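(* For $\sigma^2>1/2$ let $\rho=1-\frac1{2\sigma^2}$, let $(x_1,x_2)$ be zero-mean jointly Gaussian with covariance matrix $$\begin{bmatrix}\sigma^2&\rho\sigma^2\\ \rho\sigma^2&\sigma^2\end{bmatrix},$$ and let $x_3=x_1-x_2$ (so $x_3$ has variance $1$). Consider the problem with encoders observing $x_1,x_2,x_3$ in which the decoder reconstructs $x_3$. Let $0<d<1$ and let $R(\sigma^2,d)$ denote the minimum value of $R_1+R_2$ such that $(R_1,R_2,0,d)$ is in the rate-distortion region for the separation-based scheme. Then $$\lim_{\sigma^2\to\infty}R(\sigma^2,d)=\infty.$$
   Context: **Rate-distortion region for the separation-based scheme.** Let $\mathcal U(d)$ be the set of random vectors $\mathbf u=(u_1,u_2,u_3)$ with $u_i=\alpha_ix_i+w_i$, where $\alpha_i\in[0,1]$ and the $w_i$ are independent zero-mean Gaussian with variance $(1-\alpha_i^2)\mathrm{Var}(x_i)$, independent of $(x_1,x_2,x_3)$, such that $\mathbb E[(x_3-\mathbb E[x_3|\mathbf u])^2]\le d$. With $\mathbf v_{\mathcal A}=\{v_i:i\in\mathcal A\}$ and $\mathcal{A}^c$ the complement of $\mathcal{A}$ in $\{1,2,3\}$, let $$\mathcal{RD}_{\rm in}=\Big\{(R_1,R_2,R_3,d):\exists\,\mathbf u\in\mathcal U(d)\text{ such that }\forall\mathcal A\subseteq\{1,2,3\},\ \sum_{i\in\mathcal A}R_i\ge I(\mathbf x_{\mathcal A};\mathbf u_{\mathcal A}\mid\mathbf u_{\mathcal A^c})\Big\}.$$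 The rate-distortion region for the separation-based scheme (Gaussian vector quantization followed by Slepian-Wolf binning) is the closure of the convex hull of $\mathcal{RD}_{\rm in}$. *)

theory Defs
  imports "HOL-Probability.Probability"
begin

text \<open>The variance \<open>v = 0\<close> is the degenerate case of an (almost surely) constant variable, for which
  \<^const>\<open>normal_density\<close> is not a density.\<close>

definition gaussian :: "'a measure \<Rightarrow> ('a \<Rightarrow> real) \<Rightarrow> real \<Rightarrow> real \<Rightarrow> bool" where
  "gaussian M X \<mu> v \<longleftrightarrow>
     X \<in> borel_measurable M \<and>
     (if v = 0 then AE \<omega> in M. X \<omega> = \<mu>
      else 0 < v \<and> distributed M lborel X (normal_density \<mu> (sqrt v)))"

text \<open>For the positive definite matrix \<open>K = [[a, b], [b, c]]\<close> this is
  \<open>exp (- z\<^sup>T K\<^sup>-\<^sup>1 z / 2) / (2 \<pi> sqrt (det K))\<close> at \<open>z = (x, y)\<close>, the density of the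
  zero-mean bivariate normal distribution with covariance matrix \<open>K\<close>.\<close>

definition binormal_density :: "real \<Rightarrow> real \<Rightarrow> real \<Rightarrow> real \<times> real \<Rightarrow> real" where
  "binormal_density a b c = (\<lambda>(x, y).
     exp (- (c * x\<^sup>2 - 2 * b * x * y + a * y\<^sup>2) / (2 * (a * c - b\<^sup>2)))
       / (2 * pi * sqrt (a * c - b\<^sup>2)))"


text \<open>\<^const>\<open>KL_divergence\<close> is real-valued and meaningful only if the divergence is finite. The
  negative part of the log-likelihood ratio is always integrable with respect to \<open>N\<close>, so if \<open>N\<close> is
  absolutely continuous and the log-likelihood ratio is not integrable, the divergence is infinite.\<close>

definition eKL_divergence :: "real \<Rightarrow> 'a measure \<Rightarrow> 'a measure \<Rightarrow> ereal" where
  "eKL_divergence b M N =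
     (if absolutely_continuous M N \<and> integrable N (entropy_density b M N)
      then ereal (KL_divergence b M N) else \<infinity>)"

definition emutual_information ::
  "'a measure \<Rightarrow> 'b measure \<Rightarrow> 'c measure \<Rightarrow> ('a \<Rightarrow> 'b) \<Rightarrow> ('a \<Rightarrow> 'c) \<Rightarrow> ereal" where
  "emutual_information M S T X Y =
     eKL_divergence 2 (distr M S X \<Otimes>\<^sub>M distr M T Y) (distr M (S \<Otimes>\<^sub>M T) (\<lambda>\<omega>. (X \<omega>, Y \<omega>)))"

text \<open>As for \<^const>\<open>prob_space.conditional_mutual_information\<close>, conditional mutual information is
  given by the chain rule. The formula is meaningful if \<open>I(X; Z)\<close> is finite; otherwise its value
  is \<open>\<infinity> - \<infinity> = \<infinity>\<close>.\<close>

definition econditional_mutual_information ::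
  "'a measure \<Rightarrow> 'b measure \<Rightarrow> 'c measure \<Rightarrow> 'd measure \<Rightarrow>
   ('a \<Rightarrow> 'b) \<Rightarrow> ('a \<Rightarrow> 'c) \<Rightarrow> ('a \<Rightarrow> 'd) \<Rightarrow> ereal" where
  "econditional_mutual_information M S T U X Y Z =
     emutual_information M S (T \<Otimes>\<^sub>M U) X (\<lambda>\<omega>. (Y \<omega>, Z \<omega>)) - emutual_information M S U X Z"


abbreviation users :: "nat set" where
  "users \<equiv> {1, 2, 3}"

abbreviation subvector :: "nat set \<Rightarrow> (nat \<Rightarrow> 'a \<Rightarrow> real) \<Rightarrow> 'a \<Rightarrow> nat \<Rightarrow> real" where
  "subvector A v \<equiv> (\<lambda>\<omega>. \<lambda>i\<in>A. v i \<omega>)"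

abbreviation vec_space :: "nat set \<Rightarrow> (nat \<Rightarrow> real) measure" where
  "vec_space A \<equiv> (\<Pi>\<^sub>M i\<in>A. borel)"

definition mmse :: "'a measure \<Rightarrow> ('a \<Rightarrow> real) \<Rightarrow> (nat \<Rightarrow> 'a \<Rightarrow> real) \<Rightarrow> real" where
  "mmse M X u =
     (\<integral>\<omega>. (X \<omega> - real_cond_exp M (vimage_algebra (space M) (subvector users u) (vec_space users)) X \<omega>)\<^sup>2 \<partial>M)"

definition test_channels ::
  "'a measure \<Rightarrow> (nat \<Rightarrow> 'a \<Rightarrow> real) \<Rightarrow> real \<Rightarrow> (nat \<Rightarrow> 'a \<Rightarrow> real) set" where
  "test_channels M x d =
     {u. (\<exists>\<alpha> w.
            (\<forall>i\<in>users. 0 \<le> \<alpha> i \<and> \<alpha> i \<le> 1) \<and>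
            (\<forall>i\<in>users. gaussian M (w i) 0 ((1 - (\<alpha> i)\<^sup>2) * prob_space.variance M (x i))) \<and>
            prob_space.indep_vars M (\<lambda>_. borel) w users \<and>
            prob_space.indep_var M (vec_space users) (subvector users w)
                                   (vec_space users) (subvector users x) \<and>
            (\<forall>i\<in>users. u i = (\<lambda>\<omega>. \<alpha> i * x i \<omega> + w i \<omega>))) \<and>
         mmse M (x 3) u \<le> d}"

definition difference_source :: "real \<Rightarrow> 'a measure \<Rightarrow> (nat \<Rightarrow> 'a \<Rightarrow> real) \<Rightarrow> bool" where
  "difference_source \<sigma>2 M x \<longleftrightarrow>
     prob_space M \<and>
     (let \<rho> = 1 - 1 / (2 * \<sigma>2) in
        distributed M (lborel \<Otimes>\<^sub>M lborel) (\<lambda>\<omega>. (x 1 \<omega>, x 2 \<omega>))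
          (binormal_density \<sigma>2 (\<rho> * \<sigma>2) \<sigma>2)) \<and>
     x 3 = (\<lambda>\<omega>. x 1 \<omega> - x 2 \<omega>)"

text \<open>The rate constraints and the distortion depend only on the joint law of \<open>(x, u)\<close>; every such
  law is realized on a probability space over \<^typ>\<open>nat \<Rightarrow> real\<close>. The constraints are unaffected by
  the values \<open>\<infinity> - \<infinity>\<close>: those arise only if \<open>\<alpha> i = 1\<close> for some \<open>i\<close>, and then the constraint for
  \<open>A = {1, 2, 3}\<close>, whose right-hand side is \<open>I(x; u) = \<infinity>\<close>, is not satisfied.\<close>

definition RD_in :: "real \<Rightarrow> (real \<times> real \<times> real \<times> real) set" where
  "RD_in \<sigma>2 =
     {(R 1, R 2, R 3, d) | R d.
        \<exists>(M :: (nat \<Rightarrow> real) measure) x u.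
          difference_source \<sigma>2 M x \<and> u \<in> test_channels M x d \<and>
          (\<forall>A\<subseteq>users.
             econditional_mutual_information M (vec_space A) (vec_space A) (vec_space (users - A))
               (subvector A x) (subvector A u) (subvector (users - A) u)
             \<le> ereal (\<Sum>i\<in>A. R i))}"

definition RD_region :: "real \<Rightarrow> (real \<times> real \<times> real \<times> real) set" where
  "RD_region \<sigma>2 = closure (convex hull (RD_in \<sigma>2))"

definition min_sum_rate :: "real \<Rightarrow> real \<Rightarrow> real" where
  "min_sum_rate \<sigma>2 d =
     (LEAST r. \<exists>R1 R2. r = R1 + R2 \<and> (R1, R2, 0, d) \<in> RD_region \<sigma>2)"

end

theory Submission
  imports Defs
begin

text \<open>A minimal sum rate exists because the rate-distortion region is closed, contains a point with
  \<open>R\<^sub>3 = 0\<close> and has nonnegative rates, so it suffices to bound \<open>R\<^sub>1 + R\<^sub>2\<close> from below by an affine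
  function of \<open>R\<^sub>3\<close> and \<open>d\<close>: such a bound passes from \<open>RD_in\<close> to the closed convex hull.

  For a test channel with parameters \<open>\<alpha>\<^sub>i\<close> put \<open>S = \<alpha>\<^sub>1\<^sup>2 / ((1 - \<alpha>\<^sub>1\<^sup>2) \<sigma>\<^sup>2)\<close>. On the one hand
  \<open>R\<^sub>1 + R\<^sub>2 + R\<^sub>3 \<ge> I(x; u) \<ge> I(x\<^sub>1; u\<^sub>1) = log\<^sub>2 (1 + S \<sigma>\<^sup>2) / 2\<close>. On the other hand
  \<open>R\<^sub>3 \<ge> I(x\<^sub>3; u) - I(x\<^sub>3; u\<^sub>1, u\<^sub>2)\<close>, where \<open>I(x\<^sub>3; u) \<ge> - log\<^sub>2 d / 2\<close>, while the genie-aided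
  bound \<open>I(x\<^sub>3; u\<^sub>1, u\<^sub>2) \<le> I(x\<^sub>3; u\<^sub>1, x\<^sub>2)\<close> is at most of order \<open>S\<close>, up to a term that vanishes as
  \<open>\<sigma>\<^sup>2 \<rightarrow> \<infinity>\<close>. So a distortion \<open>d < 1\<close> with \<open>R\<^sub>3 = 0\<close> forces \<open>S\<close> to be bounded away from \<open>0\<close>,
  and then the sum rate grows like \<open>log\<^sub>2 \<sigma>\<^sup>2\<close>.\<close>

section \<open>Kullback--Leibler divergence\<close>

text \<open>A point of the region with \<open>R3 = 0\<close> may average points of different
  distortions, some above 1, and may be a limit of points with \<open>R3 > 0\<close>. So the bound
  has to be affine in the distortion, quantitative in \<open>R3\<close>, and available with
  arbitrarily large slope \<open>c\<close>. The sum rate is only logarithmic in \<open>S\<close>;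
  capping \<open>S\<close> at 1 and using concavity of the logarithm yields the linear estimate
  \<open>c * min 1 S\<close>, for every \<open>c\<close> up to \<open>log 2 (1 + s) / 2\<close>,
  where \<open>s\<close> is the source variance. The genie is cheap because
  \<open>x3 = n + (r - 1) * x2\<close> with an innovation \<open>n\<close> of variance
  \<open>1 - 1 / (4 * s)\<close>: knowing \<open>x2\<close> removes only \<open>1 / (4 * s)\<close>
  of the unit variance of \<open>x3\<close>, and given \<open>x2\<close> the observation
  \<open>u1\<close> sees \<open>n\<close> at a signal-to-noise ratio of at most \<open>S\<close>.
  Divergences may be infinite, so no differential entropies are used. Upper bounds come from
  integrable pointwise bounds on the log-likelihood ratio, lower bounds from test functions, and
  data processing from the lower bound itself.\<close>

lemma real_density_exists:
  fixes P Q :: "'a measure"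
  assumes P: "prob_space P" and Q: "prob_space Q" and s: "sets P = sets Q"
    and ac: "absolutely_continuous Q P"
  obtains f :: "'a \<Rightarrow> real" where "f \<in> borel_measurable Q" "\<And>x. 0 \<le> f x"
    "P = density Q (\<lambda>x. ennreal (f x))" "AE x in P. 0 < f x"
    "AE x in P. entropy_density b Q P x = log b (f x)"
proof -
  interpret P: prob_space P by fact
  interpret Q: prob_space Q by fact
  obtain D where D: "D \<in> borel_measurable Q" "AE x in Q. RN_deriv Q P x = ennreal (D x)"
    "AE x in P. 0 < D x" "\<And>x. 0 \<le> D x"
    using Q.real_RN_deriv[OF P.finite_measure_axioms ac s] by metis
  have "P = density Q (RN_deriv Q P)"
    using ac s by (metis Q.density_RN_deriv)
  also have "\<dots> = density Q D"
    using D by (intro density_cong) auto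
  finally have eq: "P = density Q (\<lambda>x. ennreal (D x))" .
  have "AE x in P. RN_deriv Q P x = ennreal (D x)"
    using absolutely_continuous_AE[OF s ac D(2)] .
  then have "AE x in P. entropy_density b Q P x = log b (D x)"
    using D(4) by (auto simp: entropy_density_def)
  with eq D show thesis using that by blast
qed

text \<open>The inequality \<open>ln y \<le> y - 1\<close> at \<open>y = 1 / f x\<close> bounds
  \<open>- f * ln f\<close> by 1, and \<open>Q\<close> has mass 1. Hence only the positive part of
  the log-likelihood ratio can make a divergence infinite.\<close>

lemma log_neg_part_integrable:
  fixes f :: "'a \<Rightarrow> real"
  assumes b: "1 < b" and Q: "prob_space Q" and f[measurable]: "f \<in> borel_measurable Q"
    and nn: "\<And>x. 0 \<le> f x"
  shows "integrable (density Q f) (\<lambda>x. max 0 (- log b (f x)))"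
proof (rule integrableI_bounded)
  interpret Q: prob_space Q by fact
  have *: "f x * max 0 (- log b (f x)) \<le> 1 / ln b" for x
  proof (cases "f x = 0")
    case False
    then have p: "0 < f x" using nn[of x] by simp
    have "- ln (f x) \<le> 1 / f x - 1"
      using ln_le_minus_one[of "1 / f x"] p by (simp add: ln_div)
    then have "f x * (- ln (f x)) \<le> f x * (1 / f x - 1)"
      using p by (intro mult_left_mono) auto
    also have "\<dots> \<le> 1" using p by (simp add: algebra_simps)
    finally have "f x * (- ln (f x)) / ln b \<le> 1 / ln b"
      using b by (intro divide_right_mono) auto
    then show ?thesis using b p by (auto simp: max_def log_def)
  qed (use b in auto)
  have "(\<integral>\<^sup>+x. ennreal (norm (max 0 (- log b (f x)))) \<partial>density Q f)
      = (\<integral>\<^sup>+x. ennreal (f x * max 0 (- log b (f x))) \<partial>Q)"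
    by (subst nn_integral_density) (auto simp: ennreal_mult nn)
  also have "\<dots> \<le> (\<integral>\<^sup>+x. ennreal (1 / ln b) \<partial>Q)"
    using * by (intro nn_integral_mono ennreal_leI)
  also have "\<dots> < \<infinity>" by (simp add: Q.emeasure_space_1)
  finally show "(\<integral>\<^sup>+x. ennreal (norm (max 0 (- log b (f x)))) \<partial>density Q f) < \<infinity>" .
qed measurable

text \<open>A one-sided bound is enough: the negative part of \<open>log b f\<close> is always
  integrable, so the integrable majorant \<open>B\<close> gives finiteness of the divergence
  together with the estimate.\<close>

lemma eKL_divergence_le:
  fixes f :: "'a \<Rightarrow> real"
  assumes b: "1 < b" and Q: "prob_space Q" and f[measurable]: "f \<in> borel_measurable Q"
    and nn: "\<And>x. 0 \<le> f x" and P: "prob_space (density Q f)"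
    and le: "AE x in density Q f. log b (f x) \<le> B x" and B: "integrable (density Q f) B"
  shows "eKL_divergence b Q (density Q f) \<le> ereal (\<integral>x. B x \<partial>density Q f)"
proof -
  interpret Q: prob_space Q by fact
  interpret P: prob_space "density Q f" by fact
  have "density Q (RN_deriv Q (density Q f)) = density Q f"
    by (intro Q.density_RN_deriv absolutely_continuousI_density) auto
  then have "AE x in Q. RN_deriv Q (density Q f) x = f x"
    using nn by (intro Q.density_unique) auto
  then have e: "AE x in density Q f. entropy_density b Q (density Q f) x = log b (f x)"
    using nn by (subst AE_density) (auto simp: entropy_density_def)
  have int: "integrable (density Q f) (\<lambda>x. log b (f x))"
  proof (rule Bochner_Integration.integrable_bound)
    show "integrable (density Q f) (\<lambda>x. \<bar>B x\<bar> + max 0 (- log b (f x)))"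
      using log_neg_part_integrable[OF b Q f nn] B by auto
    show "AE x in density Q f. norm (log b (f x)) \<le> norm (\<bar>B x\<bar> + max 0 (- log b (f x)))"
      using le by eventually_elim auto
  qed measurable
  have "integrable (density Q f) (entropy_density b Q (density Q f))"
    using e int by (subst integrable_cong_AE[where g="\<lambda>x. log b (f x)"]) auto
  moreover have "absolutely_continuous Q (density Q f)"
    by (rule absolutely_continuousI_density) measurable
  moreover have "KL_divergence b Q (density Q f) \<le> (\<integral>x. B x \<partial>density Q f)"
    unfolding KL_divergence_def
  proof (rule integral_mono_AE)
    show "AE x in density Q f. entropy_density b Q (density Q f) x \<le> B x"
      using e le by eventually_elim simp
  qed fact+
  ultimately show ?thesis
    by (simp add: eKL_divergence_def)
qed

section \<open>Variational lower bound and data processing\<close>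

lemma log_le_tangent:
  assumes "1 < b" "0 < h" "0 < (f :: real)"
  shows "log b h \<le> log b f + (h / f - 1) / ln b"
proof -
  have "ln h - ln f \<le> h / f - 1"
    using ln_le_minus_one[of "h / f"] assms by (simp add: ln_div)
  then have "(ln h - ln f) / ln b \<le> (h / f - 1) / ln b"
    using assms by (intro divide_right_mono) auto
  then show ?thesis by (simp add: log_def diff_divide_distrib)
qed

text \<open>Only an inequality, because \<open>h\<close> may carry mass where \<open>f\<close>
  vanishes; there the left integrand is lost.\<close>

lemma nn_integral_likelihood_ratio_le:
  fixes f h :: "'a \<Rightarrow> real"
  assumes f[measurable]: "f \<in> borel_measurable Q" and nn: "\<And>x. 0 \<le> f x"
    and h[measurable]: "h \<in> borel_measurable Q" "\<And>x. 0 \<le> h x"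
  shows "(\<integral>\<^sup>+x. ennreal (h x / f x) \<partial>density Q f) \<le> (\<integral>\<^sup>+x. ennreal (h x) \<partial>Q)"
proof -
  have "(\<integral>\<^sup>+x. ennreal (h x / f x) \<partial>density Q f) = (\<integral>\<^sup>+x. ennreal (f x) * ennreal (h x / f x) \<partial>Q)"
    by (subst nn_integral_density) auto
  also have "\<dots> \<le> (\<integral>\<^sup>+x. ennreal (h x) \<partial>Q)"
  proof (rule nn_integral_mono)
    fix x show "ennreal (f x) * ennreal (h x / f x) \<le> ennreal (h x)"
      using nn[of x] h(2)[of x] by (cases "f x = 0") (auto simp: ennreal_mult[symmetric])
  qed
  finally show ?thesis .
qed

text \<open>The variational lower bound of Donsker and Varadhan, in the form that needs no
  normalization of \<open>h\<close>.\<close>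

lemma
  fixes h :: "'a \<Rightarrow> real"
  assumes b: "1 < b" and P: "prob_space P" and Q: "prob_space Q" and s: "sets P = sets Q"
    and h[measurable]: "h \<in> borel_measurable Q" and nn: "\<And>x. 0 \<le> h x" and pos: "AE x in P. 0 < h x"
    and c: "(\<integral>\<^sup>+x. ennreal (h x) \<partial>Q) \<le> ennreal c" "0 \<le> c"
  shows eKL_divergence_ge: "integrable P (\<lambda>x. log b (h x)) \<Longrightarrow>
      ereal ((\<integral>x. log b (h x) \<partial>P) - (c - 1) / ln b) \<le> eKL_divergence b Q P"
    and eKL_divergence_finite_imp_integrable: "eKL_divergence b Q P < \<infinity> \<Longrightarrow>
      integrable P (\<lambda>x. max 0 (log b (h x)))"
proof -
  interpret P: prob_space P by fact
  interpret Q: prob_space Q by fact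
  have [measurable]: "h \<in> borel_measurable P" using h s measurable_cong_sets by blast
  have main: "integrable P (\<lambda>x. max 0 (log b (h x))) \<and> (integrable P (\<lambda>x. log b (h x)) \<longrightarrow>
     (\<integral>x. log b (h x) \<partial>P) - (c - 1) / ln b \<le> KL_divergence b Q P)"
    if ac: "absolutely_continuous Q P" and int: "integrable P (entropy_density b Q P)"
  proof -
    obtain f :: "'a \<Rightarrow> real" where f: "f \<in> borel_measurable Q" "\<And>x. 0 \<le> f x"
      "P = density Q (\<lambda>x. ennreal (f x))" "AE x in P. 0 < f x"
      "AE x in P. entropy_density b Q P x = log b (f x)"
      using real_density_exists[OF P Q s ac] by metis
    have [measurable]: "f \<in> borel_measurable Q" "f \<in> borel_measurable P"
      using f(1) s measurable_cong_sets by blast+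
    have nl: "(\<integral>\<^sup>+x. ennreal (h x / f x) \<partial>P) \<le> ennreal c"
      using nn_integral_likelihood_ratio_le[OF f(1,2) h nn] c(1)
      unfolding f(3)[symmetric] by (rule order_trans)
    have hf: "integrable P (\<lambda>x. h x / f x)"
    proof (rule integrableI_bounded)
      have "(\<integral>\<^sup>+x. ennreal (norm (h x / f x)) \<partial>P) = (\<integral>\<^sup>+x. ennreal (h x / f x) \<partial>P)"
        using f(2) nn by (intro nn_integral_cong) simp
      also have "\<dots> < \<infinity>" using nl ennreal_less_top[of c] by (simp add: order_le_less_trans)
      finally show "(\<integral>\<^sup>+x. ennreal (norm (h x / f x)) \<partial>P) < \<infinity>" .
    qed measurable
    have hfc: "(\<integral>x. h x / f x \<partial>P) \<le> c"
    proof -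
      have "ennreal (\<integral>x. h x / f x \<partial>P) = (\<integral>\<^sup>+x. ennreal (h x / f x) \<partial>P)"
        using hf f(2) nn by (intro nn_integral_eq_integral[symmetric]) auto
      then show ?thesis using nl c(2) by (metis ennreal_le_iff)
    qed
    \<comment> \<open>Integrating this tangent bound gives the estimate. As its right-hand side is
      integrable, it also dominates the positive part of \<open>log b h\<close>, without any
      integrability assumption on \<open>log b h\<close>.\<close>
    have bd: "AE x in P. log b (h x) \<le> entropy_density b Q P x + (h x / f x - 1) / ln b"
      using f(4,5) pos by eventually_elim (use log_le_tangent[OF b] in auto)
    have rint: "integrable P (\<lambda>x. entropy_density b Q P x + (h x / f x - 1) / ln b)"
      using int hf by auto
    have "integrable P (\<lambda>x. max 0 (log b (h x)))"
    proof (rule Bochner_Integration.integrable_bound[OF rint])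
      show "AE x in P. norm (max 0 (log b (h x)))
          \<le> norm (entropy_density b Q P x + (h x / f x - 1) / ln b)"
        using bd by eventually_elim auto
    qed measurable
    moreover have "(\<integral>x. log b (h x) \<partial>P) - (c - 1) / ln b \<le> KL_divergence b Q P"
      if hi: "integrable P (\<lambda>x. log b (h x))"
    proof -
      have "(\<integral>x. log b (h x) \<partial>P) \<le> (\<integral>x. entropy_density b Q P x + (h x / f x - 1) / ln b \<partial>P)"
        by (rule integral_mono_AE[OF hi rint bd])
      also have "\<dots> = KL_divergence b Q P + ((\<integral>x. h x / f x \<partial>P) - 1) / ln b"
        using int hf by (simp add: KL_divergence_def P.prob_space)
      also have "\<dots> \<le> KL_divergence b Q P + (c - 1) / ln b"
        using hfc b by (intro add_left_mono divide_right_mono) auto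
      finally show ?thesis by simp
    qed
    ultimately show ?thesis by blast
  qed
  show "ereal ((\<integral>x. log b (h x) \<partial>P) - (c - 1) / ln b) \<le> eKL_divergence b Q P"
    if "integrable P (\<lambda>x. log b (h x))"
    using main that by (auto simp: eKL_divergence_def)
  show "integrable P (\<lambda>x. max 0 (log b (h x)))" if "eKL_divergence b Q P < \<infinity>"
    using main that by (auto simp: eKL_divergence_def split: if_splits)
qed

lemma eKL_divergence_nonneg:
  assumes "1 < b" "prob_space P" "prob_space Q" "sets P = sets Q"
  shows "0 \<le> eKL_divergence b Q P"
  using eKL_divergence_ge[OF assms, of "\<lambda>_. 1" 1] prob_space.emeasure_space_1[OF assms(3)]
  by (simp add: zero_ereal_def)

text \<open>The density \<open>f\<close> of the image measures, pulled back to \<open>f o g\<close>,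
  is a test function of total mass 1 for the variational bound, and its value there is the
  divergence of the images. The work lies in showing that \<open>log b (f o g)\<close> is
  integrable.\<close>

lemma eKL_divergence_distr_le:
  fixes P Q :: "'a measure"
  assumes b: "1 < b" and P: "prob_space P" and Q: "prob_space Q" and s: "sets P = sets Q"
    and g[measurable]: "g \<in> measurable Q T"
  shows "eKL_divergence b (distr Q T g) (distr P T g) \<le> eKL_divergence b Q P"
proof (cases "eKL_divergence b Q P < \<infinity>")
  case fin: True
  interpret P: prob_space P by fact
  interpret Q: prob_space Q by fact
  have gP[measurable]: "g \<in> measurable P T" using g s measurable_cong_sets by blast
  let ?P = "distr P T g" and ?Q = "distr Q T g"
  have P': "prob_space ?P" and Q': "prob_space ?Q"
    by (auto intro!: P.prob_space_distr Q.prob_space_distr)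
  have ac: "absolutely_continuous Q P" using fin by (auto simp: eKL_divergence_def split: if_splits)
  have ac': "absolutely_continuous ?Q ?P"
    unfolding absolutely_continuous_def
  proof
    fix A assume "A \<in> null_sets ?Q"
    then have A: "A \<in> sets T" "g -` A \<inter> space Q \<in> null_sets Q"
      by (auto simp: null_sets_distr_iff)
    then have "g -` A \<inter> space P \<in> null_sets P"
      using ac sets_eq_imp_space_eq[OF s] by (auto simp: absolutely_continuous_def)
    then show "A \<in> null_sets ?P" using A by (auto simp: null_sets_distr_iff)
  qed
  obtain f :: "'b \<Rightarrow> real" where f: "f \<in> borel_measurable ?Q" "\<And>x. 0 \<le> f x"
      "?P = density ?Q (\<lambda>x. ennreal (f x))" "AE x in ?P. 0 < f x"
      "AE x in ?P. entropy_density b ?Q ?P x = log b (f x)"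
    by (rule real_density_exists[OF P' Q' _ ac', of b]) simp_all
  have fT[measurable]: "f \<in> borel_measurable T" using f(1) by simp
  have fQ: "(\<integral>\<^sup>+x. ennreal (f (g x)) \<partial>Q) = 1"
  proof -
    have "1 = emeasure ?P (space ?P)" by (rule prob_space.emeasure_space_1[OF P', symmetric])
    also have "\<dots> = (\<integral>\<^sup>+x. ennreal (f x) \<partial>?Q)"
      by (subst (1) f(3)) (auto simp: emeasure_density intro!: nn_integral_cong split: split_indicator)
    also have "\<dots> = (\<integral>\<^sup>+x. ennreal (f (g x)) \<partial>Q)" by (subst nn_integral_distr) auto
    finally show ?thesis by simp
  qed
  have "(\<integral>\<^sup>+x. ennreal (max 1 (f (g x))) \<partial>Q) \<le> (\<integral>\<^sup>+x. 1 + ennreal (f (g x)) \<partial>Q)"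
  proof (rule nn_integral_mono)
    fix x
    have *: "max 1 (f (g x)) \<le> 1 + f (g x)" using f(2)[of "g x"] by auto
    then show "ennreal (max 1 (f (g x))) \<le> 1 + ennreal (f (g x))"
      using ennreal_leI[OF *] f(2)[of "g x"] by simp
  qed
  also have "\<dots> = ennreal 2"
    by (subst nn_integral_add) (auto simp: fQ Q.emeasure_space_1)
  \<comment> \<open>The function \<open>max 1 (f (g x))\<close> is positive everywhere, has
    \<open>Q\<close>-mass at most 2, and its logarithm is the positive part of
    \<open>log b (f (g x))\<close>.\<close>
  finally have *: "integrable P (\<lambda>x. max 0 (log b (max 1 (f (g x)))))"
    by (rule eKL_divergence_finite_imp_integrable[OF b P Q s _ _ _ _ _ fin, rotated 3]) auto
  have le: "AE x in ?P. log b (f x) \<le> max 0 (log b (max 1 (f x)))"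
    using f(4) by eventually_elim (use b in auto)
  have intf: "integrable ?P (\<lambda>x. log b (f x))"
  proof -
    have B: "integrable ?P (\<lambda>x. max 0 (log b (max 1 (f x))))"
      using * by (subst integrable_distr_eq) auto
    have N: "integrable ?P (\<lambda>x. max 0 (- log b (f x)))"
      using log_neg_part_integrable[OF b Q' f(1,2)] f(3) by simp
    show ?thesis
    proof (rule Bochner_Integration.integrable_bound[OF Bochner_Integration.integrable_add[OF B N]])
      show "AE x in ?P. norm (log b (f x))
          \<le> norm (max 0 (log b (max 1 (f x))) + max 0 (- log b (f x)))"
        using le by eventually_elim auto
    qed simp
  qed
  have eint: "integrable ?P (entropy_density b ?Q ?P)"
    using f(5) intf by (subst integrable_cong_AE[where g="\<lambda>x. log b (f x)"]) auto
  have "KL_divergence b ?Q ?P = (\<integral>x. log b (f x) \<partial>?P)"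
    unfolding KL_divergence_def using f(5) by (intro integral_cong_AE) auto
  also have "\<dots> = (\<integral>x. log b (f (g x)) \<partial>P)" by (subst integral_distr) auto
  finally have KL: "KL_divergence b ?Q ?P = (\<integral>x. log b (f (g x)) \<partial>P)" .
  have "AE x in P. 0 < f (g x)" using f(4) by (simp add: AE_distr_iff)
  moreover have "integrable P (\<lambda>x. log b (f (g x)))" using intf by (subst (asm) integrable_distr_eq) auto
  ultimately have "ereal ((\<integral>x. log b (f (g x)) \<partial>P) - (1 - 1) / ln b) \<le> eKL_divergence b Q P"
    using f(2) fQ by (intro eKL_divergence_ge[OF b P Q s]) auto
  then show ?thesis using ac' eint KL by (simp add: eKL_divergence_def)
qed auto

section \<open>Independence and mutual information\<close>

text \<open>The library's \<open>indep_var\<close> only relates random variables with values in the same type.\<close>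

definition indep_rv :: "'a measure \<Rightarrow> 'b measure \<Rightarrow> ('a \<Rightarrow> 'b) \<Rightarrow> 'c measure \<Rightarrow> ('a \<Rightarrow> 'c) \<Rightarrow> bool" where
  "indep_rv M S X T Y \<longleftrightarrow> X \<in> measurable M S \<and> Y \<in> measurable M T \<and>
     distr M S X \<Otimes>\<^sub>M distr M T Y = distr M (S \<Otimes>\<^sub>M T) (\<lambda>\<omega>. (X \<omega>, Y \<omega>))"

lemma indep_rvD:
  assumes "indep_rv M S X T Y"
  shows "X \<in> measurable M S" "Y \<in> measurable M T"
    "distr M S X \<Otimes>\<^sub>M distr M T Y = distr M (S \<Otimes>\<^sub>M T) (\<lambda>\<omega>. (X \<omega>, Y \<omega>))"
  using assms by (auto simp: indep_rv_def)

lemma (in prob_space) indep_rv_iff_indep_var: "indep_rv M S X T Y \<longleftrightarrow> indep_var S X T Y"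
  by (auto simp: indep_rv_def indep_var_distribution_eq)

lemma (in prob_space) indep_rv_compose:
  assumes ind: "indep_rv M S X T Y" and [measurable]: "f \<in> measurable S S'" "g \<in> measurable T T'"
  shows "indep_rv M S' (\<lambda>\<omega>. f (X \<omega>)) T' (\<lambda>\<omega>. g (Y \<omega>))"
proof -
  note [measurable] = indep_rvD(1,2)[OF ind]
  interpret X: prob_space "distr M S X" by (intro prob_space_distr) simp
  interpret Y: prob_space "distr M T Y" by (intro prob_space_distr) simp
  interpret Y': prob_space "distr (distr M T Y) T' g" by (intro Y.prob_space_distr) simp
  have "distr M S' (\<lambda>\<omega>. f (X \<omega>)) \<Otimes>\<^sub>M distr M T' (\<lambda>\<omega>. g (Y \<omega>))
      = distr (distr M S X) S' f \<Otimes>\<^sub>M distr (distr M T Y) T' g"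
    by (simp add: distr_distr comp_def)
  also have "\<dots> = distr (distr M S X \<Otimes>\<^sub>M distr M T Y) (S' \<Otimes>\<^sub>M T') (\<lambda>(x, y). (f x, g y))"
    by (rule pair_measure_distr) (auto intro: Y'.sigma_finite_measure_axioms)
  also have "\<dots> = distr M (S' \<Otimes>\<^sub>M T') (\<lambda>\<omega>. (f (X \<omega>), g (Y \<omega>)))"
    unfolding indep_rvD(3)[OF ind] by (simp add: distr_distr comp_def)
  finally show ?thesis by (simp add: indep_rv_def)
qed

lemma (in prob_space) indep_rv_swap:
  assumes ind: "indep_rv M S X T Y"
  shows "indep_rv M T Y S X"
proof -
  note [measurable] = indep_rvD(1,2)[OF ind]
  interpret X: prob_space "distr M S X" by (intro prob_space_distr) simp
  interpret Y: prob_space "distr M T Y" by (intro prob_space_distr) simp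
  interpret YX: pair_prob_space "distr M T Y" "distr M S X" ..
  have "distr M T Y \<Otimes>\<^sub>M distr M S X = distr (distr M S X \<Otimes>\<^sub>M distr M T Y) (T \<Otimes>\<^sub>M S) (\<lambda>(x, y). (y, x))"
    by (subst YX.distr_pair_swap) (auto intro!: distr_cong sets_pair_measure_cong)
  also have "\<dots> = distr M (T \<Otimes>\<^sub>M S) (\<lambda>\<omega>. (Y \<omega>, X \<omega>))"
    unfolding indep_rvD(3)[OF ind] by (simp add: distr_distr comp_def)
  finally show ?thesis by (simp add: indep_rv_def)
qed

lemma pair_measure_assoc:
  assumes "prob_space A" "prob_space B" "prob_space C"
  shows "A \<Otimes>\<^sub>M (B \<Otimes>\<^sub>M C) = distr ((A \<Otimes>\<^sub>M B) \<Otimes>\<^sub>M C) (A \<Otimes>\<^sub>M (B \<Otimes>\<^sub>M C)) (\<lambda>v. (fst (fst v), (snd (fst v), snd v)))"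
    (is "?L = ?R")
proof (rule measure_eqI)
  fix D assume "D \<in> sets ?L"
  then have [measurable]: "D \<in> sets (A \<Otimes>\<^sub>M (B \<Otimes>\<^sub>M C))" by simp
  interpret A: prob_space A by fact
  interpret B: prob_space B by fact
  interpret C: prob_space C by fact
  interpret AB: pair_prob_space A B ..
  interpret BC: pair_prob_space B C ..
  have "emeasure ?L D = (\<integral>\<^sup>+x. \<integral>\<^sup>+v. indicator D (x, v) \<partial>(B \<Otimes>\<^sub>M C) \<partial>A)"
    by (rule BC.emeasure_pair_measure) simp
  also have "\<dots> = (\<integral>\<^sup>+x. \<integral>\<^sup>+y. \<integral>\<^sup>+z. indicator D (x, (y, z)) \<partial>C \<partial>B \<partial>A)"
    by (intro nn_integral_cong, subst C.nn_integral_fst[symmetric]) auto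
  also have "\<dots> = (\<integral>\<^sup>+w. \<integral>\<^sup>+z. indicator D (fst w, (snd w, z)) \<partial>C \<partial>(A \<Otimes>\<^sub>M B))"
    by (subst B.nn_integral_fst[symmetric]) auto
  also have "\<dots> = (\<integral>\<^sup>+w. indicator D (fst (fst w), (snd (fst w), snd w)) \<partial>((A \<Otimes>\<^sub>M B) \<Otimes>\<^sub>M C))"
    by (subst C.nn_integral_fst[symmetric]) auto
  also have "\<dots> = (\<integral>\<^sup>+v. indicator D v \<partial>?R)"
    by (subst nn_integral_distr) (auto simp: case_prod_beta')
  also have "\<dots> = emeasure ?R D" by simp
  finally show "emeasure ?L D = emeasure ?R D" .
qed simp

text \<open>Both hypotheses together say that the law of the triple is a threefold product, which
  may be bracketed either way. This regroups mutually independent blocks.\<close>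

lemma (in prob_space) indep_rv_assoc:
  assumes XY: "indep_rv M S X T Y" and XYZ: "indep_rv M (S \<Otimes>\<^sub>M T) (\<lambda>\<omega>. (X \<omega>, Y \<omega>)) U Z"
  shows "indep_rv M S X (T \<Otimes>\<^sub>M U) (\<lambda>\<omega>. (Y \<omega>, Z \<omega>))"
proof -
  note [measurable] = indep_rvD(1,2)[OF XY] indep_rvD(2)[OF XYZ]
  have "indep_rv M T (\<lambda>\<omega>. snd (X \<omega>, Y \<omega>)) U (\<lambda>\<omega>. Z \<omega>)"
    by (rule indep_rv_compose[OF XYZ]) auto
  then have YZ: "indep_rv M T Y U Z" by simp
  have "distr M S X \<Otimes>\<^sub>M distr M (T \<Otimes>\<^sub>M U) (\<lambda>\<omega>. (Y \<omega>, Z \<omega>))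
      = distr M S X \<Otimes>\<^sub>M (distr M T Y \<Otimes>\<^sub>M distr M U Z)"
    using indep_rvD(3)[OF YZ] by simp
  also have "\<dots> = distr ((distr M S X \<Otimes>\<^sub>M distr M T Y) \<Otimes>\<^sub>M distr M U Z)
      (distr M S X \<Otimes>\<^sub>M (distr M T Y \<Otimes>\<^sub>M distr M U Z)) (\<lambda>v. (fst (fst v), (snd (fst v), snd v)))"
    by (intro pair_measure_assoc prob_space_distr) simp_all
  also have "\<dots> = distr (distr M ((S \<Otimes>\<^sub>M T) \<Otimes>\<^sub>M U) (\<lambda>\<omega>. ((X \<omega>, Y \<omega>), Z \<omega>)))
      (S \<Otimes>\<^sub>M (T \<Otimes>\<^sub>M U)) (\<lambda>v. (fst (fst v), (snd (fst v), snd v)))"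
    unfolding indep_rvD(3)[OF XY] indep_rvD(3)[OF XYZ]
    by (intro distr_cong sets_pair_measure_cong) (auto simp: indep_rvD(3)[OF YZ])
  also have "\<dots> = distr M (S \<Otimes>\<^sub>M (T \<Otimes>\<^sub>M U)) (\<lambda>\<omega>. (X \<omega>, (Y \<omega>, Z \<omega>)))"
    by (simp add: distr_distr comp_def)
  finally show ?thesis by (simp add: indep_rv_def)
qed

text \<open>Obtained from \<open>indep_rv_assoc\<close> by reversing the order of the three
  blocks.\<close>

lemma (in prob_space) indep_rv_assoc':
  assumes YZ: "indep_rv M T Y U Z" and XYZ: "indep_rv M S X (T \<Otimes>\<^sub>M U) (\<lambda>\<omega>. (Y \<omega>, Z \<omega>))"
  shows "indep_rv M (S \<Otimes>\<^sub>M T) (\<lambda>\<omega>. (X \<omega>, Y \<omega>)) U Z"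
proof -
  have "indep_rv M (U \<Otimes>\<^sub>M T) (\<lambda>\<omega>. (\<lambda>(y, z). (z, y)) (Y \<omega>, Z \<omega>)) S (\<lambda>\<omega>. X \<omega>)"
    by (rule indep_rv_compose[OF indep_rv_swap[OF XYZ]]) auto
  then have "indep_rv M U Z (T \<Otimes>\<^sub>M S) (\<lambda>\<omega>. (Y \<omega>, X \<omega>))"
    by (intro indep_rv_assoc[OF indep_rv_swap[OF YZ]]) simp
  then have "indep_rv M (S \<Otimes>\<^sub>M T) (\<lambda>\<omega>. (\<lambda>(y, x). (x, y)) (Y \<omega>, X \<omega>)) U (\<lambda>\<omega>. Z \<omega>)"
    by (rule indep_rv_compose[OF indep_rv_swap]) simp_all
  then show ?thesis by simp
qed

text \<open>Subvectors over the empty index set are constant; this makes their information vanish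
  when \<open>A\<close> or its complement is empty.\<close>

lemma (in prob_space) indep_rv_const:
  assumes [measurable]: "Y \<in> measurable M T" and c: "c \<in> space S"
  shows "indep_rv M S (\<lambda>_. c) T Y"
proof -
  have [measurable]: "(\<lambda>_. c) \<in> measurable M S" using c by simp
  have "distr M S (\<lambda>_. c) \<Otimes>\<^sub>M distr M T Y = distr M (S \<Otimes>\<^sub>M T) (\<lambda>\<omega>. (c, Y \<omega>))"
  proof (rule pair_measure_eqI)
    show "sigma_finite_measure (distr M S (\<lambda>_. c))" "sigma_finite_measure (distr M T Y)"
      by (auto intro!: prob_space_imp_sigma_finite prob_space_distr)
    fix A B assume "A \<in> sets (distr M S (\<lambda>_. c))" "B \<in> sets (distr M T Y)"
    then have [measurable]: "A \<in> sets S" "B \<in> sets T" by auto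
    show "emeasure (distr M S (\<lambda>_. c)) A * emeasure (distr M T Y) B
        = emeasure (distr M (S \<Otimes>\<^sub>M T) (\<lambda>\<omega>. (c, Y \<omega>))) (A \<times> B)"
      by (cases "c \<in> A") (auto simp: emeasure_distr vimage_def Int_def emeasure_space_1 cong: conj_cong)
  qed (simp cong: sets_pair_measure_cong)
  then show ?thesis by (simp add: indep_rv_def)
qed

section \<open>Mutual information: positivity, data processing, symmetry, independent
  components\<close>

lemma emutual_information_nonneg:
  assumes "prob_space M" and [measurable]: "X \<in> measurable M S" "Y \<in> measurable M T"
  shows "0 \<le> emutual_information M S T X Y"
proof -
  interpret prob_space M by fact
  interpret X: prob_space "distr M S X" by (intro prob_space_distr) simp
  interpret Y: prob_space "distr M T Y" by (intro prob_space_distr) simp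
  interpret XY: pair_prob_space "distr M S X" "distr M T Y" ..
  show ?thesis
    unfolding emutual_information_def
    by (intro eKL_divergence_nonneg prob_space_distr XY.prob_space_axioms) auto
qed

text \<open>A map that acts on the two coordinates separately sends the product of the marginals to
  the product of the image marginals, so this is data processing for the divergence.\<close>

lemma emutual_information_mono:
  assumes "prob_space M" and [measurable]: "X \<in> measurable M S" "Y \<in> measurable M T"
    and [measurable]: "f \<in> measurable S S'" "g \<in> measurable T T'"
  shows "emutual_information M S' T' (\<lambda>\<omega>. f (X \<omega>)) (\<lambda>\<omega>. g (Y \<omega>)) \<le> emutual_information M S T X Y"
proof -
  interpret prob_space M by fact
  interpret X: prob_space "distr M S X" by (intro prob_space_distr) simp
  interpret Y: prob_space "distr M T Y" by (intro prob_space_distr) simp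
  interpret XY: pair_prob_space "distr M S X" "distr M T Y" ..
  interpret Y': prob_space "distr (distr M T Y) T' g" by (intro Y.prob_space_distr) simp
  let ?h = "\<lambda>(x, y). (f x, g y)"
  have "eKL_divergence 2
      (distr (distr M S X \<Otimes>\<^sub>M distr M T Y) (S' \<Otimes>\<^sub>M T') ?h)
      (distr (distr M (S \<Otimes>\<^sub>M T) (\<lambda>\<omega>. (X \<omega>, Y \<omega>))) (S' \<Otimes>\<^sub>M T') ?h)
    \<le> emutual_information M S T X Y"
    unfolding emutual_information_def
    by (intro eKL_divergence_distr_le prob_space_distr XY.prob_space_axioms) auto
  also have "distr (distr M S X \<Otimes>\<^sub>M distr M T Y) (S' \<Otimes>\<^sub>M T') ?h
      = distr (distr M S X) S' f \<Otimes>\<^sub>M distr (distr M T Y) T' g"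
    by (rule pair_measure_distr[symmetric]) (auto intro: Y'.sigma_finite_measure_axioms)
  also have "\<dots> = distr M S' (\<lambda>\<omega>. f (X \<omega>)) \<Otimes>\<^sub>M distr M T' (\<lambda>\<omega>. g (Y \<omega>))"
    by (simp add: distr_distr comp_def)
  also have "distr (distr M (S \<Otimes>\<^sub>M T) (\<lambda>\<omega>. (X \<omega>, Y \<omega>))) (S' \<Otimes>\<^sub>M T') ?h
      = distr M (S' \<Otimes>\<^sub>M T') (\<lambda>\<omega>. (f (X \<omega>), g (Y \<omega>)))"
    by (simp add: distr_distr comp_def)
  finally show ?thesis by (simp add: emutual_information_def)
qed

text \<open>Data processing under the swap of coordinates.\<close>

lemma emutual_information_commute_le:
  assumes "prob_space M" and [measurable]: "X \<in> measurable M S" "Y \<in> measurable M T"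
  shows "emutual_information M T S Y X \<le> emutual_information M S T X Y"
proof -
  interpret prob_space M by fact
  interpret X: prob_space "distr M S X" by (intro prob_space_distr) simp
  interpret Y: prob_space "distr M T Y" by (intro prob_space_distr) simp
  interpret XY: pair_prob_space "distr M S X" "distr M T Y" ..
  interpret YX: pair_prob_space "distr M T Y" "distr M S X" ..
  let ?h = "\<lambda>(x, y). (y, x)"
  have "eKL_divergence 2
      (distr (distr M S X \<Otimes>\<^sub>M distr M T Y) (T \<Otimes>\<^sub>M S) ?h)
      (distr (distr M (S \<Otimes>\<^sub>M T) (\<lambda>\<omega>. (X \<omega>, Y \<omega>))) (T \<Otimes>\<^sub>M S) ?h)
    \<le> emutual_information M S T X Y"
    unfolding emutual_information_def
    by (intro eKL_divergence_distr_le prob_space_distr XY.prob_space_axioms) auto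
  also have "distr (distr M S X \<Otimes>\<^sub>M distr M T Y) (T \<Otimes>\<^sub>M S) ?h = distr M T Y \<Otimes>\<^sub>M distr M S X"
    by (subst YX.distr_pair_swap) (auto intro!: distr_cong)
  also have "distr (distr M (S \<Otimes>\<^sub>M T) (\<lambda>\<omega>. (X \<omega>, Y \<omega>))) (T \<Otimes>\<^sub>M S) ?h
      = distr M (T \<Otimes>\<^sub>M S) (\<lambda>\<omega>. (Y \<omega>, X \<omega>))"
    by (simp add: distr_distr comp_def)
  finally show ?thesis by (simp add: emutual_information_def)
qed

lemma emutual_information_indep_rv:
  assumes "prob_space M" and ind: "indep_rv M S X T Y"
  shows "emutual_information M S T X Y = 0"
proof -
  interpret prob_space M by fact
  have eq: "distr M S X \<Otimes>\<^sub>M distr M T Y = distr M (S \<Otimes>\<^sub>M T) (\<lambda>\<omega>. (X \<omega>, Y \<omega>))"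
    and m[measurable]: "X \<in> measurable M S" "Y \<in> measurable M T"
    using ind by (auto simp: indep_rv_def)
  interpret P: prob_space "distr M (S \<Otimes>\<^sub>M T) (\<lambda>\<omega>. (X \<omega>, Y \<omega>))"
    by (intro prob_space_distr) simp
  let ?P = "distr M (S \<Otimes>\<^sub>M T) (\<lambda>\<omega>. (X \<omega>, Y \<omega>))"
  have "density ?P (\<lambda>x. ennreal 1) = ?P" by (simp add: density_1)
  then have "eKL_divergence 2 ?P ?P \<le> 0"
    using eKL_divergence_le[of 2 ?P "\<lambda>_. 1" "\<lambda>_. 0"] P.prob_space_axioms by (simp add: zero_ereal_def)
  then show ?thesis
    using emutual_information_nonneg[OF \<open>prob_space M\<close> m] eq
    by (simp add: emutual_information_def)
qed

text \<open>A common independent factor \<open>R\<close> leaves the density unchanged: it is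
  \<open>f o fst\<close>, and its logarithm has the same integral.\<close>

lemma eKL_divergence_pair_le:
  assumes b: "1 < b" and P: "prob_space P" and Q: "prob_space Q" and R: "prob_space R"
    and s: "sets P = sets Q"
  shows "eKL_divergence b (Q \<Otimes>\<^sub>M R) (P \<Otimes>\<^sub>M R) \<le> eKL_divergence b Q P"
proof (cases "eKL_divergence b Q P < \<infinity>")
  case fin: True
  interpret P: prob_space P by fact
  interpret Q: prob_space Q by fact
  interpret R: prob_space R by fact
  interpret QR: pair_prob_space Q R ..
  interpret PR: pair_prob_space P R ..
  have ac: "absolutely_continuous Q P" and int: "integrable P (entropy_density b Q P)"
    using fin by (auto simp: eKL_divergence_def split: if_splits)
  obtain f :: "'a \<Rightarrow> real" where f: "f \<in> borel_measurable Q" "\<And>x. 0 \<le> f x"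
      "P = density Q (\<lambda>x. ennreal (f x))" "AE x in P. 0 < f x"
      "AE x in P. entropy_density b Q P x = log b (f x)"
    using real_density_exists[OF P Q s ac] by metis
  have [measurable]: "f \<in> borel_measurable Q" "f \<in> borel_measurable P"
    using f(1) s measurable_cong_sets by blast+
  have intf: "integrable P (\<lambda>x. log b (f x))"
    using f(5) int s by (subst integrable_cong_AE[where g="entropy_density b Q P"]) auto
  have "P \<Otimes>\<^sub>M R = density Q (\<lambda>x. ennreal (f x)) \<Otimes>\<^sub>M density R (\<lambda>_. 1)"
    using f(3) by (simp add: density_1)
  also have "\<dots> = density (Q \<Otimes>\<^sub>M R) (\<lambda>(x, y). ennreal (f x) * 1)"
    using f(3) P.sigma_finite_measure_axioms R.sigma_finite_measure_axioms
    by (intro pair_measure_density) (auto simp: density_1)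
  finally have eq: "P \<Otimes>\<^sub>M R = density (Q \<Otimes>\<^sub>M R) (\<lambda>z. ennreal (f (fst z)))"
    by (simp add: case_prod_beta')
  have fst: "distr (P \<Otimes>\<^sub>M R) P fst = P"
    by (rule R.distr_pair_fst)
  have i: "integrable (P \<Otimes>\<^sub>M R) (\<lambda>z. log b (f (fst z)))"
    using intf fst integrable_distr[of fst "P \<Otimes>\<^sub>M R" P "\<lambda>x. log b (f x)"] by simp
  have "eKL_divergence b (Q \<Otimes>\<^sub>M R) (P \<Otimes>\<^sub>M R) \<le> ereal (\<integral>z. log b (f (fst z)) \<partial>(P \<Otimes>\<^sub>M R))"
    unfolding eq
    by (rule eKL_divergence_le[OF b QR.prob_space_axioms])
      (use i PR.prob_space_axioms f(2) in \<open>auto simp: eq\<close>)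
  also have "(\<integral>z. log b (f (fst z)) \<partial>(P \<Otimes>\<^sub>M R)) = (\<integral>x. log b (f x) \<partial>distr (P \<Otimes>\<^sub>M R) P fst)"
    by (rule integral_distr[symmetric]) auto
  also have "\<dots> = (\<integral>x. entropy_density b Q P x \<partial>P)"
    unfolding fst using f(5) s by (intro integral_cong_AE) auto
  also have "ereal \<dots> = eKL_divergence b Q P"
    using ac int by (simp add: eKL_divergence_def KL_divergence_def)
  finally show ?thesis .
qed auto

text \<open>After rebracketing, the joint law and the product of the marginals share the law of
  \<open>Y\<close> as a factor, which the preceding lemma removes. This discards an encoder that
  sends pure noise.\<close>

lemma emutual_information_indep_rv_le:
  assumes "prob_space M" and XZ[measurable]: "X \<in> measurable M S" "Z \<in> measurable M U"
    and ind: "indep_rv M (S \<Otimes>\<^sub>M U) (\<lambda>\<omega>. (X \<omega>, Z \<omega>)) T Y"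
  shows "emutual_information M S (T \<Otimes>\<^sub>M U) X (\<lambda>\<omega>. (Y \<omega>, Z \<omega>)) \<le> emutual_information M S U X Z"
proof -
  interpret prob_space M by fact
  note [measurable] = indep_rvD(2)[OF ind]
  have "indep_rv M U (\<lambda>\<omega>. snd (X \<omega>, Z \<omega>)) T (\<lambda>\<omega>. Y \<omega>)"
    by (rule indep_rv_compose[OF ind]) auto
  then have ZY: "indep_rv M U Z T Y" by simp
  interpret X: prob_space "distr M S X" by (intro prob_space_distr) simp
  interpret Y: prob_space "distr M T Y" by (intro prob_space_distr) simp
  interpret Z: prob_space "distr M U Z" by (intro prob_space_distr) simp
  interpret XZ: pair_prob_space "distr M S X" "distr M U Z" ..
  interpret XZY: pair_prob_space "distr M S X \<Otimes>\<^sub>M distr M U Z" "distr M T Y" ..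
  interpret P: prob_space "distr M (S \<Otimes>\<^sub>M U) (\<lambda>\<omega>. (X \<omega>, Z \<omega>))" by (intro prob_space_distr) simp
  interpret PY: pair_prob_space "distr M (S \<Otimes>\<^sub>M U) (\<lambda>\<omega>. (X \<omega>, Z \<omega>))" "distr M T Y" ..
  let ?h = "\<lambda>v. (fst (fst v), (snd (fst v), snd v))"
  let ?V = "S \<Otimes>\<^sub>M (U \<Otimes>\<^sub>M T)"
  have 1: "distr M ?V (\<lambda>\<omega>. (X \<omega>, (Z \<omega>, Y \<omega>)))
      = distr (distr M (S \<Otimes>\<^sub>M U) (\<lambda>\<omega>. (X \<omega>, Z \<omega>)) \<Otimes>\<^sub>M distr M T Y) ?V ?h"
    unfolding indep_rvD(3)[OF ind] by (simp add: distr_distr comp_def)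
  have 2: "distr M S X \<Otimes>\<^sub>M distr M (U \<Otimes>\<^sub>M T) (\<lambda>\<omega>. (Z \<omega>, Y \<omega>))
      = distr ((distr M S X \<Otimes>\<^sub>M distr M U Z) \<Otimes>\<^sub>M distr M T Y) ?V ?h"
    unfolding indep_rvD(3)[OF ZY, symmetric]
    by (subst pair_measure_assoc)
      (auto intro!: distr_cong sets_pair_measure_cong X.prob_space_axioms Y.prob_space_axioms Z.prob_space_axioms)
  have "emutual_information M S (T \<Otimes>\<^sub>M U) (\<lambda>\<omega>. X \<omega>) (\<lambda>\<omega>. (\<lambda>(z, y). (y, z)) (Z \<omega>, Y \<omega>))
      \<le> emutual_information M S (U \<Otimes>\<^sub>M T) X (\<lambda>\<omega>. (Z \<omega>, Y \<omega>))"
    by (rule emutual_information_mono[OF \<open>prob_space M\<close>, where f="\<lambda>x. x"]) auto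
  also have "\<dots> \<le>
     eKL_divergence 2 ((distr M S X \<Otimes>\<^sub>M distr M U Z) \<Otimes>\<^sub>M distr M T Y)
      (distr M (S \<Otimes>\<^sub>M U) (\<lambda>\<omega>. (X \<omega>, Z \<omega>)) \<Otimes>\<^sub>M distr M T Y)"
    unfolding emutual_information_def 1 2
    by (intro eKL_divergence_distr_le PY.prob_space_axioms XZY.prob_space_axioms)
      (auto cong: sets_pair_measure_cong)
  also have "\<dots> \<le> emutual_information M S U X Z"
    unfolding emutual_information_def
    by (intro eKL_divergence_pair_le P.prob_space_axioms XZ.prob_space_axioms Y.prob_space_axioms)
      (auto cong: sets_pair_measure_cong)
  finally show ?thesis by simp
qed

section \<open>Additive-noise channels\<close>

text \<open>The reference measure is the law of \<open>X\<close> times Lebesgue measure because the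
  input need not have a density; given \<open>X = x\<close> the output is the noise translated by
  \<open>a x\<close>.\<close>

lemma distr_additive_noise:
  fixes X :: "'a \<Rightarrow> 'c" and W :: "'a \<Rightarrow> 'b::euclidean_space"
  assumes "prob_space M" and ind: "indep_rv M S X borel W"
    and W: "distributed M lborel W \<psi>" and a[measurable]: "a \<in> borel_measurable S"
  shows "distr M (S \<Otimes>\<^sub>M borel) (\<lambda>\<omega>. (X \<omega>, a (X \<omega>) + W \<omega>))
    = density (distr M S X \<Otimes>\<^sub>M lborel) (\<lambda>(x, u). \<psi> (u - a x))" (is "?L = ?R")
proof (rule measure_eqI)
  interpret prob_space M by fact
  show "sets ?L = sets ?R" by (simp cong: sets_pair_measure_cong)
  fix A assume "A \<in> sets ?L"
  then have A[measurable]: "A \<in> sets (S \<Otimes>\<^sub>M borel)" by simp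
  have [measurable]: "X \<in> measurable M S" "W \<in> borel_measurable M"
    using ind by (auto simp: indep_rv_def)
  have [measurable]: "\<psi> \<in> borel_measurable borel"
    using W by (simp add: distributed_def)
  have dW: "distr M borel W = density lborel \<psi>"
    using W unfolding distributed_def by (metis distr_cong sets_lborel)
  have joint: "distr M (S \<Otimes>\<^sub>M borel) (\<lambda>\<omega>. (X \<omega>, W \<omega>)) = distr M S X \<Otimes>\<^sub>M density lborel \<psi>"
    using ind dW by (simp add: indep_rv_def)
  interpret X: prob_space "distr M S X" by (intro prob_space_distr) simp
  interpret D: prob_space "density lborel \<psi>" unfolding dW[symmetric] by (intro prob_space_distr) simp
  have "emeasure ?L A = (\<integral>\<^sup>+v. indicator A v \<partial>?L)" by simp
  also have "\<dots> = (\<integral>\<^sup>+\<omega>. indicator A (X \<omega>, a (X \<omega>) + W \<omega>) \<partial>M)"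
    by (subst nn_integral_distr) auto
  also have "\<dots> = (\<integral>\<^sup>+v. indicator A (fst v, a (fst v) + snd v) \<partial>distr M (S \<Otimes>\<^sub>M borel) (\<lambda>\<omega>. (X \<omega>, W \<omega>)))"
    by (subst nn_integral_distr) auto
  also have "\<dots> = (\<integral>\<^sup>+x. \<integral>\<^sup>+w. indicator A (x, a x + w) \<partial>density lborel \<psi> \<partial>distr M S X)"
    unfolding joint by (subst D.nn_integral_fst[symmetric]) (auto cong: measurable_cong_sets)
  also have "\<dots> = (\<integral>\<^sup>+x. \<integral>\<^sup>+u. \<psi> (u - a x) * indicator A (x, u) \<partial>lborel \<partial>distr M S X)"
  proof (rule nn_integral_cong)
    fix x assume "x \<in> space (distr M S X)"
    then have x: "x \<in> space S" by simp
    then have [measurable]: "(\<lambda>w. indicator A (x, w) :: ennreal) \<in> borel_measurable borel"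
      by measurable
    have "(\<integral>\<^sup>+w. indicator A (x, a x + w) \<partial>density lborel \<psi>)
        = (\<integral>\<^sup>+w. \<psi> w * indicator A (x, a x + w) \<partial>lborel)"
      using x by (subst nn_integral_density) auto
    also have "\<dots> = (\<integral>\<^sup>+u. \<psi> (u - a x) * indicator A (x, u) \<partial>distr lborel borel ((+) (a x)))"
      using x by (subst nn_integral_distr) auto
    finally show "(\<integral>\<^sup>+w. indicator A (x, a x + w) \<partial>density lborel \<psi>)
        = (\<integral>\<^sup>+u. \<psi> (u - a x) * indicator A (x, u) \<partial>lborel)"
      by (simp add: lborel_distr_plus)
  qed
  also have "\<dots> = (\<integral>\<^sup>+v. \<psi> (snd v - a (fst v)) * indicator A v \<partial>(distr M S X \<Otimes>\<^sub>M lborel))"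
    by (subst lborel.nn_integral_fst[symmetric]) auto
  also have "\<dots> = emeasure ?R A"
    by (subst emeasure_density) (auto simp: case_prod_beta' cong: sets_pair_measure_cong)
  finally show "emeasure ?L A = emeasure ?R A" .
qed

text \<open>Relative to the product of the marginals the joint law has density
  \<open>\<psi> (u - a x) / g u\<close>. As \<open>B\<close> only has to dominate its logarithm, the
  lemma serves both exact Gaussian values and crude finiteness bounds.\<close>

lemma emutual_information_additive_noise_le:
  fixes X :: "'a \<Rightarrow> 'c" and W :: "'a \<Rightarrow> 'b::euclidean_space" and \<psi> g :: "'b \<Rightarrow> real"
  assumes M: "prob_space M" and ind: "indep_rv M S X borel W"
    and W: "distributed M lborel W \<psi>" and a[measurable]: "a \<in> borel_measurable S"
    and nn: "\<And>u. 0 \<le> \<psi> u"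
    and g: "distributed M lborel (\<lambda>\<omega>. a (X \<omega>) + W \<omega>) g" "\<And>u. 0 < g u"
    and [measurable]: "\<psi> \<in> borel_measurable borel" "g \<in> borel_measurable borel"
    and [measurable]: "(\<lambda>(x, u). B x u) \<in> borel_measurable (S \<Otimes>\<^sub>M borel)"
    and le: "\<And>x u. x \<in> space S \<Longrightarrow> log 2 (\<psi> (u - a x) / g u) \<le> B x u"
    and int: "integrable M (\<lambda>\<omega>. B (X \<omega>) (a (X \<omega>) + W \<omega>))"
  shows "emutual_information M S borel X (\<lambda>\<omega>. a (X \<omega>) + W \<omega>)
    \<le> ereal (\<integral>\<omega>. B (X \<omega>) (a (X \<omega>) + W \<omega>) \<partial>M)"
proof -
  interpret prob_space M by fact
  have [measurable]: "X \<in> measurable M S" "W \<in> borel_measurable M"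
    using ind by (auto simp: indep_rv_def)
  let ?U = "\<lambda>\<omega>. a (X \<omega>) + W \<omega>"
  have dU: "distr M borel ?U = density lborel g"
    using g(1) unfolding distributed_def by (metis distr_cong sets_lborel)
  interpret X: prob_space "distr M S X" by (intro prob_space_distr) simp
  interpret U: prob_space "distr M borel ?U" by (intro prob_space_distr) simp
  interpret XU: pair_prob_space "distr M S X" "distr M borel ?U" ..
  let ?P = "distr M (S \<Otimes>\<^sub>M borel) (\<lambda>\<omega>. (X \<omega>, ?U \<omega>))"
  let ?Q = "distr M S X \<Otimes>\<^sub>M distr M borel ?U"
  let ?f = "\<lambda>v. \<psi> (snd v - a (fst v)) / g (snd v)"
  have Q: "?Q = density (distr M S X \<Otimes>\<^sub>M lborel) (\<lambda>v. ennreal (g (snd v)))"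
  proof -
    have "?Q = density (distr M S X) (\<lambda>_. 1) \<Otimes>\<^sub>M density lborel g"
      using dU by (simp add: density_1)
    also have "\<dots> = density (distr M S X \<Otimes>\<^sub>M lborel) (\<lambda>(x, u). 1 * ennreal (g u))"
      by (rule pair_measure_density)
        (use U.sigma_finite_measure_axioms dU lborel.sigma_finite_measure_axioms in auto)
    finally show ?thesis by (simp add: case_prod_beta')
  qed
  have "?P = density (distr M S X \<Otimes>\<^sub>M lborel) (\<lambda>v. ennreal (\<psi> (snd v - a (fst v))))"
    using distr_additive_noise[OF M ind W a] by (simp add: case_prod_beta')
  also have "\<dots> = density (distr M S X \<Otimes>\<^sub>M lborel) (\<lambda>v. ennreal (g (snd v)) * ennreal (?f v))"
  proof -
    have "ennreal (\<psi> (snd v - a (fst v))) = ennreal (g (snd v)) * ennreal (?f v)" for v :: "'c \<times> 'b"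
      using g(2)[of "snd v"] nn by (simp add: ennreal_mult[symmetric])
    then show ?thesis by simp
  qed
  also have "\<dots> = density ?Q (\<lambda>v. ennreal (?f v))"
    unfolding Q by (rule density_density_eq[symmetric]) auto
  finally have P: "?P = density ?Q (\<lambda>v. ennreal (?f v))" .
  have pP: "prob_space ?P" by (intro prob_space_distr) simp
  have fm: "?f \<in> borel_measurable ?Q"
    by (simp add: measurable_cong_sets[OF sets_pair_measure_cong[OF sets_distr sets_distr] refl])
  have nnf: "0 \<le> ?f v" for v using nn g(2)[of "snd v"] by (simp add: less_imp_le)
  have "AE v in ?P. log 2 (?f v) \<le> B (fst v) (snd v)"
    using le by (intro AE_I2) (auto simp: space_pair_measure)
  moreover have "integrable ?P (\<lambda>v. B (fst v) (snd v))"
    using int by (subst integrable_distr_eq) (auto simp: case_prod_beta')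
  ultimately have "eKL_divergence 2 ?Q (density ?Q (\<lambda>v. ennreal (?f v)))
      \<le> ereal (\<integral>v. B (fst v) (snd v) \<partial>density ?Q (\<lambda>v. ennreal (?f v)))"
    unfolding P using pP P
    by (intro eKL_divergence_le[OF _ XU.prob_space_axioms fm nnf]) auto
  also have "(\<integral>v. B (fst v) (snd v) \<partial>density ?Q (\<lambda>v. ennreal (?f v))) = (\<integral>\<omega>. B (X \<omega>) (?U \<omega>) \<partial>M)"
    unfolding P[symmetric] by (subst integral_distr) (auto simp: case_prod_beta')
  finally show ?thesis unfolding emutual_information_def P .
qed

section \<open>Gaussian variables\<close>

lemma normal_density_sqrt:
  "0 < v \<Longrightarrow> normal_density \<mu> (sqrt v) x = exp (- (x - \<mu>)\<^sup>2 / (2 * v)) / sqrt (2 * pi * v)"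
  by (simp add: normal_density_def)

lemma log_normal_density_divide:
  assumes "0 < v" "0 < w"
  shows "log 2 (normal_density \<mu> (sqrt v) x / normal_density \<nu> (sqrt w) y)
    = log 2 (w / v) / 2 + ((y - \<nu>)\<^sup>2 / (2 * w) - (x - \<mu>)\<^sup>2 / (2 * v)) / ln 2"
proof -
  have "ln (normal_density \<mu> (sqrt v) x / normal_density \<nu> (sqrt w) y)
      = ((y - \<nu>)\<^sup>2 / (2 * w) - (x - \<mu>)\<^sup>2 / (2 * v)) + ln (w / v) / 2"
    using assms by (simp add: normal_density_sqrt ln_div ln_mult ln_sqrt) (simp add: field_simps)
  then show ?thesis by (simp add: log_def add_divide_distrib)
qed

lemma (in prob_space)
  assumes v: "0 < v" and X: "distributed M lborel X (normal_density 0 (sqrt v))"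
  shows normal_expectation_0: "expectation X = 0"
    and normal_second_moment: "expectation (\<lambda>\<omega>. (X \<omega>)\<^sup>2) = v"
    and normal_square_integrable: "integrable M (\<lambda>\<omega>. (X \<omega>)\<^sup>2)"
proof -
  show e: "expectation X = 0" by (rule normal_distributed_expectation[OF _ X]) (use v in simp)
  show "expectation (\<lambda>\<omega>. (X \<omega>)\<^sup>2) = v"
    using normal_distributed_variance[OF _ X] v e by simp
  have "integrable lborel (\<lambda>x. normal_density 0 (sqrt v) x * x\<^sup>2)"
    using integrable_normal_moment[of "sqrt v" 0 2] v by simp
  then show "integrable M (\<lambda>\<omega>. (X \<omega>)\<^sup>2)"
    by (subst (asm) distributed_integrable[OF X]) auto
qed

text \<open>The Gaussian rate-distortion bound. The test function is the ratio of the normal density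
  of mean \<open>L y\<close> and variance \<open>v\<close> to the density of \<open>X\<close>; for
  each fixed \<open>y\<close> its integral against the law of \<open>X\<close> is 1. The estimator
  \<open>L\<close> may be nonlinear, and \<open>v\<close> only has to dominate its error.\<close>

lemma emutual_information_normal_ge:
  assumes M: "prob_space M" and s: "0 < s" and X: "distributed M lborel X (normal_density 0 (sqrt s))"
    and Y[measurable]: "Y \<in> measurable M T" and L[measurable]: "L \<in> borel_measurable T"
    and int: "integrable M (\<lambda>\<omega>. (X \<omega> - L (Y \<omega>))\<^sup>2)" and le: "(\<integral>\<omega>. (X \<omega> - L (Y \<omega>))\<^sup>2 \<partial>M) \<le> v"
    and v: "0 < v"
  shows "ereal (log 2 (s / v) / 2) \<le> emutual_information M borel T X Y"
proof -
  interpret prob_space M by fact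
  have [measurable]: "X \<in> borel_measurable M" using X by (simp add: distributed_def)
  interpret X: prob_space "distr M borel X" by (intro prob_space_distr) simp
  interpret Y: prob_space "distr M T Y" by (intro prob_space_distr) simp
  interpret XY: pair_prob_space "distr M borel X" "distr M T Y" ..
  let ?P = "distr M (borel \<Otimes>\<^sub>M T) (\<lambda>\<omega>. (X \<omega>, Y \<omega>))"
  let ?Q = "distr M borel X \<Otimes>\<^sub>M distr M T Y"
  have sQ: "sets ?Q = sets (borel \<Otimes>\<^sub>M T)" by (intro sets_pair_measure_cong) simp_all
  have dX: "distr M borel X = density lborel (normal_density 0 (sqrt s))"
    using X unfolding distributed_def by (metis distr_cong sets_lborel)
  define h where "h z = normal_density (L (snd z)) (sqrt v) (fst z) / normal_density 0 (sqrt s) (fst z)" for z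
  have pos: "0 < h z" for z
    using s v by (simp add: h_def normal_density_pos)
  have hm[measurable]: "h \<in> borel_measurable (borel \<Otimes>\<^sub>M T)"
    unfolding h_def normal_density_def by measurable
  have hQ[measurable]: "h \<in> borel_measurable ?Q" by (simp add: measurable_cong_sets[OF sQ refl])
  have "(\<integral>\<^sup>+z. ennreal (h z) \<partial>?Q) = (\<integral>\<^sup>+y. \<integral>\<^sup>+x. ennreal (h (x, y)) \<partial>distr M borel X \<partial>distr M T Y)"
    by (rule XY.nn_integral_snd[symmetric]) measurable
  also have "\<dots> = (\<integral>\<^sup>+y. 1 \<partial>distr M T Y)"
  proof (rule nn_integral_cong)
    fix y assume "y \<in> space (distr M T Y)"
    then have y: "y \<in> space T" by simp
    have [measurable]: "(\<lambda>x. h (x, y)) \<in> borel_measurable borel"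
      by (rule measurable_compose[OF measurable_Pair2'[OF y] hm])
    have "(\<integral>\<^sup>+x. ennreal (h (x, y)) \<partial>distr M borel X)
        = (\<integral>\<^sup>+x. ennreal (normal_density 0 (sqrt s) x) * ennreal (h (x, y)) \<partial>lborel)"
      unfolding dX by (subst nn_integral_density) auto
    also have "\<dots> = (\<integral>\<^sup>+x. ennreal (normal_density (L y) (sqrt v) x) \<partial>lborel)"
      using normal_density_pos[of "sqrt s" 0] s
      by (intro nn_integral_cong) (simp add: h_def ennreal_mult[symmetric] less_imp_neq[symmetric])
    also have "\<dots> = 1"
      using prob_space.emeasure_space_1[OF prob_space_normal_density[of "sqrt v" "L y"]] v
      by (simp add: emeasure_density)
    finally show "(\<integral>\<^sup>+x. ennreal (h (x, y)) \<partial>distr M borel X) = 1" .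
  qed
  also have "\<dots> = ennreal 1" by (simp add: Y.emeasure_space_1[simplified])
  finally have h1: "(\<integral>\<^sup>+z. ennreal (h z) \<partial>?Q) \<le> ennreal 1" by simp
  have lh: "log 2 (h (X \<omega>, Y \<omega>))
      = log 2 (s / v) / 2 + ((X \<omega>)\<^sup>2 / (2 * s) - (X \<omega> - L (Y \<omega>))\<^sup>2 / (2 * v)) / ln 2" for \<omega>
    using s v by (simp add: h_def log_normal_density_divide)
  have i: "integrable M (\<lambda>\<omega>. log 2 (h (X \<omega>, Y \<omega>)))"
    unfolding lh using int normal_square_integrable[OF s X] by simp
  have "ereal ((\<integral>z. log 2 (h z) \<partial>?P) - (1 - 1) / ln 2) \<le> eKL_divergence 2 ?Q ?P"
  proof (rule eKL_divergence_ge[OF _ _ _ _ hQ _ _ h1])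
    show "integrable ?P (\<lambda>z. log 2 (h z))"
      using i by (subst integrable_distr_eq) auto
    show "prob_space ?P" by (intro prob_space_distr) simp
    show "sets ?P = sets ?Q" using sQ by simp
  qed (auto intro: XY.prob_space_axioms less_imp_le pos)
  also have "(\<integral>z. log 2 (h z) \<partial>?P) = (\<integral>\<omega>. log 2 (h (X \<omega>, Y \<omega>)) \<partial>M)"
    by (subst integral_distr) auto
  also have "\<dots> = log 2 (s / v) / 2 + (s / (2 * s) - (\<integral>\<omega>. (X \<omega> - L (Y \<omega>))\<^sup>2 \<partial>M) / (2 * v)) / ln 2"
    unfolding lh using int normal_square_integrable[OF s X] normal_second_moment[OF s X]
    by (simp add: prob_space)
  finally have *: "ereal (log 2 (s / v) / 2 + (s / (2 * s) - (\<integral>\<omega>. (X \<omega> - L (Y \<omega>))\<^sup>2 \<partial>M) / (2 * v)) / ln 2)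
      \<le> eKL_divergence 2 ?Q ?P" by simp
  have "0 \<le> (s / (2 * s) - (\<integral>\<omega>. (X \<omega> - L (Y \<omega>))\<^sup>2 \<partial>M) / (2 * v)) / ln 2"
    using s v le by (simp add: field_simps)
  then have "ereal (log 2 (s / v) / 2)
      \<le> ereal (log 2 (s / v) / 2 + (s / (2 * s) - (\<integral>\<omega>. (X \<omega> - L (Y \<omega>))\<^sup>2 \<partial>M) / (2 * v)) / ln 2)"
    by simp
  then show ?thesis using * unfolding emutual_information_def by (rule order_trans)
qed

text \<open>Read backwards, \<open>X\<close> is the output of an additive-noise channel with input
  \<open>Z\<close>. The log-likelihood ratio is then explicit, and its two quadratic terms have
  opposite expectations, leaving the constant.\<close>

lemma emutual_information_normal_le:
  assumes M: "prob_space M" and s: "0 < s" and v: "0 < v"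
    and X: "distributed M lborel X (normal_density 0 (sqrt s))"
    and e: "distributed M lborel e (normal_density 0 (sqrt v))"
    and ind: "indep_rv M T Z borel e" and L[measurable]: "L \<in> borel_measurable T"
    and eq: "\<And>\<omega>. X \<omega> = L (Z \<omega>) + e \<omega>"
  shows "emutual_information M borel T X Z \<le> ereal (log 2 (s / v) / 2)"
proof -
  interpret prob_space M by fact
  have [measurable]: "X \<in> borel_measurable M" using X by (simp add: distributed_def)
  note [measurable] = indep_rvD(1,2)[OF ind]
  define B where "B z u = log 2 (s / v) / 2 + (u\<^sup>2 / (2 * s) - (u - L z)\<^sup>2 / (2 * v)) / ln 2" for z u
  have BX: "B (Z \<omega>) (L (Z \<omega>) + e \<omega>)
      = log 2 (s / v) / 2 + ((X \<omega>)\<^sup>2 / (2 * s) - (e \<omega>)\<^sup>2 / (2 * v)) / ln 2" for \<omega>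
    by (simp add: B_def eq)
  have XU: "X = (\<lambda>\<omega>. L (Z \<omega>) + e \<omega>)" using eq by auto
  have "emutual_information M borel T X Z \<le> emutual_information M T borel Z X"
    by (rule emutual_information_commute_le[OF M]) measurable
  also have "\<dots> \<le> ereal (\<integral>\<omega>. B (Z \<omega>) (L (Z \<omega>) + e \<omega>) \<partial>M)"
    unfolding XU
  proof (rule emutual_information_additive_noise_le[OF M ind e L, where g="normal_density 0 (sqrt s)"])
    show "distributed M lborel (\<lambda>\<omega>. L (Z \<omega>) + e \<omega>) (normal_density 0 (sqrt s))"
      using X XU by simp
    show "(\<lambda>(z, u). B z u) \<in> borel_measurable (T \<Otimes>\<^sub>M borel)"
      unfolding B_def by measurable
    show "integrable M (\<lambda>\<omega>. B (Z \<omega>) (L (Z \<omega>) + e \<omega>))"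
      unfolding BX using normal_square_integrable[OF s X] normal_square_integrable[OF v e] by simp
    show "log 2 (normal_density 0 (sqrt v) (u - L z) / normal_density 0 (sqrt s) u) \<le> B z u" for z u
      using s v by (simp add: log_normal_density_divide B_def)
  qed (use s in \<open>auto simp: normal_density_pos\<close>)
  also have "(\<integral>\<omega>. B (Z \<omega>) (L (Z \<omega>) + e \<omega>) \<partial>M) = log 2 (s / v) / 2 + (s / (2 * s) - v / (2 * v)) / ln 2"
    unfolding BX using normal_square_integrable[OF s X] normal_square_integrable[OF v e]
      normal_second_moment[OF s X] normal_second_moment[OF v e]
    by (simp add: prob_space)
  finally show ?thesis using s v by simp
qed

section \<open>Linear changes of variables for pairs of Gaussians\<close>

text \<open>Shears have Jacobian 1, so the density is merely composed with the inverse map. Together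
  with the coordinate swap they generate the linear maps needed for regression.\<close>

lemma distributed_shear:
  fixes X Y :: "'a \<Rightarrow> real" and f :: "real \<times> real \<Rightarrow> real"
  assumes D: "distributed M (lborel \<Otimes>\<^sub>M lborel) (\<lambda>\<omega>. (X \<omega>, Y \<omega>)) f"
    and f[measurable]: "f \<in> borel_measurable (borel \<Otimes>\<^sub>M borel)"
  shows "distributed M (lborel \<Otimes>\<^sub>M lborel) (\<lambda>\<omega>. (X \<omega> + c * Y \<omega>, Y \<omega>)) (\<lambda>(x, y). f (x - c * y, y))"
proof -
  have m[measurable]: "(\<lambda>\<omega>. (X \<omega>, Y \<omega>)) \<in> measurable M (borel \<Otimes>\<^sub>M borel)"
    using D by (simp add: distributed_def measurable_cong_sets[OF refl sets_pair_measure_cong[OF sets_lborel sets_lborel]])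
  have [measurable]: "X \<in> borel_measurable M" "Y \<in> borel_measurable M"
    using measurable_compose[OF m measurable_fst] measurable_compose[OF m measurable_snd] by simp_all
  have eq: "distr M (lborel \<Otimes>\<^sub>M lborel) (\<lambda>\<omega>. (X \<omega>, Y \<omega>)) = density (lborel \<Otimes>\<^sub>M lborel) f"
    using D by (simp add: distributed_def)
  show ?thesis
    unfolding distributed_def
  proof (intro conjI)
    show "(\<lambda>z. ennreal ((\<lambda>(x, y). f (x - c * y, y)) z)) \<in> borel_measurable (lborel \<Otimes>\<^sub>M lborel)"
      by measurable
    show "(\<lambda>\<omega>. (X \<omega> + c * Y \<omega>, Y \<omega>)) \<in> measurable M (lborel \<Otimes>\<^sub>M lborel)" by measurable
    show "distr M (lborel \<Otimes>\<^sub>M lborel) (\<lambda>\<omega>. (X \<omega> + c * Y \<omega>, Y \<omega>))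
        = density (lborel \<Otimes>\<^sub>M lborel) (\<lambda>z. ennreal ((\<lambda>(x, y). f (x - c * y, y)) z))" (is "?L = ?R")
    proof (rule measure_eqI)
      fix A assume "A \<in> sets ?L"
      then have A[measurable]: "A \<in> sets (borel \<Otimes>\<^sub>M borel)"
        by (simp cong: sets_pair_measure_cong)
      have "emeasure ?L A = (\<integral>\<^sup>+v. indicator A v \<partial>?L)" by (simp cong: sets_pair_measure_cong)
      also have "\<dots> = (\<integral>\<^sup>+\<omega>. indicator A (X \<omega> + c * Y \<omega>, Y \<omega>) \<partial>M)"
        by (subst nn_integral_distr) auto
      also have "\<dots> = (\<integral>\<^sup>+v. indicator A (fst v + c * snd v, snd v) \<partial>distr M (lborel \<Otimes>\<^sub>M lborel) (\<lambda>\<omega>. (X \<omega>, Y \<omega>)))"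
        by (subst nn_integral_distr) auto
      also have "\<dots> = (\<integral>\<^sup>+v. ennreal (f v) * indicator A (fst v + c * snd v, snd v) \<partial>(lborel \<Otimes>\<^sub>M lborel))"
        unfolding eq by (subst nn_integral_density) auto
      also have "\<dots> = (\<integral>\<^sup>+y. \<integral>\<^sup>+x. ennreal (f (x, y)) * indicator A (x + c * y, y) \<partial>lborel \<partial>lborel)"
        by (subst lborel_pair.nn_integral_snd[symmetric]) auto
      also have "\<dots> = (\<integral>\<^sup>+y. \<integral>\<^sup>+x. ennreal (f (x - c * y, y)) * indicator A (x, y) \<partial>lborel \<partial>lborel)"
      proof (rule nn_integral_cong)
        fix y :: real
        show "(\<integral>\<^sup>+x. ennreal (f (x, y)) * indicator A (x + c * y, y) \<partial>lborel)
            = (\<integral>\<^sup>+x. ennreal (f (x - c * y, y)) * indicator A (x, y) \<partial>lborel)"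
          by (subst nn_integral_real_affine[where c=1 and t="- c * y"]) (auto simp: algebra_simps)
      qed
      also have "\<dots> = (\<integral>\<^sup>+v. ennreal (f (fst v - c * snd v, snd v)) * indicator A v \<partial>(lborel \<Otimes>\<^sub>M lborel))"
        by (subst lborel_pair.nn_integral_snd[symmetric]) auto
      also have "\<dots> = emeasure ?R A"
        by (subst emeasure_density) (auto simp: case_prod_beta' cong: sets_pair_measure_cong)
      finally show "emeasure ?L A = emeasure ?R A" .
    qed simp
  qed
qed

lemma distributed_pair_swap:
  fixes X Y :: "'a \<Rightarrow> real" and f :: "real \<times> real \<Rightarrow> real"
  assumes D: "distributed M (lborel \<Otimes>\<^sub>M lborel) (\<lambda>\<omega>. (X \<omega>, Y \<omega>)) f"
    and f[measurable]: "f \<in> borel_measurable (borel \<Otimes>\<^sub>M borel)"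
  shows "distributed M (lborel \<Otimes>\<^sub>M lborel) (\<lambda>\<omega>. (Y \<omega>, X \<omega>)) (\<lambda>(x, y). f (y, x))"
proof -
  have m[measurable]: "(\<lambda>\<omega>. (X \<omega>, Y \<omega>)) \<in> measurable M (borel \<Otimes>\<^sub>M borel)"
    using D by (simp add: distributed_def measurable_cong_sets[OF refl sets_pair_measure_cong[OF sets_lborel sets_lborel]])
  have [measurable]: "X \<in> borel_measurable M" "Y \<in> borel_measurable M"
    using measurable_compose[OF m measurable_fst] measurable_compose[OF m measurable_snd] by simp_all
  have eq: "distr M (lborel \<Otimes>\<^sub>M lborel) (\<lambda>\<omega>. (X \<omega>, Y \<omega>)) = density (lborel \<Otimes>\<^sub>M lborel) f"
    using D by (simp add: distributed_def)
  show ?thesis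
    unfolding distributed_def
  proof (intro conjI)
    show "(\<lambda>z. ennreal ((\<lambda>(x, y). f (y, x)) z)) \<in> borel_measurable (lborel \<Otimes>\<^sub>M lborel)" by measurable
    show "(\<lambda>\<omega>. (Y \<omega>, X \<omega>)) \<in> measurable M (lborel \<Otimes>\<^sub>M lborel)" by measurable
    show "distr M (lborel \<Otimes>\<^sub>M lborel) (\<lambda>\<omega>. (Y \<omega>, X \<omega>))
        = density (lborel \<Otimes>\<^sub>M lborel) (\<lambda>z. ennreal ((\<lambda>(x, y). f (y, x)) z))" (is "?L = ?R")
    proof (rule measure_eqI)
      fix A assume "A \<in> sets ?L"
      then have A[measurable]: "A \<in> sets (borel \<Otimes>\<^sub>M borel)"
        by (simp cong: sets_pair_measure_cong)
      have "emeasure ?L A = (\<integral>\<^sup>+v. indicator A v \<partial>?L)" by (simp cong: sets_pair_measure_cong)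
      also have "\<dots> = (\<integral>\<^sup>+\<omega>. indicator A (Y \<omega>, X \<omega>) \<partial>M)"
        by (subst nn_integral_distr) auto
      also have "\<dots> = (\<integral>\<^sup>+v. indicator A (snd v, fst v) \<partial>distr M (lborel \<Otimes>\<^sub>M lborel) (\<lambda>\<omega>. (X \<omega>, Y \<omega>)))"
        by (subst nn_integral_distr) auto
      also have "\<dots> = (\<integral>\<^sup>+v. ennreal (f v) * indicator A (snd v, fst v) \<partial>(lborel \<Otimes>\<^sub>M lborel))"
        unfolding eq by (subst nn_integral_density) auto
      also have "\<dots> = (\<integral>\<^sup>+y. \<integral>\<^sup>+x. ennreal (f (x, y)) * indicator A (y, x) \<partial>lborel \<partial>lborel)"
        by (subst lborel_pair.nn_integral_snd[symmetric]) auto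
      also have "\<dots> = (\<integral>\<^sup>+v. ennreal (f (snd v, fst v)) * indicator A v \<partial>(lborel \<Otimes>\<^sub>M lborel))"
        by (subst lborel.nn_integral_fst[symmetric]) auto
      also have "\<dots> = emeasure ?R A"
        by (subst emeasure_density) (auto simp: case_prod_beta' cong: sets_pair_measure_cong)
      finally show "emeasure ?L A = emeasure ?R A" .
    qed simp
  qed
qed

text \<open>Both factors are normalized, so the joint law is a product measure and its marginals can
  be read off.\<close>

lemma (in prob_space) distributed_prod_indep:
  fixes X Y :: "'a \<Rightarrow> real" and f g :: "real \<Rightarrow> real"
  assumes D: "distributed M (lborel \<Otimes>\<^sub>M lborel) (\<lambda>\<omega>. (X \<omega>, Y \<omega>)) (\<lambda>(x, y). f x * g y)"
    and f[measurable]: "f \<in> borel_measurable borel" "\<And>x. 0 \<le> f x" "prob_space (density lborel f)"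
    and g[measurable]: "g \<in> borel_measurable borel" "\<And>x. 0 \<le> g x" "prob_space (density lborel g)"
  shows "distributed M lborel X f" "distributed M lborel Y g" "indep_rv M borel X borel Y"
proof -
  have m[measurable]: "(\<lambda>\<omega>. (X \<omega>, Y \<omega>)) \<in> measurable M (borel \<Otimes>\<^sub>M borel)"
    using D by (simp add: distributed_def measurable_cong_sets[OF refl sets_pair_measure_cong[OF sets_lborel sets_lborel]])
  have [measurable]: "X \<in> borel_measurable M" "Y \<in> borel_measurable M"
    using measurable_compose[OF m measurable_fst] measurable_compose[OF m measurable_snd] by simp_all
  interpret F: prob_space "density lborel f" by fact
  interpret G: prob_space "density lborel g" by fact
  interpret FG: pair_prob_space "density lborel f" "density lborel g" ..
  have "distr M (lborel \<Otimes>\<^sub>M lborel) (\<lambda>\<omega>. (X \<omega>, Y \<omega>))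
      = density (lborel \<Otimes>\<^sub>M lborel) (\<lambda>(x, y). ennreal (f x * g y))"
    using D by (simp add: distributed_def case_prod_beta')
  also have "\<dots> = density lborel f \<Otimes>\<^sub>M density lborel g"
    by (subst pair_measure_density)
      (use G.sigma_finite_measure_axioms lborel.sigma_finite_measure_axioms f(2) g(2) in \<open>auto simp: ennreal_mult\<close>)
  finally have j: "distr M (lborel \<Otimes>\<^sub>M lborel) (\<lambda>\<omega>. (X \<omega>, Y \<omega>)) = density lborel f \<Otimes>\<^sub>M density lborel g" .
  have "distr M borel X = distr (distr M (lborel \<Otimes>\<^sub>M lborel) (\<lambda>\<omega>. (X \<omega>, Y \<omega>))) borel fst"
    by (simp add: distr_distr comp_def)
  also have "\<dots> = distr (density lborel f \<Otimes>\<^sub>M density lborel g) (density lborel f) fst"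
    unfolding j by (intro distr_cong) auto
  also have "\<dots> = density lborel f" by (rule G.distr_pair_fst)
  finally have X: "distr M borel X = density lborel f" .
  have "distr M borel Y = distr (distr M (lborel \<Otimes>\<^sub>M lborel) (\<lambda>\<omega>. (X \<omega>, Y \<omega>))) borel snd"
    by (simp add: distr_distr comp_def)
  also have "\<dots> = distr (distr (density lborel g \<Otimes>\<^sub>M density lborel f) (density lborel f \<Otimes>\<^sub>M density lborel g) (\<lambda>(x, y). (y, x))) borel snd"
    unfolding j by (subst FG.distr_pair_swap) simp
  also have "\<dots> = distr (density lborel g \<Otimes>\<^sub>M density lborel f) (density lborel g) fst"
    by (subst distr_distr) (auto intro!: distr_cong simp: comp_def case_prod_beta')
  also have "\<dots> = density lborel g" by (rule F.distr_pair_fst)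
  finally have Y: "distr M borel Y = density lborel g" .
  show "distributed M lborel X f" "distributed M lborel Y g"
    using X Y by (auto simp: distributed_def cong: distr_cong)
  have "distr M (borel \<Otimes>\<^sub>M borel) (\<lambda>\<omega>. (X \<omega>, Y \<omega>)) = distr M (lborel \<Otimes>\<^sub>M lborel) (\<lambda>\<omega>. (X \<omega>, Y \<omega>))"
    by (intro distr_cong sets_pair_measure_cong) auto
  then show "indep_rv M borel X borel Y"
    using X Y j by (simp add: indep_rv_def)
qed

lemma (in prob_space) distributed_indep_joint:
  fixes X Y :: "'a \<Rightarrow> real" and f g :: "real \<Rightarrow> real"
  assumes ind: "indep_rv M borel X borel Y" and X: "distributed M lborel X f" and Y: "distributed M lborel Y g"
    and nn: "\<And>x. 0 \<le> f x"
  shows "distributed M (lborel \<Otimes>\<^sub>M lborel) (\<lambda>\<omega>. (X \<omega>, Y \<omega>)) (\<lambda>z. f (fst z) * g (snd z))"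
proof -
  have "indep_var borel X borel Y" using ind by (simp add: indep_rv_iff_indep_var)
  then have "distributed M (lborel \<Otimes>\<^sub>M lborel) (\<lambda>\<omega>. (X \<omega>, Y \<omega>)) (\<lambda>(x, y). ennreal (f x) * ennreal (g y))"
    by (intro distributed_joint_indep X Y lborel.sigma_finite_measure_axioms)
      (simp add: indep_rv_iff_indep_var[symmetric] indep_rv_def cong: distr_cong sets_pair_measure_cong)
  then show ?thesis using nn by (simp add: ennreal_mult' case_prod_beta')
qed

text \<open>Here \<open>k\<close> is the covariance of \<open>A\<close> with the observation
  \<open>p * A + B\<close> divided by the variance of the observation. Two shears with a swap in
  between lead to the pair of residual and observation, and completing the square shows that its
  density factors.\<close>

lemma (in prob_space) indep_normal_regression:
  fixes A B :: "'a \<Rightarrow> real" and p :: real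
  assumes ind: "indep_rv M borel A borel B" and a: "0 < a" and b: "0 < b"
    and A: "distributed M lborel A (normal_density 0 (sqrt a))"
    and B: "distributed M lborel B (normal_density 0 (sqrt b))"
  defines "k \<equiv> p * a / (p\<^sup>2 * a + b)"
  shows "distributed M lborel (\<lambda>\<omega>. A \<omega> - k * (p * A \<omega> + B \<omega>)) (normal_density 0 (sqrt (a * b / (p\<^sup>2 * a + b))))"
    and "distributed M lborel (\<lambda>\<omega>. p * A \<omega> + B \<omega>) (normal_density 0 (sqrt (p\<^sup>2 * a + b)))"
    and "indep_rv M borel (\<lambda>\<omega>. A \<omega> - k * (p * A \<omega> + B \<omega>)) borel (\<lambda>\<omega>. p * A \<omega> + B \<omega>)"
proof -
  let ?t = "p\<^sup>2 * a + b"
  have t: "0 < ?t" using a b by (simp add: add_nonneg_pos)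
  let ?n = "\<lambda>v. normal_density 0 (sqrt v)"
  have 1: "distributed M (lborel \<Otimes>\<^sub>M lborel) (\<lambda>\<omega>. (B \<omega>, A \<omega>)) (\<lambda>z. ?n b (fst z) * ?n a (snd z))"
    by (rule distributed_indep_joint[OF indep_rv_swap[OF ind] B A]) simp
  have "distributed M (lborel \<Otimes>\<^sub>M lborel) (\<lambda>\<omega>. (B \<omega> + p * A \<omega>, A \<omega>)) (\<lambda>(x, y). ?n b (x - p * y) * ?n a y)"
    using distributed_shear[OF 1, of p] by simp
  then have "distributed M (lborel \<Otimes>\<^sub>M lborel) (\<lambda>\<omega>. (A \<omega>, B \<omega> + p * A \<omega>)) (\<lambda>(x, y). ?n b (y - p * x) * ?n a x)"
    using distributed_pair_swap[where f="\<lambda>(x, y). ?n b (x - p * y) * ?n a y" and M=M and X="\<lambda>\<omega>. B \<omega> + p * A \<omega>" and Y=A]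
    by (simp add: case_prod_beta')
  then have "distributed M (lborel \<Otimes>\<^sub>M lborel) (\<lambda>\<omega>. (A \<omega> + (- k) * (B \<omega> + p * A \<omega>), B \<omega> + p * A \<omega>))
      (\<lambda>(x, y). ?n b (y - p * (x + k * y)) * ?n a (x + k * y))"
    using distributed_shear[where f="\<lambda>(x, y). ?n b (y - p * x) * ?n a x" and c="- k" and M=M and X=A and Y="\<lambda>\<omega>. B \<omega> + p * A \<omega>"]
    by (simp add: case_prod_beta')
  moreover have "?n b (y - p * (x + k * y)) * ?n a (x + k * y) = ?n (a * b / ?t) x * ?n ?t y" for x y
  proof -
    have e: "- (y - p * (x + k * y))\<^sup>2 / (2 * b) + - (x + k * y)\<^sup>2 / (2 * a)
        = - x\<^sup>2 / (2 * (a * b / ?t)) + - y\<^sup>2 / (2 * ?t)"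
    proof -
      have k: "k * ?t = p * a" using t by (simp add: k_def)
      \<comment> \<open>The cross term has the factor \<open>k * ?t - p * a\<close>, which the
        choice of \<open>k\<close> makes zero.\<close>
      have "(y - p * (x + k * y))\<^sup>2 * a + (x + k * y)\<^sup>2 * b = x\<^sup>2 * ?t + y\<^sup>2 * (a * (1 - p * k)\<^sup>2 + k\<^sup>2 * b) + 2 * x * y * (k * ?t - p * a)"
        by (simp add: power2_eq_square algebra_simps)
      also have "a * (1 - p * k)\<^sup>2 + k\<^sup>2 * b = a - 2 * k * p * a + k * (k * ?t)"
        by (simp add: power2_eq_square algebra_simps)
      also have "\<dots> = a - k * p * a" unfolding k by simp
      also have "\<dots> = a * b / ?t" unfolding k_def using t by (simp add: field_simps power2_eq_square)
      finally have "(y - p * (x + k * y))\<^sup>2 * a + (x + k * y)\<^sup>2 * b = x\<^sup>2 * ?t + y\<^sup>2 * (a * b / ?t)"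
        using k by simp
      then have "((y - p * (x + k * y))\<^sup>2 * a + (x + k * y)\<^sup>2 * b) / (2 * a * b) = (x\<^sup>2 * ?t + y\<^sup>2 * (a * b / ?t)) / (2 * a * b)"
        by simp
      moreover have "((y - p * (x + k * y))\<^sup>2 * a + (x + k * y)\<^sup>2 * b) / (2 * a * b)
          = (y - p * (x + k * y))\<^sup>2 / (2 * b) + (x + k * y)\<^sup>2 / (2 * a)"
        using a b by (simp add: add_divide_distrib)
      moreover have "(x\<^sup>2 * ?t + y\<^sup>2 * (a * b / ?t)) / (2 * a * b) = x\<^sup>2 / (2 * (a * b / ?t)) + y\<^sup>2 / (2 * ?t)"
        using a b t by (simp add: add_divide_distrib) (simp add: algebra_simps)
      ultimately show ?thesis by linarith
    qed
    have "sqrt (2 * pi * b) * sqrt (2 * pi * a) = sqrt (2 * pi * (a * b / ?t)) * sqrt (2 * pi * ?t)"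
    proof -
      have "2 * pi * b * (2 * pi * a) = 2 * pi * (a * b / ?t) * (2 * pi * ?t)"
        using t by (simp add: divide_simps)
      then show ?thesis by (simp only: real_sqrt_mult[symmetric])
    qed
    then show ?thesis
      using a b t e by (simp add: normal_density_sqrt exp_add[symmetric])
  qed
  ultimately have D: "distributed M (lborel \<Otimes>\<^sub>M lborel) (\<lambda>\<omega>. (A \<omega> - k * (p * A \<omega> + B \<omega>), p * A \<omega> + B \<omega>))
      (\<lambda>(x, y). ?n (a * b / ?t) x * ?n ?t y)"
    by (simp add: add.commute)
  have n: "prob_space (density lborel (?n v))" if "0 < v" for v
    using that by (intro prob_space_normal_density) simp
  show "distributed M lborel (\<lambda>\<omega>. A \<omega> - k * (p * A \<omega> + B \<omega>)) (?n (a * b / ?t))"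
    "distributed M lborel (\<lambda>\<omega>. p * A \<omega> + B \<omega>) (?n ?t)"
    "indep_rv M borel (\<lambda>\<omega>. A \<omega> - k * (p * A \<omega> + B \<omega>)) borel (\<lambda>\<omega>. p * A \<omega> + B \<omega>)"
    using distributed_prod_indep[OF D] n[of ?t] n[of "a * b / ?t"] a b t by auto
qed

lemma (in prob_space) normal_cmult:
  assumes "0 < v" "c \<noteq> 0" "distributed M lborel X (normal_density 0 (sqrt v))"
  shows "distributed M lborel (\<lambda>\<omega>. c * X \<omega>) (normal_density 0 (sqrt (c\<^sup>2 * v)))"
  using normal_density_affine[OF assms(3), of c 0] assms by (simp add: real_sqrt_mult)

text \<open>The first argument is written as \<open>x + r * y\<close> because \<open>r * y\<close>
  is the regression on \<open>y\<close>: in these coordinates the quadratic form is diagonal, and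
  the determinant of the covariance matrix is the product of the two variances.\<close>

lemma binormal_density_factor:
  assumes s: "0 < s" and r: "r\<^sup>2 < 1"
  shows "binormal_density s (r * s) s (x + r * y, y)
    = normal_density 0 (sqrt (s * (1 - r\<^sup>2))) x * normal_density 0 (sqrt s) y"
proof -
  let ?v = "s * (1 - r\<^sup>2)"
  have v: "0 < ?v" using s r by simp
  have d: "s * s - (r * s)\<^sup>2 = s * ?v" by (simp add: power2_eq_square algebra_simps)
  have "s * (x + r * y)\<^sup>2 - 2 * (r * s) * (x + r * y) * y + s * y\<^sup>2 = s * x\<^sup>2 + ?v * y\<^sup>2"
    by (simp add: power2_eq_square algebra_simps)
  then have e: "- (s * (x + r * y)\<^sup>2 - 2 * (r * s) * (x + r * y) * y + s * y\<^sup>2) / (2 * (s * ?v))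
      = - x\<^sup>2 / (2 * ?v) + - y\<^sup>2 / (2 * s)"
  proof -
    have "(s * x\<^sup>2 + ?v * y\<^sup>2) / (2 * (s * ?v)) = x\<^sup>2 / (2 * ?v) + y\<^sup>2 / (2 * s)"
      using s v r by (simp only: add_divide_distrib) (auto simp: divide_simps)
    then show ?thesis unfolding \<open>_ = s * x\<^sup>2 + ?v * y\<^sup>2\<close> minus_divide_left[symmetric] by linarith
  qed
  have "sqrt (2 * pi * ?v) * sqrt (2 * pi * s) = (sqrt (2 * pi) * sqrt (2 * pi)) * sqrt (s * ?v)"
    by (simp only: real_sqrt_mult mult_ac)
  then have "2 * pi * sqrt (s * ?v) = sqrt (2 * pi * ?v) * sqrt (2 * pi * s)"
    by simp
  then show ?thesis
    using s v e unfolding binormal_density_def d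
    by (simp add: normal_density_sqrt exp_add[symmetric])
qed

lemma (in prob_space) binormal_regression:
  fixes X Y :: "'a \<Rightarrow> real"
  assumes D: "distributed M (lborel \<Otimes>\<^sub>M lborel) (\<lambda>\<omega>. (X \<omega>, Y \<omega>)) (binormal_density s (r * s) s)"
    and s: "0 < s" and r: "r\<^sup>2 < 1"
  shows "distributed M lborel (\<lambda>\<omega>. X \<omega> - r * Y \<omega>) (normal_density 0 (sqrt (s * (1 - r\<^sup>2))))"
    and "distributed M lborel Y (normal_density 0 (sqrt s))"
    and "indep_rv M borel (\<lambda>\<omega>. X \<omega> - r * Y \<omega>) borel Y"
proof -
  let ?n = "\<lambda>v. normal_density 0 (sqrt v)"
  let ?v = "s * (1 - r\<^sup>2)"
  have v: "0 < ?v" using s r by simp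
  have [measurable]: "binormal_density s (r * s) s \<in> borel_measurable (borel \<Otimes>\<^sub>M borel)"
    unfolding binormal_density_def by measurable
  have "distributed M (lborel \<Otimes>\<^sub>M lborel) (\<lambda>\<omega>. (X \<omega> + (- r) * Y \<omega>, Y \<omega>))
      (\<lambda>(x, y). binormal_density s (r * s) s (x - (- r) * y, y))"
    by (rule distributed_shear[OF D]) measurable
  then have D': "distributed M (lborel \<Otimes>\<^sub>M lborel) (\<lambda>\<omega>. (X \<omega> - r * Y \<omega>, Y \<omega>)) (\<lambda>(x, y). ?n ?v x * ?n s y)"
    by (simp add: binormal_density_factor[OF s r])
  have n: "prob_space (density lborel (?n v))" if "0 < v" for v
    using that by (intro prob_space_normal_density) simp
  show "distributed M lborel (\<lambda>\<omega>. X \<omega> - r * Y \<omega>) (?n ?v)" "distributed M lborel Y (?n s)"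
    "indep_rv M borel (\<lambda>\<omega>. X \<omega> - r * Y \<omega>) borel Y"
    using distributed_prod_indep[OF D'] n[OF v] n[OF s] by auto
qed

section \<open>Estimation and test channels\<close>

text \<open>Doob--Dynkin factorization: \<open>L\<close> is recovered from the sets \<open>{y. q < L y}\<close> with rational \<open>q\<close>.\<close>

lemma vimage_algebra_factorization:
  fixes g :: "'a \<Rightarrow> real"
  assumes f: "f \<in> X \<rightarrow> space T" and g[measurable]: "g \<in> borel_measurable (vimage_algebra X f T)"
  obtains L where "L \<in> borel_measurable T" "\<And>x. x \<in> X \<Longrightarrow> g x = L (f x)"
proof -
  have "\<exists>A\<in>sets T. {x \<in> X. real_of_rat q < g x} = f -` A \<inter> X" for q
  proof -
    have "{x \<in> space (vimage_algebra X f T). real_of_rat q < g x} \<in> sets (vimage_algebra X f T)"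
      by measurable
    then show ?thesis using sets_vimage_algebra2[OF f] by auto
  qed
  then obtain A where A[measurable]: "\<And>q. A q \<in> sets T"
    and Aq: "\<And>q. {x \<in> X. real_of_rat q < g x} = f -` A q \<inter> X" by metis
  define l where "l y = (SUP q. if y \<in> A q then ereal (real_of_rat q) else -\<infinity>)" for y
  have [measurable]: "l \<in> borel_measurable T" unfolding l_def by measurable
  have l: "l (f x) = ereal (g x)" if x: "x \<in> X" for x
  proof (rule antisym)
    have *: "f x \<in> A q \<longleftrightarrow> real_of_rat q < g x" for q using Aq[of q] x by auto
    show "l (f x) \<le> ereal (g x)"
      unfolding l_def by (intro SUP_least) (auto simp: * less_imp_le)
    show "ereal (g x) \<le> l (f x)"
    proof (rule ccontr)
      assume "\<not> ereal (g x) \<le> l (f x)"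
      then obtain z where z: "l (f x) < ereal z" "ereal z < ereal (g x)"
        using ereal_dense2[of "l (f x)" "ereal (g x)"] by (auto simp: not_le)
      then obtain q where q: "z < real_of_rat q" "real_of_rat q < g x"
        using of_rat_dense[of z "g x"] by auto
      then have "ereal (real_of_rat q) \<le> l (f x)"
        unfolding l_def using * by (intro SUP_upper2[of q]) auto
      then show False using z q by (metis dual_order.strict_trans1 ereal_less_eq(3) less_imp_le not_less)
    qed
  qed
  show thesis
  proof (rule that)
    \<comment> \<open>Off the range of \<open>f\<close> the supremum may be infinite;
      \<open>real_of_ereal\<close> supplies a measurable finite value there.\<close>
    show "(\<lambda>y. real_of_ereal (l y)) \<in> borel_measurable T" by measurable
    show "g x = real_of_ereal (l (f x))" if "x \<in> X" for x using l[OF that] by simp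
  qed
qed

section \<open>Square-integrable variables and least-squares estimation\<close>

lemma integrable_mult_of_squares:
  fixes f g :: "'a \<Rightarrow> real"
  assumes [measurable]: "f \<in> borel_measurable M" "g \<in> borel_measurable M"
    and "integrable M (\<lambda>x. (f x)\<^sup>2)" "integrable M (\<lambda>x. (g x)\<^sup>2)"
  shows "integrable M (\<lambda>x. f x * g x)"
proof (rule Bochner_Integration.integrable_bound)
  show "integrable M (\<lambda>x. (f x)\<^sup>2 + (g x)\<^sup>2)" using assms by simp
  have "\<bar>f x * g x\<bar> \<le> (f x)\<^sup>2 + (g x)\<^sup>2" for x
  proof -
    have "0 \<le> (\<bar>f x\<bar> - \<bar>g x\<bar>)\<^sup>2" by simp
    then have "2 * (\<bar>f x\<bar> * \<bar>g x\<bar>) \<le> (f x)\<^sup>2 + (g x)\<^sup>2"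
      by (simp add: power2_diff)
    moreover have "0 \<le> \<bar>f x\<bar> * \<bar>g x\<bar>" by simp
    ultimately show ?thesis unfolding abs_mult by linarith
  qed
  then show "AE x in M. norm (f x * g x) \<le> norm ((f x)\<^sup>2 + (g x)\<^sup>2)" by simp
qed measurable

lemma square_integrable_add:
  fixes f g :: "'a \<Rightarrow> real"
  assumes [measurable]: "f \<in> borel_measurable M" "g \<in> borel_measurable M"
    and "integrable M (\<lambda>x. (f x)\<^sup>2)" "integrable M (\<lambda>x. (g x)\<^sup>2)"
  shows "integrable M (\<lambda>x. (a * f x + b * g x)\<^sup>2)"
proof -
  have "(\<lambda>x. (a * f x + b * g x)\<^sup>2) = (\<lambda>x. a\<^sup>2 * (f x)\<^sup>2 + b\<^sup>2 * (g x)\<^sup>2 + 2 * a * b * (f x * g x))"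
    by (auto simp: fun_eq_iff power2_eq_square algebra_simps)
  then show ?thesis using assms integrable_mult_of_squares[of f M g] by simp
qed

text \<open>Square integrability is conditional Jensen for the square. For the minimum,
  \<open>Z = E[X | F] - L\<close> is \<open>F\<close>-measurable, hence orthogonal to the residual,
  and Pythagoras applies.\<close>

lemma (in prob_space)
  fixes X :: "'a \<Rightarrow> real"
  assumes F: "subalgebra M F" and [measurable]: "X \<in> borel_measurable M"
    and X2: "integrable M (\<lambda>\<omega>. (X \<omega>)\<^sup>2)"
  shows cond_exp_square_integrable: "integrable M (\<lambda>\<omega>. (real_cond_exp M F X \<omega>)\<^sup>2)"
    and cond_exp_minimizes: "L \<in> borel_measurable F \<Longrightarrow> integrable M (\<lambda>\<omega>. (L \<omega>)\<^sup>2) \<Longrightarrow>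
      expectation (\<lambda>\<omega>. (X \<omega> - real_cond_exp M F X \<omega>)\<^sup>2) \<le> expectation (\<lambda>\<omega>. (X \<omega> - L \<omega>)\<^sup>2)"
proof -
  interpret finite_measure_subalgebra M F
    using F by unfold_locales
  let ?C = "real_cond_exp M F X"
  have X1: "integrable M X" by (rule square_integrable_imp_integrable[OF _ X2]) simp
  show C2: "integrable M (\<lambda>\<omega>. (?C \<omega>)\<^sup>2)"
    by (rule integrable_convex_cond_exp[where I=UNIV and q="\<lambda>x. x\<^sup>2"])
      (use X1 X2 convex_power2 in auto)
  show "expectation (\<lambda>\<omega>. (X \<omega> - ?C \<omega>)\<^sup>2) \<le> expectation (\<lambda>\<omega>. (X \<omega> - L \<omega>)\<^sup>2)"
    if L: "L \<in> borel_measurable F" and L2: "integrable M (\<lambda>\<omega>. (L \<omega>)\<^sup>2)"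
  proof -
    have CF: "?C \<in> borel_measurable F" by simp
    have [measurable]: "L \<in> borel_measurable M" "?C \<in> borel_measurable M"
      using L CF F by (auto intro: measurable_from_subalg)
    define Z where "Z \<omega> = ?C \<omega> - L \<omega>" for \<omega>
    have ZF: "Z \<in> borel_measurable F" unfolding Z_def using CF L by measurable
    have [measurable]: "Z \<in> borel_measurable M" unfolding Z_def by measurable
    have Z2: "integrable M (\<lambda>\<omega>. (Z \<omega>)\<^sup>2)"
      using square_integrable_add[OF _ _ C2 L2, of 1 "-1"] by (simp add: Z_def)
    have ZX: "integrable M (\<lambda>\<omega>. Z \<omega> * X \<omega>)" and ZC: "integrable M (\<lambda>\<omega>. Z \<omega> * ?C \<omega>)"
      using Z2 X2 C2 by (auto intro: integrable_mult_of_squares)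
    have orth: "expectation (\<lambda>\<omega>. Z \<omega> * ?C \<omega>) = expectation (\<lambda>\<omega>. Z \<omega> * X \<omega>)"
      using real_cond_exp_intg(2)[OF ZX ZF] by simp
    have R2: "integrable M (\<lambda>\<omega>. (X \<omega> - ?C \<omega>)\<^sup>2)"
      using square_integrable_add[OF _ _ X2 C2, of 1 "-1"] by simp
    have "(X \<omega> - L \<omega>)\<^sup>2 = (X \<omega> - ?C \<omega>)\<^sup>2 + (Z \<omega>)\<^sup>2 + 2 * (Z \<omega> * X \<omega>) - 2 * (Z \<omega> * ?C \<omega>)" for \<omega>
      by (simp add: Z_def power2_eq_square algebra_simps)
    then have "expectation (\<lambda>\<omega>. (X \<omega> - L \<omega>)\<^sup>2) = expectation (\<lambda>\<omega>. (X \<omega> - ?C \<omega>)\<^sup>2) + expectation (\<lambda>\<omega>. (Z \<omega>)\<^sup>2)"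
      using R2 Z2 ZX ZC orth by simp
    moreover have "0 \<le> expectation (\<lambda>\<omega>. (Z \<omega>)\<^sup>2)" by simp
    ultimately show ?thesis by linarith
  qed
qed

lemma (in prob_space) indep_second_moment:
  fixes X W :: "'a \<Rightarrow> real"
  assumes ind: "indep_rv M borel X borel W"
    and X2: "integrable M (\<lambda>\<omega>. (X \<omega>)\<^sup>2)" and W2: "integrable M (\<lambda>\<omega>. (W \<omega>)\<^sup>2)" and W0: "expectation W = 0"
  shows "expectation (\<lambda>\<omega>. (a * X \<omega> + b * W \<omega>)\<^sup>2) = a\<^sup>2 * expectation (\<lambda>\<omega>. (X \<omega>)\<^sup>2) + b\<^sup>2 * expectation (\<lambda>\<omega>. (W \<omega>)\<^sup>2)"
proof -
  note [measurable] = indep_rvD(1,2)[OF ind]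
  have i: "integrable M X" "integrable M W" by (rule square_integrable_imp_integrable[OF _ X2] square_integrable_imp_integrable[OF _ W2], simp)+
  have iv: "indep_var borel X borel W" using ind by (simp add: indep_rv_iff_indep_var)
  have "expectation (\<lambda>\<omega>. X \<omega> * W \<omega>) = 0"
    using indep_var_lebesgue_integral[OF iv i] W0 by simp
  moreover have "integrable M (\<lambda>\<omega>. X \<omega> * W \<omega>)" using indep_var_integrable[OF iv i] .
  moreover have "(a * X \<omega> + b * W \<omega>)\<^sup>2 = a\<^sup>2 * (X \<omega>)\<^sup>2 + b\<^sup>2 * (W \<omega>)\<^sup>2 + 2 * a * b * (X \<omega> * W \<omega>)" for \<omega>
    by (simp add: power2_eq_square algebra_simps)
  ultimately show ?thesis using X2 W2 by simp
qed

text \<open>The case \<open>v = 0\<close> has to be covered, since \<open>test_channels\<close>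
  admits \<open>\<alpha> i = 1\<close>, where the noise is almost surely zero and has no density.
  The moment formulas are the same in both cases.\<close>

lemma (in prob_space)
  assumes g: "gaussian M X 0 v"
  shows gaussian_measurable: "X \<in> borel_measurable M"
    and gaussian_expectation: "expectation X = 0"
    and gaussian_square_integrable: "integrable M (\<lambda>\<omega>. (X \<omega>)\<^sup>2)"
    and gaussian_second_moment: "expectation (\<lambda>\<omega>. (X \<omega>)\<^sup>2) = v"
proof -
  show m[measurable]: "X \<in> borel_measurable M" using g by (simp add: gaussian_def)
  have "expectation X = 0 \<and> integrable M (\<lambda>\<omega>. (X \<omega>)\<^sup>2) \<and> expectation (\<lambda>\<omega>. (X \<omega>)\<^sup>2) = v"
  proof (cases "v = 0")
    case True
    then have 0: "AE \<omega> in M. X \<omega> = 0" using g by (simp add: gaussian_def)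
    then have "expectation X = expectation (\<lambda>_. 0)" by (intro integral_cong_AE) auto
    moreover have 1: "AE \<omega> in M. (X \<omega>)\<^sup>2 = 0" using 0 by eventually_elim simp
    then have "expectation (\<lambda>\<omega>. (X \<omega>)\<^sup>2) = expectation (\<lambda>_. 0)" by (intro integral_cong_AE) auto
    moreover have "integrable M (\<lambda>\<omega>. (X \<omega>)\<^sup>2)"
      using 1 by (subst integrable_cong_AE[where g="\<lambda>_. 0"]) auto
    ultimately show ?thesis using True by simp
  next
    case False
    then have v: "0 < v" "distributed M lborel X (normal_density 0 (sqrt v))"
      using g by (auto simp: gaussian_def)
    then show ?thesis
      using normal_expectation_0[OF v] normal_second_moment[OF v] normal_square_integrable[OF v] by simp
  qed
  then show "expectation X = 0" "integrable M (\<lambda>\<omega>. (X \<omega>)\<^sup>2)" "expectation (\<lambda>\<omega>. (X \<omega>)\<^sup>2) = v"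
    by auto
qed

text \<open>Adding \<open>Y\<close> cannot decrease the information about \<open>X\<close>. The
  convention that \<open>\<infinity> - \<infinity>\<close> equals \<open>\<infinity>\<close> is
  harmless for this bound.\<close>

lemma econditional_mutual_information_nonneg:
  assumes "prob_space M" and [measurable]: "X \<in> measurable M S" "Y \<in> measurable M T" "Z \<in> measurable M U"
  shows "0 \<le> econditional_mutual_information M S T U X Y Z"
proof -
  have "emutual_information M S U (\<lambda>\<omega>. X \<omega>) (\<lambda>\<omega>. snd (Y \<omega>, Z \<omega>))
      \<le> emutual_information M S (T \<Otimes>\<^sub>M U) X (\<lambda>\<omega>. (Y \<omega>, Z \<omega>))"
    by (rule emutual_information_mono[OF \<open>prob_space M\<close>, where f="\<lambda>x. x"]) auto
  moreover have "0 \<le> emutual_information M S U X Z"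
    by (rule emutual_information_nonneg[OF \<open>prob_space M\<close>]) measurable
  ultimately show ?thesis
    unfolding econditional_mutual_information_def
    by (cases "emutual_information M S U X Z"; cases "emutual_information M S (T \<Otimes>\<^sub>M U) X (\<lambda>\<omega>. (Y \<omega>, Z \<omega>))") auto
qed

text \<open>Gives finiteness without knowing the output law. The output density \<open>g\<close> is
  a mixture of translates of \<open>\<psi>\<close>; the factored lower bound \<open>low\<close>
  carries over to the mixture, so the likelihood ratio is at most a constant divided by
  \<open>l u\<close>, whose logarithm is integrable by assumption.\<close>

lemma emutual_information_additive_noise_finite:
  fixes X :: "'a \<Rightarrow> 'c" and W :: "'a \<Rightarrow> 'b::euclidean_space" and \<psi> :: "'b \<Rightarrow> real"
  assumes M: "prob_space M" and ind: "indep_rv M S X borel W"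
    and W: "distributed M lborel W \<psi>" and a[measurable]: "a \<in> borel_measurable S"
    and \<psi>[measurable]: "\<psi> \<in> borel_measurable borel" and nn: "\<And>u. 0 \<le> \<psi> u" and c: "\<And>u. \<psi> u \<le> c"
    and l[measurable]: "l \<in> borel_measurable borel" "\<And>u. 0 < l u"
    and \<eta>[measurable]: "\<eta> \<in> borel_measurable S" "\<And>x. 0 < \<eta> x"
    and low: "\<And>x u. l u * \<eta> x \<le> \<psi> (u - a x)"
    and int: "integrable M (\<lambda>\<omega>. ln (l (a (X \<omega>) + W \<omega>)))"
  shows "emutual_information M S borel X (\<lambda>\<omega>. a (X \<omega>) + W \<omega>) < \<infinity>"
proof -
  interpret prob_space M by fact
  note [measurable] = indep_rvD(1,2)[OF ind]
  interpret X: prob_space "distr M S X" by (intro prob_space_distr) simp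
  define g where "g u = expectation (\<lambda>\<omega>. \<psi> (u - a (X \<omega>)))" for u
  have i\<psi>: "integrable M (\<lambda>\<omega>. \<psi> (u - a (X \<omega>)))" for u
    by (rule integrable_const_bound[of _ c]) (use nn c in auto)
  \<comment> \<open>The bound \<open>low\<close> at \<open>u = 0\<close> already shows that
    \<open>\<eta>\<close> is bounded.\<close>
  have \<eta>c: "\<eta> x \<le> c / l 0" for x
    using low[of 0 x] c[of "0 - a x"] l(2)[of 0] by (simp add: field_simps)
  have i\<eta>: "integrable M (\<lambda>\<omega>. \<eta> (X \<omega>))"
    by (rule integrable_const_bound[of _ "c / l 0"]) (use \<eta>c \<eta>(2) in \<open>auto simp: less_imp_le\<close>)
  \<comment> \<open>Averaging \<open>low\<close> over the input turns it into the lower bound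
    \<open>l u * k\<close> for the output density.\<close>
  define k where "k = expectation (\<lambda>\<omega>. \<eta> (X \<omega>))"
  have k: "0 < k"
  proof -
    have "k \<noteq> 0"
      unfolding k_def using i\<eta> \<eta>(2)
      by (subst integral_nonneg_eq_0_iff_AE) (auto simp: less_imp_le less_imp_neq[symmetric] AE_False)
    moreover have "0 \<le> k" unfolding k_def using \<eta>(2) by (simp add: less_imp_le)
    ultimately show ?thesis by simp
  qed
  have gk: "l u * k \<le> g u" for u
  proof -
    have "l u * k = expectation (\<lambda>\<omega>. l u * \<eta> (X \<omega>))" by (simp add: k_def)
    also have "\<dots> \<le> g u"
      unfolding g_def using i\<eta> i\<psi> low by (intro integral_mono) auto
    finally show ?thesis .
  qed
  have gpos: "0 < g u" for u using gk[of u] k l(2)[of u] by (meson less_le_trans mult_pos_pos)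
  have [measurable]: "g \<in> borel_measurable borel" unfolding g_def by measurable
  have U: "distributed M lborel (\<lambda>\<omega>. a (X \<omega>) + W \<omega>) g"
    unfolding distributed_def
  proof (intro conjI)
    show "distr M lborel (\<lambda>\<omega>. a (X \<omega>) + W \<omega>) = density lborel (\<lambda>u. ennreal (g u))" (is "?L = ?R")
    proof (rule measure_eqI)
      fix A assume "A \<in> sets ?L"
      then have A[measurable]: "A \<in> sets borel" by simp
      let ?D = "density (distr M S X \<Otimes>\<^sub>M lborel) (\<lambda>(x, u). ennreal (\<psi> (u - a x)))"
      have "emeasure ?L A = (\<integral>\<^sup>+u. indicator A u \<partial>?L)" by simp
      also have "\<dots> = (\<integral>\<^sup>+\<omega>. indicator A (a (X \<omega>) + W \<omega>) \<partial>M)"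
        by (subst nn_integral_distr) auto
      also have "\<dots> = (\<integral>\<^sup>+v. indicator A (snd v) \<partial>distr M (S \<Otimes>\<^sub>M borel) (\<lambda>\<omega>. (X \<omega>, a (X \<omega>) + W \<omega>)))"
        by (subst nn_integral_distr) auto
      also have "\<dots> = (\<integral>\<^sup>+v. ennreal (\<psi> (snd v - a (fst v))) * indicator A (snd v) \<partial>(distr M S X \<Otimes>\<^sub>M lborel))"
        unfolding distr_additive_noise[OF M ind W a]
        by (subst nn_integral_density) (auto simp: case_prod_beta' cong: measurable_cong_sets sets_pair_measure_cong)
      also have "\<dots> = (\<integral>\<^sup>+u. \<integral>\<^sup>+x. ennreal (\<psi> (u - a x)) * indicator A u \<partial>distr M S X \<partial>lborel)"
      proof -
        interpret P: pair_sigma_finite "distr M S X" "lborel :: 'b measure"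
          by (intro pair_sigma_finite.intro X.sigma_finite_measure_axioms lborel.sigma_finite_measure_axioms)
        show ?thesis by (subst P.nn_integral_snd[symmetric]) auto
      qed
      also have "\<dots> = (\<integral>\<^sup>+u. ennreal (g u) * indicator A u \<partial>lborel)"
      proof (rule nn_integral_cong)
        fix u
        have "(\<integral>\<^sup>+x. ennreal (\<psi> (u - a x)) \<partial>distr M S X) = (\<integral>\<^sup>+\<omega>. ennreal (\<psi> (u - a (X \<omega>))) \<partial>M)"
          by (subst nn_integral_distr) auto
        also have "\<dots> = ennreal (g u)"
          unfolding g_def using nn i\<psi> by (intro nn_integral_eq_integral) auto
        finally show "(\<integral>\<^sup>+x. ennreal (\<psi> (u - a x)) * indicator A u \<partial>distr M S X) = ennreal (g u) * indicator A u"
          by (subst nn_integral_multc) auto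
      qed
      also have "\<dots> = emeasure ?R A" by (subst emeasure_density) auto
      finally show "emeasure ?L A = emeasure ?R A" .
    qed simp
  qed auto
  define B where "B x u = (ln (c / k) - ln (l u)) / ln 2" for x :: 'c and u :: 'b
  have "emutual_information M S borel X (\<lambda>\<omega>. a (X \<omega>) + W \<omega>)
      \<le> ereal (\<integral>\<omega>. B (X \<omega>) (a (X \<omega>) + W \<omega>) \<partial>M)"
  proof (rule emutual_information_additive_noise_le[OF M ind W a nn U gpos])
    show "(\<lambda>(x, u). B x u) \<in> borel_measurable (S \<Otimes>\<^sub>M borel)" unfolding B_def by measurable
    show "integrable M (\<lambda>\<omega>. B (X \<omega>) (a (X \<omega>) + W \<omega>))" unfolding B_def using int by simp
    fix x u assume "x \<in> space S"
    have p: "0 < \<psi> (u - a x)" using low[of u x] l(2)[of u] \<eta>(2)[of x] by (meson less_le_trans mult_pos_pos)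
    then have cp: "0 < c" using c[of "u - a x"] by linarith
    have lk: "0 < l u * k" using l(2)[of u] k by simp
    have "\<psi> (u - a x) / g u \<le> c / (l u * k)"
      using c gk gpos lk cp p by (intro frac_le) auto
    then have "log 2 (\<psi> (u - a x) / g u) \<le> log 2 (c / (l u * k))"
      using p gpos[of u] cp lk by (subst log_le_cancel_iff) auto
    also have "\<dots> = B x u"
      using cp k l(2)[of u] by (simp add: B_def log_def ln_div ln_mult)
    finally show "log 2 (\<psi> (u - a x) / g u) \<le> B x u" .
  qed measurable
  then show ?thesis by (rule order_le_less_trans) simp
qed

section \<open>Converse\<close>

text \<open>The variable \<open>x 1 - r * x 2\<close> is the innovation of \<open>x 1\<close> given
  \<open>x 2\<close>, of variance \<open>s * (1 - r^2) = 1 - 1 / (4 * s)\<close>. Both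
  \<open>x 1\<close> and \<open>x 3\<close> are this innovation plus a multiple of the independent
  \<open>x 2\<close>, with coefficients \<open>r\<close> and \<open>r - 1\<close>; this gives their
  laws.\<close>

lemma difference_sourceD:
  assumes src: "difference_source s M x" and s: "1 / 2 < s"
  defines "r \<equiv> 1 - 1 / (2 * s)"
  shows "prob_space M"
    and "distributed M lborel (\<lambda>\<omega>. x 1 \<omega> - r * x 2 \<omega>) (normal_density 0 (sqrt (1 - 1 / (4 * s))))"
    and "distributed M lborel (x 2) (normal_density 0 (sqrt s))"
    and "indep_rv M borel (\<lambda>\<omega>. x 1 \<omega> - r * x 2 \<omega>) borel (x 2)"
    and "distributed M lborel (x 1) (normal_density 0 (sqrt s))"
    and "distributed M lborel (x 3) (normal_density 0 (sqrt 1))"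
    and "x 3 = (\<lambda>\<omega>. x 1 \<omega> - x 2 \<omega>)"
proof -
  define X Y where "X = x 1" and "Y = x 2"
  show M: "prob_space M" using src by (simp add: difference_source_def)
  interpret prob_space M by fact
  show x3: "x 3 = (\<lambda>\<omega>. x 1 \<omega> - x 2 \<omega>)" using src by (simp add: difference_source_def)
  have x3': "x 3 = (\<lambda>\<omega>. X \<omega> - Y \<omega>)" using x3 by (simp only: X_def Y_def)
  have D: "distributed M (lborel \<Otimes>\<^sub>M lborel) (\<lambda>\<omega>. (X \<omega>, Y \<omega>)) (binormal_density s (r * s) s)"
    using src by (simp add: difference_source_def r_def Let_def X_def Y_def)
  have r: "0 < r" "r < 1" using s by (auto simp: r_def field_simps)
  then have r2: "r\<^sup>2 < 1" by (simp add: power_less_one_iff)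
  have s0: "0 < s" using s by simp
  have t: "s * (1 - r\<^sup>2) = 1 - 1 / (4 * s)"
    using s0 by (simp add: r_def power2_eq_square field_simps)
  have t0: "0 < 1 - 1 / (4 * s)" using s by (simp add: field_simps)
  note reg = binormal_regression[OF D s0 r2, unfolded t]
  have n: "distributed M lborel (\<lambda>\<omega>. X \<omega> - r * Y \<omega>) (normal_density 0 (sqrt (1 - 1 / (4 * s))))"
    and y: "distributed M lborel Y (normal_density 0 (sqrt s))"
    and ny: "indep_rv M borel (\<lambda>\<omega>. X \<omega> - r * Y \<omega>) borel Y"
    using reg by auto
  note lin = indep_normal_regression(2)[OF indep_rv_swap[OF ny] s0 t0 y n]
  \<comment> \<open>The contribution of \<open>x 2\<close> to the variance of \<open>x 3\<close> is
    \<open>(r - 1)^2 * s = 1 / (4 * s)\<close>, which complements the innovation variance to exactly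
    1.\<close>
  have v1: "r\<^sup>2 * s + (1 - 1 / (4 * s)) = s" and v3: "(r - 1)\<^sup>2 * s + (1 - 1 / (4 * s)) = 1"
    using s0 by (simp_all add: r_def power2_eq_square field_simps)
  have "distributed M lborel X (normal_density 0 (sqrt s))"
    using lin[of r] unfolding v1 by simp
  moreover have "distributed M lborel (x 3) (normal_density 0 (sqrt 1))"
    using lin[of "r - 1"] unfolding v3 by (simp add: x3' algebra_simps)
  ultimately show "distributed M lborel (\<lambda>\<omega>. x 1 \<omega> - r * x 2 \<omega>) (normal_density 0 (sqrt (1 - 1 / (4 * s))))"
    "distributed M lborel (x 2) (normal_density 0 (sqrt s))"
    "indep_rv M borel (\<lambda>\<omega>. x 1 \<omega> - r * x 2 \<omega>) borel (x 2)"
    "distributed M lborel (x 1) (normal_density 0 (sqrt s))"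
    "distributed M lborel (x 3) (normal_density 0 (sqrt 1))"
    using n y ny by (auto simp: X_def Y_def)
qed

lemma (in prob_space) normal_variance:
  assumes "0 < v" "distributed M lborel X (normal_density 0 (sqrt v))"
  shows "variance X = v"
  using normal_expectation_0[OF assms] normal_second_moment[OF assms] by simp

lemma econditional_mutual_information_const:
  assumes "prob_space M" "X \<in> measurable M S" "c \<in> space U"
  shows "econditional_mutual_information M S T U X Y (\<lambda>_. c)
    = emutual_information M S (T \<Otimes>\<^sub>M U) X (\<lambda>\<omega>. (Y \<omega>, c))"
proof -
  interpret prob_space M by fact
  have "emutual_information M S U X (\<lambda>_. c) = 0"
    by (rule emutual_information_indep_rv[OF assms(1) indep_rv_swap[OF indep_rv_const[OF assms(2,3)]]])
  then show ?thesis by (simp add: econditional_mutual_information_def)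
qed

lemma measurable_subvector[measurable (raw)]:
  "(\<And>i. i \<in> A \<Longrightarrow> v i \<in> borel_measurable M) \<Longrightarrow> subvector A v \<in> measurable M (vec_space A)"
  by (intro measurable_restrict) auto

lemma test_channelsD:
  assumes u: "u \<in> test_channels M x d" and s: "1 / 2 < s" and src: "difference_source s M x"
  obtains \<alpha> w where "\<forall>i\<in>users. 0 \<le> \<alpha> i \<and> \<alpha> i \<le> 1"
    "\<forall>i\<in>users. u i = (\<lambda>\<omega>. \<alpha> i * x i \<omega> + w i \<omega>)"
    "\<forall>i\<in>users. gaussian M (w i) 0 ((1 - (\<alpha> i)\<^sup>2) * (if i = 3 then 1 else s))"
    "prob_space.indep_vars M (\<lambda>_. borel) w users"
    "indep_rv M (vec_space users) (subvector users w) (vec_space users) (subvector users x)"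
    "mmse M (x 3) u \<le> d"
proof -
  note S = difference_sourceD[OF src s]
  interpret prob_space M by (rule S(1))
  have s0: "0 < s" using s by simp
  have v: "variance (x 1) = s" "variance (x 2) = s" "variance (x 3) = 1"
    using normal_variance[OF s0 S(5)] normal_variance[OF s0 S(3)] normal_variance[OF _ S(6)] by simp_all
  obtain \<alpha> w where *: "\<forall>i\<in>users. 0 \<le> \<alpha> i \<and> \<alpha> i \<le> 1"
    "\<forall>i\<in>users. gaussian M (w i) 0 ((1 - (\<alpha> i)\<^sup>2) * variance (x i))"
    "indep_vars (\<lambda>_. borel) w users"
    "indep_var (vec_space users) (subvector users w) (vec_space users) (subvector users x)"
    "\<forall>i\<in>users. u i = (\<lambda>\<omega>. \<alpha> i * x i \<omega> + w i \<omega>)" "mmse M (x 3) u \<le> d"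
    using u unfolding test_channels_def by blast
  show thesis
  proof (rule that)
    show "\<forall>i\<in>users. gaussian M (w i) 0 ((1 - (\<alpha> i)\<^sup>2) * (if i = 3 then 1 else s))"
      using *(2) v by auto
  qed (use * in \<open>auto simp: indep_rv_iff_indep_var\<close>)
qed

text \<open>The information \<open>I(x\<^sub>1; u\<^sub>1) = - log\<^sub>2 (1 - a\<^sup>2) / 2\<close> is infinite for \<open>a = 1\<close>; the lower bound is therefore applied with every \<open>v > 0\<close> above the error variance.\<close>

lemma sum_rate_ge:
  assumes M: "prob_space M" and s: "0 < s" and X: "distributed M lborel (x 1) (normal_density 0 (sqrt s))"
    and x: "\<And>i. i \<in> users \<Longrightarrow> x i \<in> borel_measurable M" and w: "gaussian M w 0 ((1 - a\<^sup>2) * s)"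
    and ind: "indep_rv M borel (x 1) borel w" and a: "0 \<le> a" "a \<le> 1"
    and u1: "u 1 = (\<lambda>\<omega>. a * x 1 \<omega> + w \<omega>)" and u: "\<And>i. i \<in> users \<Longrightarrow> u i \<in> borel_measurable M"
    and rate: "econditional_mutual_information M (vec_space users) (vec_space users) (vec_space (users - users))
               (subvector users x) (subvector users u) (subvector (users - users) u) \<le> ereal R"
  shows "a < 1" "- log 2 (1 - a\<^sup>2) / 2 \<le> R"
proof -
  interpret prob_space M by fact
  have mxu[measurable]: "subvector users x \<in> measurable M (vec_space users)"
    "subvector users u \<in> measurable M (vec_space users)"
    "u 1 \<in> borel_measurable M" "x 1 \<in> borel_measurable M"
    using x u by (intro measurable_subvector; blast)+ (use x u in auto)
  \<comment> \<open>Nothing is conditioned on: the complement is empty, and its subvector is the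
    constant function \<open>undefined\<close>.\<close>
  have c: "subvector (users - users) u = (\<lambda>_. \<lambda>_. undefined)"
    by (auto simp: fun_eq_iff)
  let ?U = "\<lambda>\<omega>. (subvector users u \<omega>, \<lambda>_. undefined) :: (nat \<Rightarrow> real) \<times> (nat \<Rightarrow> real)"
  have f: "(\<lambda>a. a 1) \<in> borel_measurable (vec_space users)"
    by (rule measurable_component_singleton) simp
  have g: "(\<lambda>p. fst p 1) \<in> borel_measurable (vec_space users \<Otimes>\<^sub>M vec_space (users - users))"
    by (rule measurable_compose[OF measurable_fst f])
  have mU: "?U \<in> measurable M (vec_space users \<Otimes>\<^sub>M vec_space (users - users))"
    by (rule measurable_Pair[OF mxu(2) measurable_const]) (simp add: space_PiM)
  have "emutual_information M borel borel (\<lambda>\<omega>. subvector users x \<omega> 1) (\<lambda>\<omega>. fst (?U \<omega>) 1)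
      \<le> emutual_information M (vec_space users) (vec_space users \<Otimes>\<^sub>M vec_space (users - users)) (subvector users x) ?U"
    by (rule emutual_information_mono[OF M mxu(1) mU f g])
  also have "\<dots> \<le> ereal R"
    using rate unfolding c by (subst (asm) econditional_mutual_information_const[OF M mxu(1)]) (simp_all add: space_PiM)
  finally have I: "emutual_information M borel borel (x 1) (u 1) \<le> ereal R" by simp
  note gw = gaussian_square_integrable[OF w] gaussian_second_moment[OF w] gaussian_expectation[OF w]
  \<comment> \<open>The output \<open>u 1\<close> has the same variance \<open>s\<close> as
    \<open>x 1\<close>, so the regression coefficient of \<open>x 1\<close> on \<open>u 1\<close> is
    \<open>a\<close> itself.\<close>
  have e: "x 1 \<omega> - a * u 1 \<omega> = (1 - a\<^sup>2) * x 1 \<omega> + (- a) * w \<omega>" for \<omega>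
    unfolding u1 by (simp add: power2_eq_square algebra_simps)
  have wm: "w \<in> borel_measurable M" by (rule gaussian_measurable[OF w])
  have i: "integrable M (\<lambda>\<omega>. (x 1 \<omega> - a * u 1 \<omega>)\<^sup>2)"
    unfolding e by (rule square_integrable_add[OF _ wm normal_square_integrable[OF s X] gw(1)]) measurable
  have "expectation (\<lambda>\<omega>. (x 1 \<omega> - a * u 1 \<omega>)\<^sup>2) = (1 - a\<^sup>2)\<^sup>2 * s + (- a)\<^sup>2 * ((1 - a\<^sup>2) * s)"
    unfolding e indep_second_moment[OF ind normal_square_integrable[OF s X] gw(1,3)]
    by (simp only: normal_second_moment[OF s X] gw(2))
  also have "\<dots> = (1 - a\<^sup>2) * s" by (simp add: power2_eq_square algebra_simps)
  finally have E: "expectation (\<lambda>\<omega>. (x 1 \<omega> - a * u 1 \<omega>)\<^sup>2) = (1 - a\<^sup>2) * s" .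
  have low: "log 2 (s / v) / 2 \<le> R" if "0 < v" "(1 - a\<^sup>2) * s \<le> v" for v
  proof -
    have "ereal (log 2 (s / v) / 2) \<le> emutual_information M borel borel (x 1) (u 1)"
      by (rule emutual_information_normal_ge[OF M s X mxu(3), where L="\<lambda>y. a * y"]) (use i E that in auto)
    then have "ereal (log 2 (s / v) / 2) \<le> ereal R" using I by (rule order_trans)
    then show ?thesis by simp
  qed
  show a1: "a < 1"
  proof (rule ccontr)
    assume "\<not> a < 1"
    then have "a = 1" using a by simp
    \<comment> \<open>For \<open>a = 1\<close> the error vanishes and every positive
      \<open>v\<close> is admissible; this one gives \<open>R + 1 \<le> R\<close>.\<close>
    then have "log 2 (s / (s / 2 powr (2 * R + 2))) / 2 \<le> R" using s by (intro low) auto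
    moreover have "log 2 (s / (s / 2 powr (2 * R + 2))) = 2 * R + 2" using s by simp
    ultimately show False by simp
  qed
  have a2: "0 < 1 - a\<^sup>2" using a a1 by (simp add: power_less_one_iff)
  then have "log 2 (s / ((1 - a\<^sup>2) * s)) / 2 \<le> R" using s by (intro low) auto
  moreover have "s / ((1 - a\<^sup>2) * s) = 1 / (1 - a\<^sup>2)" using s by simp
  ultimately show "- log 2 (1 - a\<^sup>2) / 2 \<le> R" using a2 by (simp add: log_divide)
qed

text \<open>Given \<open>x\<^sub>2\<close>, the observation \<open>u\<^sub>1\<close> is a noisy version of the innovation \<open>n\<close>, and \<open>u\<^sub>2\<close> is a
  function of \<open>x\<^sub>2\<close> and of noise that is independent of everything else.\<close>

lemma difference_information_le:
  assumes M: "prob_space M" and t: "0 < t" and N: "0 < N"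
    and n: "distributed M lborel n (normal_density 0 (sqrt t))" and ny: "indep_rv M borel n borel y"
    and w1: "distributed M lborel w1 (normal_density 0 (sqrt N))" and ww: "indep_rv M borel w1 borel w2"
    and ind: "indep_rv M (borel \<Otimes>\<^sub>M borel) (\<lambda>\<omega>. (n \<omega>, y \<omega>)) (borel \<Otimes>\<^sub>M borel) (\<lambda>\<omega>. (w1 \<omega>, w2 \<omega>))"
    and z: "distributed M lborel (\<lambda>\<omega>. n \<omega> + c * y \<omega>) (normal_density 0 (sqrt 1))"
  shows "emutual_information M borel (borel \<Otimes>\<^sub>M (borel \<Otimes>\<^sub>M borel)) (\<lambda>\<omega>. n \<omega> + c * y \<omega>)
      (\<lambda>\<omega>. (a * n \<omega> + w1 \<omega>, (y \<omega>, w2 \<omega>))) \<le> ereal (log 2 (1 / (t * N / (a\<^sup>2 * t + N))) / 2)"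
proof -
  interpret prob_space M by fact
  note [measurable] = indep_rvD(1,2)[OF ny] indep_rvD(1,2)[OF ww]
  have "indep_rv M borel w1 (borel \<Otimes>\<^sub>M (borel \<Otimes>\<^sub>M borel)) (\<lambda>\<omega>. (w2 \<omega>, (n \<omega>, y \<omega>)))"
    by (rule indep_rv_assoc[OF ww indep_rv_swap[OF ind]])
  then have "indep_rv M borel (\<lambda>\<omega>. w1 \<omega>) (borel \<Otimes>\<^sub>M borel) (\<lambda>\<omega>. (\<lambda>(b, (c, d)). (d, b)) (w2 \<omega>, (n \<omega>, y \<omega>)))"
    by (rule indep_rv_compose) measurable
  then have w1yw: "indep_rv M borel w1 (borel \<Otimes>\<^sub>M borel) (\<lambda>\<omega>. (y \<omega>, w2 \<omega>))" by simp
  have "indep_rv M borel n (borel \<Otimes>\<^sub>M (borel \<Otimes>\<^sub>M borel)) (\<lambda>\<omega>. (y \<omega>, (w1 \<omega>, w2 \<omega>)))"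
    by (rule indep_rv_assoc[OF ny ind])
  then have "indep_rv M borel (\<lambda>\<omega>. n \<omega>) (borel \<Otimes>\<^sub>M (borel \<Otimes>\<^sub>M borel)) (\<lambda>\<omega>. (\<lambda>(b, (c, d)). (c, (b, d))) (y \<omega>, (w1 \<omega>, w2 \<omega>)))"
    by (rule indep_rv_compose) measurable
  then have nw: "indep_rv M borel n (borel \<Otimes>\<^sub>M (borel \<Otimes>\<^sub>M borel)) (\<lambda>\<omega>. (w1 \<omega>, (y \<omega>, w2 \<omega>)))" by simp
  have 1: "indep_rv M (borel \<Otimes>\<^sub>M borel) (\<lambda>\<omega>. (n \<omega>, w1 \<omega>)) (borel \<Otimes>\<^sub>M borel) (\<lambda>\<omega>. (y \<omega>, w2 \<omega>))"
    by (rule indep_rv_assoc'[OF w1yw nw])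
  have "indep_rv M borel (\<lambda>\<omega>. n \<omega>) borel (\<lambda>\<omega>. fst (w1 \<omega>, (y \<omega>, w2 \<omega>)))"
    by (rule indep_rv_compose[OF nw]) measurable
  then have nw1: "indep_rv M borel n borel w1" by simp
  \<comment> \<open>Regression of \<open>n\<close> on \<open>a * n + w1\<close>; the residual
    \<open>e\<close> is independent of that observation and of \<open>y\<close> and
    \<open>w2\<close>.\<close>
  define k where "k = a * t / (a\<^sup>2 * t + N)"
  define e where "e \<omega> = n \<omega> - k * (a * n \<omega> + w1 \<omega>)" for \<omega>
  have e: "distributed M lborel e (normal_density 0 (sqrt (t * N / (a\<^sup>2 * t + N))))"
    and et: "indep_rv M borel e borel (\<lambda>\<omega>. a * n \<omega> + w1 \<omega>)"
    using indep_normal_regression(1,3)[OF nw1 t N n w1, of a] by (simp_all add: e_def[abs_def] k_def)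
  have "indep_rv M (borel \<Otimes>\<^sub>M borel) (\<lambda>\<omega>. (\<lambda>(b, c). (b - k * (a * b + c), a * b + c)) (n \<omega>, w1 \<omega>)) (borel \<Otimes>\<^sub>M borel) (\<lambda>\<omega>. (y \<omega>, w2 \<omega>))"
    by (rule indep_rv_compose[OF 1, where g="\<lambda>z. z"]) measurable
  then have "indep_rv M borel e (borel \<Otimes>\<^sub>M (borel \<Otimes>\<^sub>M borel)) (\<lambda>\<omega>. (a * n \<omega> + w1 \<omega>, (y \<omega>, w2 \<omega>)))"
    by (intro indep_rv_assoc[OF et]) (simp add: e_def)
  note ind_e = indep_rv_swap[OF this]
  have m: "0 < t * N / (a\<^sup>2 * t + N)" using t N by (simp add: add_nonneg_pos)
  \<comment> \<open>Given the genie's data, \<open>n + c * y\<close> is estimated by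
    \<open>k * (a * n + w1) + c * y\<close>, and the error is exactly \<open>e\<close>.\<close>
  show ?thesis
    by (rule emutual_information_normal_le[OF M _ m z e ind_e, where L="\<lambda>(b, (c', d)). k * b + c * c'"])
      (auto simp: e_def algebra_simps)
qed

lemma subalgebra_vimage_algebra:
  assumes "f \<in> measurable M N"
  shows "subalgebra M (vimage_algebra (space M) f N)"
proof -
  have "f \<in> space M \<rightarrow> space N" using assms by (auto dest: measurable_space)
  then show ?thesis
    using measurable_sets[OF assms] by (auto simp: subalgebra_def sets_vimage_algebra2)
qed

text \<open>The third encoder must supply the information about \<open>x 3\<close> that the
  distortion demands and the other two cannot give. The conditional expectation is measurable with
  respect to the observations, so it factors through \<open>u\<close> and serves as the estimator in
  the Gaussian lower bound.\<close>

lemma third_rate_ge: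
  assumes M: "prob_space M" and X: "distributed M lborel (x 3) (normal_density 0 (sqrt 1))"
    and u: "\<And>i. i \<in> users \<Longrightarrow> u i \<in> borel_measurable M" and m: "0 < m"
    and le: "emutual_information M (vec_space {3}) (vec_space (users - {3})) (subvector {3} x) (subvector (users - {3}) u)
      \<le> ereal (log 2 (1 / m) / 2)"
    and rate: "econditional_mutual_information M (vec_space {3}) (vec_space {3}) (vec_space (users - {3}))
               (subvector {3} x) (subvector {3} u) (subvector (users - {3}) u) \<le> ereal R"
    and v: "mmse M (x 3) u \<le> v" "0 < v"
  shows "log 2 (m / v) / 2 \<le> R"
proof -
  interpret prob_space M by fact
  let ?F = "vimage_algebra (space M) (subvector users u) (vec_space users)"
  let ?Y = "\<lambda>\<omega>. (subvector {3} u \<omega>, subvector (users - {3}) u \<omega>)"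
  have x3[measurable]: "x 3 \<in> borel_measurable M" using X by (simp add: distributed_def)
  have mu: "subvector A u \<in> measurable M (vec_space A)" if "A \<subseteq> users" for A
    using u that by (intro measurable_subvector) blast
  have mx: "subvector {3} x \<in> measurable M (vec_space {3})"
    by (intro measurable_subvector) simp
  have mY: "?Y \<in> measurable M (vec_space {3} \<Otimes>\<^sub>M vec_space (users - {3}))"
    by (intro measurable_Pair mu) auto
  have F: "subalgebra M ?F" by (intro subalgebra_vimage_algebra mu) simp
  have x2: "integrable M (\<lambda>\<omega>. (x 3 \<omega>)\<^sup>2)" by (rule normal_square_integrable[OF _ X]) simp
  define C where "C = real_cond_exp M ?F (x 3)"
  have CF: "C \<in> borel_measurable ?F" by (simp add: C_def)
  then have [measurable]: "C \<in> borel_measurable M" using F by (rule measurable_from_subalg[rotated])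
  have C2: "integrable M (\<lambda>\<omega>. (C \<omega>)\<^sup>2)"
    unfolding C_def by (rule cond_exp_square_integrable[OF F x3 x2])
  have D2: "integrable M (\<lambda>\<omega>. (x 3 \<omega> - C \<omega>)\<^sup>2)"
    using square_integrable_add[OF _ _ x2 C2, of 1 "-1"] by simp
  have "subvector users u \<in> space M \<rightarrow> space (vec_space users)"
    using mu[of users] by (auto dest: measurable_space)
  then obtain L where L[measurable]: "L \<in> borel_measurable (vec_space users)"
    and CL: "\<And>\<omega>. \<omega> \<in> space M \<Longrightarrow> C \<omega> = L (subvector users u \<omega>)"
    using vimage_algebra_factorization[OF _ CF] by metis
  \<comment> \<open>Reassembles the vector \<open>u\<close> from the split form that the chain rule
    uses.\<close>
  define h where "h = (\<lambda>p :: (nat \<Rightarrow> real) \<times> (nat \<Rightarrow> real). \<lambda>i\<in>users. if i = 3 then fst p i else snd p i)"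
  have h[measurable]: "h \<in> measurable (vec_space {3} \<Otimes>\<^sub>M vec_space (users - {3})) (vec_space users)"
    unfolding h_def
  proof (rule measurable_restrict)
    fix i :: nat assume i: "i \<in> users"
    show "(\<lambda>p. if i = 3 then fst p i else snd p i) \<in> measurable (vec_space {3} \<Otimes>\<^sub>M vec_space (users - {3})) borel"
    proof (cases "i = 3")
      case True
      then show ?thesis
        by (simp add: measurable_compose[OF measurable_fst measurable_component_singleton])
    next
      case False
      then have "(\<lambda>b. b i) \<in> borel_measurable (vec_space (users - {3}))"
        using i by (intro measurable_component_singleton) auto
      then show ?thesis using False measurable_compose[OF measurable_snd] by simp
    qed
  qed
  have hY: "h (?Y \<omega>) = subvector users u \<omega>" for \<omega>
    by (auto simp: h_def fun_eq_iff)
  have DL: "(x 3 \<omega> - L (h (?Y \<omega>)))\<^sup>2 = (x 3 \<omega> - C \<omega>)\<^sup>2" if "\<omega> \<in> space M" for \<omega>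
    using CL[OF that] hY by simp
  have i: "integrable M (\<lambda>\<omega>. (x 3 \<omega> - L (h (?Y \<omega>)))\<^sup>2)"
    using D2 DL by (subst Bochner_Integration.integrable_cong[OF refl]) auto
  have "expectation (\<lambda>\<omega>. (x 3 \<omega> - L (h (?Y \<omega>)))\<^sup>2) = mmse M (x 3) u"
    unfolding mmse_def C_def[symmetric] using DL by (intro Bochner_Integration.integral_cong) auto
  then have E: "expectation (\<lambda>\<omega>. (x 3 \<omega> - L (h (?Y \<omega>)))\<^sup>2) \<le> v" using v by simp
  have mL: "(\<lambda>p. L (h p)) \<in> borel_measurable (vec_space {3} \<Otimes>\<^sub>M vec_space (users - {3}))"
    by measurable
  have f3: "(\<lambda>b. b 3) \<in> borel_measurable (vec_space {3})"
    by (rule measurable_component_singleton) simp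
  have id: "(\<lambda>p. p) \<in> measurable (vec_space {3} \<Otimes>\<^sub>M vec_space (users - {3})) (vec_space {3} \<Otimes>\<^sub>M vec_space (users - {3}))"
    by simp
  have "ereal (log 2 (1 / v) / 2) \<le> emutual_information M borel (vec_space {3} \<Otimes>\<^sub>M vec_space (users - {3})) (x 3) ?Y"
    by (rule emutual_information_normal_ge[OF M _ X mY mL i E v(2)]) simp
  also have "\<dots> = emutual_information M borel (vec_space {3} \<Otimes>\<^sub>M vec_space (users - {3})) (\<lambda>\<omega>. subvector {3} x \<omega> 3) ?Y"
    by simp
  also have "\<dots> \<le> emutual_information M (vec_space {3}) (vec_space {3} \<Otimes>\<^sub>M vec_space (users - {3})) (subvector {3} x) ?Y"
    by (rule emutual_information_mono[OF M mx mY f3 id])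
  finally have I1: "ereal (log 2 (1 / v) / 2) \<le> \<dots>" .
  have I2: "0 \<le> emutual_information M (vec_space {3}) (vec_space (users - {3})) (subvector {3} x) (subvector (users - {3}) u)"
    by (intro emutual_information_nonneg[OF M] mx mu) auto
  \<comment> \<open>By \<open>le\<close> the subtracted information is finite, so
    \<open>\<infinity> - \<infinity>\<close> does not arise here.\<close>
  have "ereal (log 2 (1 / v) / 2) - ereal (log 2 (1 / m) / 2) \<le> ereal R"
    using ereal_minus_mono[OF I1 le] rate
    unfolding econditional_mutual_information_def by (rule order_trans)
  moreover have "log 2 (1 / v) / 2 - log 2 (1 / m) / 2 = log 2 (m / v) / 2"
    using m v by (simp add: log_divide)
  ultimately show ?thesis by simp
qed

text \<open>Of the test channel only \<open>a = \<alpha> 1\<close> survives, linking the constraints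
  for all users and for \<open>{3}\<close>. The last bound is stated for every positive
  \<open>v\<close> above \<open>d\<close> because \<open>d = 0\<close> has not been excluded
  yet.\<close>

lemma RD_in_bounds:
  assumes src: "difference_source s M x" and s: "1 / 2 < s" and u: "u \<in> test_channels M x d"
    and rate: "\<And>A. A \<subseteq> users \<Longrightarrow> econditional_mutual_information M (vec_space A) (vec_space A) (vec_space (users - A))
               (subvector A x) (subvector A u) (subvector (users - A) u) \<le> ereal (\<Sum>i\<in>A. R i)"
  shows "0 \<le> R 1" "0 \<le> R 2" "0 \<le> R 3" "0 \<le> d"
    and "\<exists>a\<ge>0. a < 1 \<and> - log 2 (1 - a\<^sup>2) / 2 \<le> R 1 + R 2 + R 3 \<and>
      (\<forall>v>0. d \<le> v \<longrightarrow> log 2 ((1 - 1 / (4 * s)) * ((1 - a\<^sup>2) * s) / (a\<^sup>2 * (1 - 1 / (4 * s)) + (1 - a\<^sup>2) * s) / v) / 2 \<le> R 3)"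
proof -
  note S = difference_sourceD[OF src s]
  interpret prob_space M by (rule S(1))
  have s0: "0 < s" and t0: "0 < 1 - 1 / (4 * s)" using s by (auto simp: field_simps)
  obtain \<alpha> w where all: "\<forall>i\<in>users. 0 \<le> \<alpha> i \<and> \<alpha> i \<le> 1"
    "\<forall>i\<in>users. u i = (\<lambda>\<omega>. \<alpha> i * x i \<omega> + w i \<omega>)"
    "\<forall>i\<in>users. gaussian M (w i) 0 ((1 - (\<alpha> i)\<^sup>2) * (if i = 3 then 1 else s))"
    and iw: "indep_vars (\<lambda>_. borel) w users"
    and wx: "indep_rv M (vec_space users) (subvector users w) (vec_space users) (subvector users x)"
    and d: "mmse M (x 3) u \<le> d"
    using test_channelsD[OF u s src] by blast
  note \<alpha> = all(1)[rule_format] and ui = all(2)[rule_format] and gw = all(3)[rule_format]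
  have x[measurable]: "x 1 \<in> borel_measurable M" "x 2 \<in> borel_measurable M" "x 3 \<in> borel_measurable M"
    using S(3,5,6) by (auto simp: distributed_def)
  have mx: "x i \<in> borel_measurable M" if "i \<in> users" for i using that x by auto
  have mw: "w i \<in> borel_measurable M" if "i \<in> users" for i using gaussian_measurable[OF gw[OF that]] .
  have mu: "u i \<in> borel_measurable M" if "i \<in> users" for i
    using mx[OF that] mw[OF that] unfolding ui[OF that] by measurable
  have sx: "subvector A x \<in> measurable M (vec_space A)" if "A \<subseteq> users" for A
    using mx that by (intro measurable_subvector) blast
  have su: "subvector A u \<in> measurable M (vec_space A)" if "A \<subseteq> users" for A
    using mu that by (intro measurable_subvector) blast
  have R: "0 \<le> R i" if "i \<in> users" for i
  proof -
    have "0 \<le> econditional_mutual_information M (vec_space {i}) (vec_space {i}) (vec_space (users - {i}))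
               (subvector {i} x) (subvector {i} u) (subvector (users - {i}) u)"
      using that by (intro econditional_mutual_information_nonneg[OF S(1)] sx su) auto
    also have "\<dots> \<le> ereal (\<Sum>i\<in>{i}. R i)" using that by (intro rate) auto
    finally show ?thesis by simp
  qed
  then show "0 \<le> R 1" "0 \<le> R 2" "0 \<le> R 3" by auto
  show "0 \<le> d" using d by (rule order_trans[rotated]) (simp add: mmse_def)
  have comp: "indep_rv M borel (x i) borel (w j)" if "i \<in> users" "j \<in> users" for i j
  proof -
    have "indep_rv M borel (\<lambda>\<omega>. subvector users x \<omega> i) borel (\<lambda>\<omega>. subvector users w \<omega> j)"
      by (rule indep_rv_compose[OF indep_rv_swap[OF wx]]) (rule measurable_component_singleton, fact)+
    then show ?thesis using that by simp
  qed
  define a where "a = \<alpha> 1"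
  have a: "0 \<le> a" "a \<le> 1" using \<alpha>[of 1] by (auto simp: a_def)
  have u1: "u 1 = (\<lambda>\<omega>. a * x 1 \<omega> + w 1 \<omega>)" unfolding a_def by (rule ui) simp
  have gw1: "gaussian M (w 1) 0 ((1 - a\<^sup>2) * s)" using gw[of 1] by (simp add: a_def)
  have rate1: "econditional_mutual_information M (vec_space users) (vec_space users) (vec_space (users - users))
               (subvector users x) (subvector users u) (subvector (users - users) u) \<le> ereal (R 1 + R 2 + R 3)"
    using rate[of users] by (simp add: add.assoc)
  have xw1: "indep_rv M borel (x 1) borel (w 1)" by (rule comp) auto
  note sr = sum_rate_ge[OF S(1) s0 S(5) mx gw1 xw1 a u1 mu rate1]
  have N: "0 < (1 - a\<^sup>2) * s" using sr(1) a s0 by (simp add: power_less_one_iff)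
  have w1: "distributed M lborel (w 1) (normal_density 0 (sqrt ((1 - a\<^sup>2) * s)))"
    using gw1 N unfolding gaussian_def by (metis less_irrefl)
  have "indep_var (vec_space {1}) (subvector {1} w) (vec_space {2}) (subvector {2} w)"
    by (rule indep_var_restrict[OF iw]) auto
  then have w12: "indep_rv M (vec_space {1}) (subvector {1} w) (vec_space {2}) (subvector {2} w)"
    by (simp only: indep_rv_iff_indep_var)
  have "indep_rv M borel (\<lambda>\<omega>. subvector {1} w \<omega> 1) borel (\<lambda>\<omega>. subvector {2} w \<omega> 2)"
    by (rule indep_rv_compose[OF w12]) (rule measurable_component_singleton, simp)+
  then have ww: "indep_rv M borel (w 1) borel (w 2)" by simp
  define r where "r = 1 - 1 / (2 * s)"
  have p: "(\<lambda>b. b i) \<in> borel_measurable (vec_space users)" if "i \<in> users" for i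
    using that by (rule measurable_component_singleton)
  note [measurable] = p[of 1, simplified] p[of 2, simplified]
  have "indep_rv M (borel \<Otimes>\<^sub>M borel) (\<lambda>\<omega>. (\<lambda>b. (b 1 - r * b 2, b 2)) (subvector users x \<omega>))
      (borel \<Otimes>\<^sub>M borel) (\<lambda>\<omega>. (\<lambda>b. (b 1, b 2)) (subvector users w \<omega>))"
    by (rule indep_rv_compose[OF indep_rv_swap[OF wx]]; measurable)
  then have ind: "indep_rv M (borel \<Otimes>\<^sub>M borel) (\<lambda>\<omega>. (x 1 \<omega> - r * x 2 \<omega>, x 2 \<omega>)) (borel \<Otimes>\<^sub>M borel) (\<lambda>\<omega>. (w 1 \<omega>, w 2 \<omega>))"
    by simp
  have z3: "x 3 = (\<lambda>\<omega>. (x 1 \<omega> - r * x 2 \<omega>) + (r - 1) * x 2 \<omega>)"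
    unfolding S(7) by (simp add: algebra_simps)
  have z: "distributed M lborel (\<lambda>\<omega>. (x 1 \<omega> - r * x 2 \<omega>) + (r - 1) * x 2 \<omega>) (normal_density 0 (sqrt 1))"
    using S(6) unfolding z3 .
  let ?m = "(1 - 1 / (4 * s)) * ((1 - a\<^sup>2) * s) / (a\<^sup>2 * (1 - 1 / (4 * s)) + (1 - a\<^sup>2) * s)"
  let ?Z = "\<lambda>\<omega>. (a * (x 1 \<omega> - r * x 2 \<omega>) + w 1 \<omega>, (x 2 \<omega>, w 2 \<omega>))"
  have I: "emutual_information M borel (borel \<Otimes>\<^sub>M (borel \<Otimes>\<^sub>M borel)) (x 3) ?Z \<le> ereal (log 2 (1 / ?m) / 2)"
    unfolding z3
    by (rule difference_information_le[OF S(1) t0 N S(2)[folded r_def] S(4)[folded r_def] w1 ww ind z])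
  have m: "0 < ?m" using t0 N by (simp add: add_nonneg_pos)
  define f where "f = (\<lambda>c :: real. \<lambda>i\<in>{3::nat}. c)"
  \<comment> \<open>With \<open>n = x 1 - r * x 2\<close> the outputs are
    \<open>u 1 = (a * n + w 1) + a * r * x 2\<close> and
    \<open>u 2 = \<alpha> 2 * x 2 + w 2\<close>, hence functions of the genie's triple.\<close>
  define g where "g = (\<lambda>p :: real \<times> real \<times> real. \<lambda>i\<in>users - {3}. if i = 1 then fst p + a * r * fst (snd p) else \<alpha> 2 * fst (snd p) + snd (snd p))"
  have f: "f \<in> measurable borel (vec_space {3})" unfolding f_def by (intro measurable_restrict) simp
  have g: "g \<in> measurable (borel \<Otimes>\<^sub>M (borel \<Otimes>\<^sub>M borel)) (vec_space (users - {3}))"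
    unfolding g_def by (intro measurable_restrict) measurable
  have mZ: "?Z \<in> measurable M (borel \<Otimes>\<^sub>M (borel \<Otimes>\<^sub>M borel))"
    using mw[of 1] mw[of 2] by measurable
  have "emutual_information M (vec_space {3}) (vec_space (users - {3})) (\<lambda>\<omega>. f (x 3 \<omega>)) (\<lambda>\<omega>. g (?Z \<omega>))
      \<le> emutual_information M borel (borel \<Otimes>\<^sub>M (borel \<Otimes>\<^sub>M borel)) (x 3) ?Z"
    by (rule emutual_information_mono[OF S(1) x(3) mZ f g])
  moreover have "(\<lambda>\<omega>. f (x 3 \<omega>)) = subvector {3} x" by (auto simp: f_def fun_eq_iff)
  moreover have "(\<lambda>\<omega>. g (?Z \<omega>)) = subvector (users - {3}) u"
    using u1 ui[of 2] by (auto simp: g_def fun_eq_iff algebra_simps)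
  ultimately have le: "emutual_information M (vec_space {3}) (vec_space (users - {3})) (subvector {3} x) (subvector (users - {3}) u)
      \<le> ereal (log 2 (1 / ?m) / 2)"
    using I by simp
  have rate3: "econditional_mutual_information M (vec_space {3}) (vec_space {3}) (vec_space (users - {3}))
               (subvector {3} x) (subvector {3} u) (subvector (users - {3}) u) \<le> ereal (R 3)"
    using rate[of "{3}"] by simp
  have "log 2 (?m / v) / 2 \<le> R 3" if "0 < v" "d \<le> v" for v
    using d that by (intro third_rate_ge[OF S(1,6) mu m le rate3]) auto
  then show "\<exists>a\<ge>0. a < 1 \<and> - log 2 (1 - a\<^sup>2) / 2 \<le> R 1 + R 2 + R 3 \<and>
      (\<forall>v>0. d \<le> v \<longrightarrow> log 2 ((1 - 1 / (4 * s)) * ((1 - a\<^sup>2) * s) / (a\<^sup>2 * (1 - 1 / (4 * s)) + (1 - a\<^sup>2) * s) / v) / 2 \<le> R 3)"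
    using sr a by blast
qed

section \<open>From logarithmic bounds to supporting half-spaces of the region\<close>

text \<open>With \<open>T = min 1 S\<close>, the point \<open>1 + T * s\<close> is a convex
  combination of 1 and \<open>1 + s\<close>, so the concave logarithm lies above the chord
  there.\<close>

lemma log_concave_bound:
  assumes "0 \<le> (S::real)" "0 \<le> s"
  shows "min 1 S * log 2 (1 + s) \<le> log 2 (1 + S * s)"
proof -
  define T where "T = min 1 S"
  have T: "0 \<le> T" "T \<le> 1" "T \<le> S" using assms by (auto simp: T_def)
  have "(1 - T) * log 2 1 + T * log 2 (1 + s) \<le> log 2 ((1 - T) *\<^sub>R 1 + T *\<^sub>R (1 + s))"
    using log_concave[of 2] T assms by (intro concave_onD) auto
  also have "(1 - T) *\<^sub>R 1 + T *\<^sub>R (1 + s) = 1 + T * s" by (simp add: algebra_simps)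
  also have "log 2 (1 + T * s) \<le> log 2 (1 + S * s)"
    using T assms by (subst log_le_cancel_iff) (auto simp: mult_right_mono add_pos_nonneg)
  finally show ?thesis by (simp add: T_def)
qed

text \<open>Eliminates \<open>a\<close> between the two rate bounds. The hypothesis
  \<open>c + 1 \<le> 4 * s\<close> keeps the cost \<open>c / (4 * s - 1)\<close> of revealing
  \<open>x2\<close> below the additive constant 1, and \<open>2 powr (2 * c) \<le> 1 + s\<close>
  makes the chord slope in \<open>log_concave_bound\<close> at least \<open>2 * c\<close>.\<close>

lemma rate_distortion_tradeoff:
  fixes c s d R R3 a :: real
  assumes c: "0 \<le> c" and s: "1 \<le> s" "c + 1 \<le> 4 * s" "2 powr (2 * c) \<le> 1 + s"
    and a: "0 \<le> a" "a < 1" and sum: "- log 2 (1 - a\<^sup>2) / 2 \<le> R" and R3: "0 \<le> R3" and d: "0 \<le> d"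
    and third: "\<And>v. 0 < v \<Longrightarrow> d \<le> v \<Longrightarrow>
      log 2 ((1 - 1 / (4 * s)) * ((1 - a\<^sup>2) * s) / (a\<^sup>2 * (1 - 1 / (4 * s)) + (1 - a\<^sup>2) * s) / v) / 2 \<le> R3"
  shows "c * (1 - d) \<le> R + 2 * ln 2 * c * R3 + 1"
proof -
  define t where "t = 1 - 1 / (4 * s)"
  define N where "N = (1 - a\<^sup>2) * s"
  define m where "m = t * N / (a\<^sup>2 * t + N)"
  define S where "S = a\<^sup>2 / N"
  have t: "0 < t" "t \<le> 1" using s by (auto simp: t_def field_simps)
  have a2: "a\<^sup>2 < 1" using a by (simp add: power_less_one_iff)
  have N: "0 < N" using a2 s by (simp add: N_def)
  have m: "0 < m" using t N by (simp add: m_def add_nonneg_pos)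
  have third: "log 2 (m / v) / 2 \<le> R3" if "0 < v" "d \<le> v" for v
    using third[OF that] by (simp add: m_def t_def N_def)
  \<comment> \<open>For \<open>d = 0\<close> every positive \<open>v\<close> is admissible, and a
    small enough one contradicts the finite \<open>R3\<close>.\<close>
  have dpos: "0 < d"
  proof (rule ccontr)
    assume "\<not> 0 < d"
    then have "log 2 (m / (m / 2 powr (2 * R3 + 2))) / 2 \<le> R3" using d m by (intro third) auto
    moreover have "log 2 (m / (m / 2 powr (2 * R3 + 2))) = 2 * R3 + 2" using m by simp
    ultimately show False by simp
  qed
  have "ln m - ln d \<le> 2 * ln 2 * R3"
    using third[OF dpos order_refl] m dpos by (simp add: log_def ln_div field_simps)
  moreover have "1 - d \<le> - ln d" using ln_le_minus_one[OF dpos] by simp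
  moreover have "- ln m \<le> 1 / (4 * s - 1) + S"
  proof -
    \<comment> \<open>The factor \<open>1 / t\<close> accounts for what \<open>x2\<close> tells
      about \<open>x3\<close>, the other for what \<open>u1\<close> adds about the innovation; each
      logarithm is bounded by its tangent at 1.\<close>
    have "1 / m = 1 / t * (1 + a\<^sup>2 * t / N)" using t N by (simp add: m_def field_simps)
    then have "- ln m = ln (1 / t * (1 + a\<^sup>2 * t / N))" using m by (metis ln_div ln_one diff_0 less_irrefl zero_less_one)
    also have "\<dots> = ln (1 / t) + ln (1 + a\<^sup>2 * t / N)"
      using t N by (intro ln_mult_pos) (auto intro!: add_pos_nonneg)
    also have "ln (1 / t) \<le> 1 / t - 1" using t by (intro ln_le_minus_one) simp
    also have "1 / t - 1 = 1 / (4 * s - 1)" using s by (simp add: t_def field_simps)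
    also have "ln (1 + a\<^sup>2 * t / N) \<le> a\<^sup>2 * t / N"
      using t N ln_le_minus_one[of "1 + a\<^sup>2 * t / N"] by (simp add: add_pos_nonneg)
    also have "a\<^sup>2 * t / N \<le> S"
      unfolding S_def using t N by (intro divide_right_mono) (auto simp: mult_left_le)
    finally show ?thesis by simp
  qed
  ultimately have "1 - d \<le> 2 * ln 2 * R3 + 1 / (4 * s - 1) + S" by linarith
  moreover have S0: "0 \<le> S" using N by (simp add: S_def)
  moreover have "0 \<le> 2 * ln 2 * R3" using R3 by simp
  moreover have "0 \<le> 1 / (4 * s - 1)" using s by simp
  \<comment> \<open>Capping \<open>S\<close> costs nothing: the left side is at most 1 and the other
    summands on the right are nonnegative.\<close>
  ultimately have "1 - d \<le> 2 * ln 2 * R3 + 1 / (4 * s - 1) + min 1 S" using d by linarith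
  then have "c * (1 - d) \<le> c * (2 * ln 2 * R3 + 1 / (4 * s - 1) + min 1 S)"
    using c by (rule mult_left_mono)
  also have "\<dots> = 2 * ln 2 * c * R3 + c / (4 * s - 1) + min 1 S * c"
    by (simp add: algebra_simps)
  also have "c / (4 * s - 1) \<le> 1" using s by simp
  also have "min 1 S * c \<le> R"
  proof -
    have "log 2 (2 powr (2 * c)) \<le> log 2 (1 + s)" using s by (subst log_le_cancel_iff) auto
    then have "2 * c \<le> log 2 (1 + s)" by simp
    then have "min 1 S * (2 * c) \<le> min 1 S * log 2 (1 + s)" using S0 by (intro mult_left_mono) auto
    also have "\<dots> \<le> log 2 (1 + S * s)" using S0 s by (intro log_concave_bound) auto
    \<comment> \<open>This identity recognizes the sum-rate bound as
      \<open>log 2 (1 + S * s) / 2\<close>.\<close>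
    also have "1 + S * s = 1 / (1 - a\<^sup>2)" using a2 s by (simp add: S_def N_def field_simps)
    also have "log 2 (1 / (1 - a\<^sup>2)) = - log 2 (1 - a\<^sup>2)" using a2 by (simp add: log_divide)
    finally show ?thesis using sum by simp
  qed
  finally show ?thesis by simp
qed

text \<open>Each bound defines a closed half-space that contains \<open>RD_in\<close>. The tradeoff
  is applied to the total rate including \<open>R3\<close>, hence the coefficient
  \<open>1 + 2 * ln 2 * c\<close>.\<close>

lemma RD_region_bounds:
  assumes c: "0 \<le> c" and s: "1 \<le> s" "c + 1 \<le> 4 * s" "2 powr (2 * c) \<le> 1 + s"
    and mem: "(R1, R2, R3, d) \<in> RD_region s"
  shows "0 \<le> R1" "0 \<le> R2" "c * (1 - d) \<le> R1 + R2 + (1 + 2 * ln 2 * c) * R3 + 1"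
proof -
  let ?H = "{p :: real \<times> real \<times> real \<times> real. 0 \<le> fst p} \<inter> {p. 0 \<le> fst (snd p)} \<inter>
    {p. c * (1 - snd (snd (snd p))) \<le> fst p + fst (snd p) + (1 + 2 * ln 2 * c) * fst (snd (snd p)) + 1}"
  have cl: "closed ?H"
    by (intro closed_Int closed_Collect_le continuous_intros)
  have "convex ?H"
  proof (intro convex_Int)
    show "convex {p :: real \<times> real \<times> real \<times> real. 0 \<le> fst p}"
      "convex {p :: real \<times> real \<times> real \<times> real. 0 \<le> fst (snd p)}"
      by (auto simp: convex_def)
    let ?f = "\<lambda>p :: real \<times> real \<times> real \<times> real. fst p + fst (snd p) + (1 + 2 * ln 2 * c) * fst (snd (snd p)) + c * snd (snd (snd p))"
    have "linear ?f" by (rule linearI) (auto simp: algebra_simps)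
    then have "convex (?f -` {c - 1..})" by (rule convex_linear_vimage) simp
    moreover have "?f -` {c - 1..} = {p. c * (1 - snd (snd (snd p))) \<le> fst p + fst (snd p) + (1 + 2 * ln 2 * c) * fst (snd (snd p)) + 1}"
      by (auto simp: algebra_simps)
    ultimately show "convex {p :: real \<times> real \<times> real \<times> real. c * (1 - snd (snd (snd p))) \<le> fst p + fst (snd p) + (1 + 2 * ln 2 * c) * fst (snd (snd p)) + 1}"
      by metis
  qed
  moreover have "RD_in s \<subseteq> ?H"
  proof
    fix p assume "p \<in> RD_in s"
    then obtain R d M x u where p: "p = (R 1, R 2, R 3, d)"
      and src: "difference_source s (M :: (nat \<Rightarrow> real) measure) x" and u: "u \<in> test_channels M x d"
      and rate: "\<And>A. A \<subseteq> users \<Longrightarrow> econditional_mutual_information M (vec_space A) (vec_space A) (vec_space (users - A))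
               (subvector A x) (subvector A u) (subvector (users - A) u) \<le> ereal (\<Sum>i\<in>A. R i)"
      unfolding RD_in_def by blast
    have s2: "1 / 2 < s" using s by simp
    note b = RD_in_bounds[OF src s2 u rate]
    obtain a where a: "0 \<le> a" "a < 1" "- log 2 (1 - a\<^sup>2) / 2 \<le> R 1 + R 2 + R 3"
      "\<And>v. 0 < v \<Longrightarrow> d \<le> v \<Longrightarrow> log 2 ((1 - 1 / (4 * s)) * ((1 - a\<^sup>2) * s) / (a\<^sup>2 * (1 - 1 / (4 * s)) + (1 - a\<^sup>2) * s) / v) / 2 \<le> R 3"
      using b(5) by blast
    have "c * (1 - d) \<le> (R 1 + R 2 + R 3) + 2 * ln 2 * c * R 3 + 1"
      by (rule rate_distortion_tradeoff[OF c s a(1,2,3) b(3,4) a(4)])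
    then show "p \<in> ?H" using b(1,2) by (simp add: p algebra_simps)
  qed
  ultimately have "RD_region s \<subseteq> ?H"
    unfolding RD_region_def by (intro closure_minimal hull_minimal cl)
  then show "0 \<le> R1" "0 \<le> R2" "c * (1 - d) \<le> R1 + R2 + (1 + 2 * ln 2 * c) * R3 + 1"
    using mem by auto
qed

section \<open>Achievability\<close>

text \<open>The definition of \<open>RD_in\<close> asks for a measure on
  \<open>nat \<Rightarrow> real\<close>; a finite product of standard normal laws is such a measure
  and provides independent variables as coordinates.\<close>

lemma std_normal_coordinates:
  fixes n :: nat
  assumes n: "0 < n"
  defines "M \<equiv> (\<Pi>\<^sub>M i\<in>{..<n}. density lborel std_normal_density)"
  shows "prob_space M"
    and "prob_space.indep_vars M (\<lambda>_. borel) (\<lambda>i \<omega>. \<omega> i) {..<n}"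
    and "i < n \<Longrightarrow> distributed M lborel (\<lambda>\<omega>. \<omega> i) std_normal_density"
proof -
  let ?N = "density lborel std_normal_density"
  have N: "prob_space ?N" by (rule prob_space_normal_density) simp
  interpret N: prob_space ?N by fact
  interpret prod: product_prob_space "\<lambda>_. ?N" "{..<n}" by unfold_locales
  show M: "prob_space M" unfolding M_def by (rule prob_space_PiM) (rule N)
  interpret prob_space M by fact
  have m: "(\<lambda>\<omega>. \<omega> i) \<in> borel_measurable M" if "i < n" for i
  proof -
    have "(\<lambda>\<omega>. \<omega> i) \<in> measurable M ?N"
      unfolding M_def using that by (intro measurable_component_singleton) simp
    then show ?thesis by simp
  qed
  have c: "distr M borel (\<lambda>\<omega>. \<omega> i) = ?N" if "i < n" for i
  proof -
    have "distr M borel (\<lambda>\<omega>. \<omega> i) = distr M ?N (\<lambda>\<omega>. \<omega> i)" by (intro distr_cong) simp_all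
    also have "\<dots> = ?N" unfolding M_def by (rule distr_PiM_component) (use that N in auto)
    finally show ?thesis .
  qed
  show "distributed M lborel (\<lambda>\<omega>. \<omega> i) std_normal_density" if "i < n"
    using c[OF that] m[OF that] by (auto simp: distributed_def cong: distr_cong)
  have s: "sets (\<Pi>\<^sub>M i\<in>{..<n}. borel :: real measure) = sets M"
    unfolding M_def by (intro sets_PiM_cong) simp_all
  \<comment> \<open>Points of the product space are extensional, so restricting them changes nothing
    and the joint law of the coordinates is \<open>M\<close> itself.\<close>
  have "distr M (\<Pi>\<^sub>M i\<in>{..<n}. borel) (\<lambda>\<omega>. \<lambda>i\<in>{..<n}. \<omega> i) = distr M M (\<lambda>\<omega>. \<omega>)"
  proof (rule distr_cong)
    fix \<omega> assume "\<omega> \<in> space M"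
    then show "(\<lambda>i\<in>{..<n}. \<omega> i) = \<omega>" by (auto simp: M_def space_PiM PiE_def extensional_restrict)
  qed (use s in auto)
  also have "\<dots> = (\<Pi>\<^sub>M i\<in>{..<n}. distr M borel (\<lambda>\<omega>. \<omega> i))"
    using c unfolding M_def by (simp, intro PiM_cong) auto
  finally show "indep_vars (\<lambda>_. borel) (\<lambda>i \<omega>. \<omega> i) {..<n}"
    using n m by (subst indep_vars_iff_distr_eq_PiM') auto
qed

text \<open>From \<open>(u - x)^2 \<le> 2 * u^2 + 2 * x^2\<close>. This separates input and output
  as \<open>emutual_information_additive_noise_finite\<close> requires.\<close>

lemma normal_density_noise_ge:
  assumes N: "0 < N"
  shows "exp (- u\<^sup>2 / N) * exp (- x\<^sup>2 / N) / sqrt (2 * pi * N) \<le> normal_density 0 (sqrt N) (u - x)"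
proof -
  have "(u - x)\<^sup>2 \<le> 2 * u\<^sup>2 + 2 * x\<^sup>2"
    using zero_le_power2[of "u + x"] by (simp add: power2_eq_square algebra_simps)
  then have "(u - x)\<^sup>2 / (2 * N) \<le> (2 * u\<^sup>2 + 2 * x\<^sup>2) / (2 * N)"
    using N by (intro divide_right_mono) auto
  also have "\<dots> = u\<^sup>2 / N + x\<^sup>2 / N" by (simp add: add_divide_distrib)
  finally have "exp (- u\<^sup>2 / N) * exp (- x\<^sup>2 / N) \<le> exp (- (u - x)\<^sup>2 / (2 * N))"
    by (simp add: exp_add[symmetric])
  then show ?thesis using N by (simp add: normal_density_sqrt divide_right_mono)
qed

text \<open>The two noises form one noise vector in the plane. Its density is bounded, and the
  logarithm of its factored lower bound is quadratic in the output, hence integrable by the second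
  moments.\<close>

lemma noisy_pair_information_finite:
  assumes M: "prob_space M" and N: "0 < N"
    and ind: "indep_rv M (borel \<Otimes>\<^sub>M borel) (\<lambda>\<omega>. (x1 \<omega>, x2 \<omega>)) (borel \<Otimes>\<^sub>M borel) (\<lambda>\<omega>. (w1 \<omega>, w2 \<omega>))"
    and ww: "indep_rv M borel w1 borel w2"
    and w1: "distributed M lborel w1 (normal_density 0 (sqrt N))"
    and w2: "distributed M lborel w2 (normal_density 0 (sqrt N))"
    and x12: "integrable M (\<lambda>\<omega>. (x1 \<omega>)\<^sup>2)" "integrable M (\<lambda>\<omega>. (x2 \<omega>)\<^sup>2)"
  shows "emutual_information M (borel \<Otimes>\<^sub>M borel) (borel \<Otimes>\<^sub>M borel) (\<lambda>\<omega>. (x1 \<omega>, x2 \<omega>))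
      (\<lambda>\<omega>. (a * x1 \<omega> + w1 \<omega>, a * x2 \<omega> + w2 \<omega>)) < \<infinity>"
proof -
  interpret prob_space M by fact
  note [measurable] = indep_rvD(1,2)[OF ww]
  have [measurable]: "x1 \<in> borel_measurable M" "x2 \<in> borel_measurable M"
    using measurable_compose[OF indep_rvD(1)[OF ind] measurable_fst] measurable_compose[OF indep_rvD(1)[OF ind] measurable_snd]
    by simp_all
  let ?X = "\<lambda>\<omega>. (x1 \<omega>, x2 \<omega>)" and ?W = "\<lambda>\<omega>. (w1 \<omega>, w2 \<omega>)"
  let ?n = "normal_density 0 (sqrt N)"
  define k where "k = 1 / sqrt (2 * pi * N)"
  have k: "0 < k" using N by (simp add: k_def)
  have nk: "?n y \<le> k" for y using N by (simp add: normal_density_sqrt k_def divide_right_mono)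
  define \<psi> where "\<psi> = (\<lambda>z. ?n (fst z) * ?n (snd z))"
  define l where "l = (\<lambda>z :: real \<times> real. k * k * exp (- ((fst z)\<^sup>2 + (snd z)\<^sup>2) / N))"
  define \<eta> where "\<eta> = (\<lambda>z :: real \<times> real. exp (- ((a * fst z)\<^sup>2 + (a * snd z)\<^sup>2) / N))"
  have ind': "indep_rv M borel ?X borel ?W" using ind by (simp add: borel_prod)
  have W: "distributed M lborel ?W \<psi>"
    using distributed_indep_joint[OF ww w1 w2] by (simp add: lborel_prod \<psi>_def)
  have \<psi>m: "\<psi> \<in> borel_measurable borel" unfolding \<psi>_def borel_prod[symmetric] by measurable
  have lm: "l \<in> borel_measurable borel" unfolding l_def borel_prod[symmetric] by measurable
  have \<eta>m: "\<eta> \<in> borel_measurable borel" unfolding \<eta>_def borel_prod[symmetric] by measurable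
  have low: "l u * \<eta> x \<le> \<psi> (u - a *\<^sub>R x)" for u x
  proof -
    have "(exp (- (fst u)\<^sup>2 / N) * exp (- (a * fst x)\<^sup>2 / N) * k) * (exp (- (snd u)\<^sup>2 / N) * exp (- (a * snd x)\<^sup>2 / N) * k)
        \<le> ?n (fst u - a * fst x) * ?n (snd u - a * snd x)"
      using normal_density_noise_ge[OF N, of "fst u" "a * fst x"] normal_density_noise_ge[OF N, of "snd u" "a * snd x"] k
      by (intro mult_mono) (auto simp: k_def)
    also have "(exp (- (fst u)\<^sup>2 / N) * exp (- (a * fst x)\<^sup>2 / N) * k) * (exp (- (snd u)\<^sup>2 / N) * exp (- (a * snd x)\<^sup>2 / N) * k) = l u * \<eta> x"
      by (simp add: l_def \<eta>_def exp_add[symmetric] add_divide_distrib diff_divide_distrib algebra_simps)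
    finally show ?thesis by (simp add: \<psi>_def)
  qed
  have l: "ln (l z) = ln (k * k) - ((fst z)\<^sup>2 + (snd z)\<^sup>2) / N" for z
    using k by (simp add: l_def ln_mult add_divide_distrib diff_divide_distrib)
  have w2': "integrable M (\<lambda>\<omega>. (w1 \<omega>)\<^sup>2)" "integrable M (\<lambda>\<omega>. (w2 \<omega>)\<^sup>2)"
    using normal_square_integrable[OF N w1] normal_square_integrable[OF N w2] by auto
  have int: "integrable M (\<lambda>\<omega>. ln (l (a *\<^sub>R ?X \<omega> + ?W \<omega>)))"
    unfolding l using square_integrable_add[OF _ _ x12(1) w2'(1), of a 1] square_integrable_add[OF _ _ x12(2) w2'(2), of a 1]
    by simp
  have "emutual_information M borel borel ?X (\<lambda>\<omega>. a *\<^sub>R ?X \<omega> + ?W \<omega>) < \<infinity>"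
    by (rule emutual_information_additive_noise_finite[OF M ind' W _ \<psi>m _ _ lm _ \<eta>m _ low int, where c="k * k"])
      (use k nk in \<open>auto simp: \<psi>_def l_def \<eta>_def intro!: mult_mono\<close>)
  then show ?thesis by (simp add: borel_prod)
qed

text \<open>The third encoder sends pure noise and needs no rate, while the first two use the same
  \<open>a\<close>. Making \<open>a\<close> close to 1 lets them describe \<open>x 1\<close> and
  \<open>x 2\<close> so well that the difference of the outputs estimates \<open>x 3\<close>. Only
  existence of a finite rate matters, so it is chosen generously.\<close>

lemma RD_in_achievable:
  assumes s: "1 / 2 < s" and a: "0 \<le> a" "a < 1" and d: "3 * ((1 - a)\<^sup>2 + 2 * ((1 - a\<^sup>2) * s)) \<le> d"
  shows "\<exists>C. (C, C, 0, d) \<in> RD_in s"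
proof -
  \<comment> \<open>Five coordinates: 1, 2 and 3 drive the noises of the same index, 0 drives
    \<open>x 2\<close>, and 4 drives the innovation of \<open>x 1\<close>.\<close>
  let ?I = "{..<5 :: nat}"
  define M where "M = (\<Pi>\<^sub>M i\<in>?I. density lborel std_normal_density)"
  note P = std_normal_coordinates[of 5, folded M_def, simplified]
  interpret prob_space M by (rule P(1))
  define r t N where "r = 1 - 1 / (2 * s)" and "t = 1 - 1 / (4 * s)" and "N = (1 - a\<^sup>2) * s"
  have s0: "0 < s" and t: "0 < t" using s by (auto simp: t_def field_simps)
  have a2: "a\<^sup>2 < 1" using a by (simp add: power_less_one_iff)
  then have N: "0 < N" using s0 by (simp add: N_def)
  have r: "0 < r" "r < 1" using s by (auto simp: r_def field_simps)
  then have r2: "r\<^sup>2 < 1" by (simp add: power_less_one_iff)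
  have tr: "s * (1 - r\<^sup>2) = t"
    using s0 by (simp add: r_def t_def power2_eq_square field_simps)
  define xf where "xf i b = (if i = 1 then sqrt t * b 4 + r * (sqrt s * b 0) else if i = 2 then sqrt s * b 0
      else (sqrt t * b 4 + r * (sqrt s * b 0)) - sqrt s * b 0)" for i :: nat and b :: "nat \<Rightarrow> real"
  \<comment> \<open>Standard deviations of the noises; the third is 1 because
    \<open>\<alpha> 3 = 0\<close> leaves the full variance of \<open>x 3\<close> to the
    noise.\<close>
  define c where "c i = (if i = 3 then 1 else sqrt N)" for i :: nat
  define \<alpha> where "\<alpha> i = (if i = 3 then 0 else a)" for i :: nat
  define x where "x = (\<lambda>i \<omega>. xf i \<omega>)"
  define w where "w = (\<lambda>i \<omega> :: nat \<Rightarrow> real. c i * \<omega> i)"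
  define u where "u = (\<lambda>i \<omega>. \<alpha> i * x i \<omega> + w i \<omega>)"

  \<comment> \<open>All independence claims below reduce to disjointness of the coordinate sets
    involved.\<close>
  have block: "indep_rv M S (\<lambda>\<omega>. f (restrict \<omega> A)) T (\<lambda>\<omega>. g (restrict \<omega> B))"
    if "A \<inter> B = {}" "A \<subseteq> ?I" "B \<subseteq> ?I" "f \<in> measurable (vec_space A) S" "g \<in> measurable (vec_space B) T"
    for A B and f :: "_ \<Rightarrow> 'b" and g :: "_ \<Rightarrow> 'c" and S T
  proof -
    have "indep_var (vec_space A) (\<lambda>\<omega>. restrict (\<lambda>i. \<omega> i) A) (vec_space B) (\<lambda>\<omega>. restrict (\<lambda>i. \<omega> i) B)"
      by (rule indep_var_restrict[OF P(2) that(1-3)])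
    then have "indep_rv M (vec_space A) (\<lambda>\<omega>. restrict \<omega> A) (vec_space B) (\<lambda>\<omega>. restrict \<omega> B)"
      by (simp add: indep_rv_iff_indep_var)
    then show ?thesis using that(4,5) by (rule indep_rv_compose)
  qed
  have comp: "(\<lambda>b. b i) \<in> borel_measurable (vec_space A)" if "i \<in> A" for i :: nat and A
    using that by (rule measurable_component_singleton)
  have mxf: "xf i \<in> borel_measurable (vec_space A)" if "0 \<in> A" "4 \<in> A" for i A
    using comp[OF that(1)] comp[OF that(2)] unfolding xf_def by measurable
  have mwf: "(\<lambda>b. c i * b i) \<in> borel_measurable (vec_space A)" if "i \<in> A" for i A
    using comp[OF that] by measurable
  have muf: "(\<lambda>b. \<alpha> i * xf i b + c i * b i) \<in> borel_measurable (vec_space A)" if "0 \<in> A" "4 \<in> A" "i \<in> A" for i A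
    using mxf[OF that(1,2), of i] mwf[OF that(3)] by measurable
  have mRx: "(\<lambda>b. \<lambda>i\<in>B. xf i b) \<in> measurable (vec_space A) (vec_space B)" if "0 \<in> A" "4 \<in> A" for A B
    using that by (intro measurable_restrict mxf)
  have mRw: "(\<lambda>b. \<lambda>i\<in>B. c i * b i) \<in> measurable (vec_space A) (vec_space B)" if "B \<subseteq> A" for A B
    using that by (intro measurable_restrict mwf) blast
  have mRu: "(\<lambda>b. \<lambda>i\<in>B. \<alpha> i * xf i b + c i * b i) \<in> measurable (vec_space A) (vec_space B)" if "0 \<in> A" "4 \<in> A" "B \<subseteq> A" for A B
    using that by (intro measurable_restrict muf) blast+
  have xr: "xf i (restrict \<omega> A) = x i \<omega>" if "0 \<in> A" "4 \<in> A" for i A \<omega>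
    using that by (simp add: xf_def x_def)
  have coord[measurable]: "(\<lambda>\<omega>. \<omega> i) \<in> borel_measurable M" if "i < 5" for i
    using P(3)[OF that] by (simp add: distributed_def)
  have mx: "x i \<in> borel_measurable M" for i
    using coord[of 0] coord[of 4] unfolding x_def xf_def by measurable
  have mw: "w i \<in> borel_measurable M" if "i \<in> users" for i
    using coord[of i] that unfolding w_def by auto
  have mu: "u i \<in> borel_measurable M" if "i \<in> users" for i
    using mx[of i] mw[OF that] unfolding u_def by measurable
  have std: "distributed M lborel (\<lambda>\<omega>. \<omega> i) (normal_density 0 (sqrt 1))" if "i < 5" for i
    using P(3)[OF that] by simp
  have scaled: "distributed M lborel (\<lambda>\<omega>. sqrt v * \<omega> i) (normal_density 0 (sqrt v))" if "0 < v" "i < 5" for v i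
    using normal_cmult[OF _ _ std[OF that(2)], of "sqrt v"] that(1) by simp

  have src: "difference_source s M x"
  proof -
    have n: "distributed M lborel (\<lambda>\<omega>. sqrt t * \<omega> 4) (normal_density 0 (sqrt t))"
      and y: "distributed M lborel (\<lambda>\<omega>. sqrt s * \<omega> 0) (normal_density 0 (sqrt s))"
      using scaled[OF t, of 4] scaled[OF s0, of 0] by simp_all
    have "indep_rv M borel (\<lambda>\<omega>. sqrt t * restrict \<omega> {4} 4) borel (\<lambda>\<omega>. sqrt s * restrict \<omega> {0} 0)"
      using comp[of 4 "{4}"] comp[of 0 "{0}"] by (intro block[of "{4}" "{0}"]) auto
    then have ny: "indep_rv M borel (\<lambda>\<omega>. sqrt t * \<omega> 4) borel (\<lambda>\<omega>. sqrt s * \<omega> 0)" by simp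
    have "distributed M (lborel \<Otimes>\<^sub>M lborel) (\<lambda>\<omega>. (sqrt t * \<omega> 4 + r * (sqrt s * \<omega> 0), sqrt s * \<omega> 0))
        (\<lambda>(p, q). normal_density 0 (sqrt t) (fst (p - r * q, q)) * normal_density 0 (sqrt s) (snd (p - r * q, q)))"
      by (rule distributed_shear[OF distributed_indep_joint[OF ny n y]]) auto
    also have "(\<lambda>(p, q). normal_density 0 (sqrt t) (fst (p - r * q, q)) * normal_density 0 (sqrt s) (snd (p - r * q, q)))
        = binormal_density s (r * s) s"
    proof (rule ext, safe)
      fix p q :: real
      show "normal_density 0 (sqrt t) (fst (p - r * q, q)) * normal_density 0 (sqrt s) (snd (p - r * q, q))
          = binormal_density s (r * s) s (p, q)"
        using binormal_density_factor[OF s0 r2, of "p - r * q" q] by (simp add: tr)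
    qed
    finally show ?thesis
      using prob_space_axioms by (simp add: difference_source_def Let_def x_def xf_def r_def)
  qed
  note S = difference_sourceD[OF src s]
  have x3: "x 3 \<omega> = x 1 \<omega> - x 2 \<omega>" for \<omega> using S(7) by simp
  have gw: "gaussian M (w i) 0 ((1 - (\<alpha> i)\<^sup>2) * (if i = 3 then 1 else s))" if i: "i \<in> users" for i
  proof -
    have "(1 - (\<alpha> i)\<^sup>2) * (if i = 3 then 1 else s) = (c i)\<^sup>2"
      using N by (simp add: \<alpha>_def c_def N_def)
    moreover have "0 < c i" using N by (simp add: c_def)
    moreover have "distributed M lborel (w i) (normal_density 0 (sqrt ((c i)\<^sup>2)))"
      using scaled[of "(c i)\<^sup>2" i] \<open>0 < c i\<close> i unfolding w_def by auto
    ultimately show ?thesis using mw[OF i] by (simp add: gaussian_def)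
  qed
  have var: "variance (x i) = (if i = 3 then 1 else s)" if "i \<in> users" for i
    using that normal_variance[OF s0 S(5)] normal_variance[OF s0 S(3)] normal_variance[OF _ S(6)] by auto
  have iw: "indep_vars (\<lambda>_. borel) w users"
    unfolding w_def
    by (rule indep_vars_compose2[where M'="\<lambda>_. borel", OF indep_vars_subset[OF P(2)]]) auto
  have wx: "indep_var (vec_space users) (subvector users w) (vec_space users) (subvector users x)"
  proof -
    have "indep_rv M (vec_space users) (\<lambda>\<omega>. (\<lambda>b. \<lambda>i\<in>users. c i * b i) (restrict \<omega> users))
        (vec_space users) (\<lambda>\<omega>. (\<lambda>b. \<lambda>i\<in>users. xf i b) (restrict \<omega> {0, 4}))"
      by (rule block[OF _ _ _ mRw mRx]) auto
    moreover have "(\<lambda>\<omega>. (\<lambda>b. \<lambda>i\<in>users. c i * b i) (restrict \<omega> users)) = subvector users w"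
      by (auto simp: fun_eq_iff w_def)
    moreover have "(\<lambda>\<omega>. (\<lambda>b. \<lambda>i\<in>users. xf i b) (restrict \<omega> {0, 4})) = subvector users x"
      by (simp add: xr)
    ultimately show ?thesis by (simp only: indep_rv_iff_indep_var)
  qed

  have dist: "mmse M (x 3) u \<le> d"
  proof -
    let ?F = "vimage_algebra (space M) (subvector users u) (vec_space users)"
    have su: "subvector users u \<in> measurable M (vec_space users)"
      using mu by (intro measurable_subvector)
    have F: "subalgebra M ?F" by (rule subalgebra_vimage_algebra[OF su])
    have "subvector users u \<in> space M \<rightarrow> space (vec_space users)"
      using su by (auto dest: measurable_space)
    note m1 = measurable_vimage_algebra1[OF this]
    have uF: "u i \<in> borel_measurable ?F" if "i \<in> users" for i
      using measurable_compose[OF m1 comp[OF that]] that by simp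
    \<comment> \<open>Any square-integrable estimator bounds the minimal error from above; this one
      has error \<open>(1 - a) * x 3 - w 1 + w 2\<close>.\<close>
    let ?L = "\<lambda>\<omega>. 1 * u 1 \<omega> + (- 1) * u 2 \<omega>"
    have L: "?L \<in> borel_measurable ?F" using uF[of 1] uF[of 2] by measurable
    have x2: "integrable M (\<lambda>\<omega>. (x i \<omega>)\<^sup>2)" if "i \<in> users" for i
      using that normal_square_integrable[OF s0 S(5)] normal_square_integrable[OF s0 S(3)] normal_square_integrable[OF _ S(6)] by auto
    have w2: "integrable M (\<lambda>\<omega>. (w i \<omega>)\<^sup>2)" if "i \<in> users" for i by (rule gaussian_square_integrable[OF gw[OF that]])
    have u2: "integrable M (\<lambda>\<omega>. (u i \<omega>)\<^sup>2)" if "i \<in> users" for i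
      using square_integrable_add[OF mx mw[OF that] x2[OF that] w2[OF that], of "\<alpha> i" 1] by (simp add: u_def)
    have L2: "integrable M (\<lambda>\<omega>. (?L \<omega>)\<^sup>2)"
      by (rule square_integrable_add[OF mu mu u2 u2]) auto
    have "mmse M (x 3) u \<le> expectation (\<lambda>\<omega>. (x 3 \<omega> - ?L \<omega>)\<^sup>2)"
      unfolding mmse_def by (rule cond_exp_minimizes[OF F mx x2 L L2]) simp
    also have "\<dots> \<le> expectation (\<lambda>\<omega>. 3 * ((1 - a)\<^sup>2 * (x 3 \<omega>)\<^sup>2 + (w 1 \<omega>)\<^sup>2 + (w 2 \<omega>)\<^sup>2))"
    proof (rule integral_mono)
      show "integrable M (\<lambda>\<omega>. (x 3 \<omega> - ?L \<omega>)\<^sup>2)"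
        using square_integrable_add[OF mx _ x2 L2, of 3 1 "-1"] mu[of 1] mu[of 2]
        by (simp add: algebra_simps)
      show "integrable M (\<lambda>\<omega>. 3 * ((1 - a)\<^sup>2 * (x 3 \<omega>)\<^sup>2 + (w 1 \<omega>)\<^sup>2 + (w 2 \<omega>)\<^sup>2))"
        using x2[of 3] w2[of 1] w2[of 2] by simp
      fix \<omega>
      have e: "x 3 \<omega> - ?L \<omega> = (1 - a) * x 3 \<omega> + (- w 1 \<omega>) + w 2 \<omega>"
        by (simp add: u_def \<alpha>_def x3 algebra_simps)
      \<comment> \<open>This crude bound is the origin of the factor 3 in the hypothesis on
        \<open>d\<close>; it avoids all covariances.\<close>
      have "(p + q + z)\<^sup>2 \<le> 3 * (p\<^sup>2 + q\<^sup>2 + z\<^sup>2)" for p q z :: real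
        using zero_le_power2[of "p - q"] zero_le_power2[of "q - z"] zero_le_power2[of "p - z"]
        by (simp add: power2_eq_square algebra_simps)
      from this[of "(1 - a) * x 3 \<omega>" "- w 1 \<omega>" "w 2 \<omega>"]
      show "(x 3 \<omega> - ?L \<omega>)\<^sup>2 \<le> 3 * ((1 - a)\<^sup>2 * (x 3 \<omega>)\<^sup>2 + (w 1 \<omega>)\<^sup>2 + (w 2 \<omega>)\<^sup>2)"
        unfolding e by (simp add: power_mult_distrib)
    qed
    also have "\<dots> = 3 * ((1 - a)\<^sup>2 + 2 * ((1 - a\<^sup>2) * s))"
    proof -
      have "expectation (\<lambda>\<omega>. (w i \<omega>)\<^sup>2) = (1 - a\<^sup>2) * s" if "i = 1 \<or> i = 2" for i
        using gaussian_second_moment[OF gw[of i]] that by (auto simp: \<alpha>_def)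
      then show ?thesis
        using x2[of 3] w2[of 1] w2[of 2] normal_second_moment[OF _ S(6)] by simp
    qed
    also note d
    finally show ?thesis .
  qed
  have u: "u \<in> test_channels M x d"
    unfolding test_channels_def
  proof (intro CollectI conjI exI[of _ \<alpha>] exI[of _ w] ballI)
    show "0 \<le> \<alpha> i" "\<alpha> i \<le> 1" for i using a by (auto simp: \<alpha>_def)
    show "gaussian M (w i) 0 ((1 - (\<alpha> i)\<^sup>2) * variance (x i))" if "i \<in> users" for i
      using gw[OF that] var[OF that] by simp
    show "u i = (\<lambda>\<omega>. \<alpha> i * x i \<omega> + w i \<omega>)" for i by (simp add: u_def)
  qed (fact iw wx dist)+

  let ?X = "\<lambda>\<omega>. (x 1 \<omega>, x 2 \<omega>)" and ?U = "\<lambda>\<omega>. (u 1 \<omega>, u 2 \<omega>)"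
  let ?B = "borel \<Otimes>\<^sub>M borel :: (real \<times> real) measure"
  define K where "K = emutual_information M ?B ?B ?X ?U"
  have mX: "?X \<in> measurable M ?B" and mU: "?U \<in> measurable M ?B"
    using mx mu by (auto intro!: measurable_Pair)
  have K: "0 \<le> K" unfolding K_def by (rule emutual_information_nonneg[OF prob_space_axioms mX mU])
  have "K < \<infinity>"
  proof -
    have ind: "indep_rv M ?B (\<lambda>\<omega>. (\<lambda>b. (xf 1 b, xf 2 b)) (restrict \<omega> {0, 4})) ?B (\<lambda>\<omega>. (\<lambda>b. (c 1 * b 1, c 2 * b 2)) (restrict \<omega> {1, 2}))"
      by (rule block) (auto intro!: measurable_Pair mwf mxf)
    have ww: "indep_rv M borel (\<lambda>\<omega>. (\<lambda>b. c 1 * b 1) (restrict \<omega> {1})) borel (\<lambda>\<omega>. (\<lambda>b. c 2 * b 2) (restrict \<omega> {2}))"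
      by (rule block) (auto intro!: mwf)
    have w: "distributed M lborel (w i) (normal_density 0 (sqrt N))" if "i = 1 \<or> i = 2" for i
      using scaled[OF N, of i] that by (auto simp: w_def c_def)
    have "emutual_information M ?B ?B ?X (\<lambda>\<omega>. (a * x 1 \<omega> + w 1 \<omega>, a * x 2 \<omega> + w 2 \<omega>)) < \<infinity>"
    proof (rule noisy_pair_information_finite[OF prob_space_axioms N])
      show "indep_rv M ?B ?X ?B (\<lambda>\<omega>. (w 1 \<omega>, w 2 \<omega>))" using ind xr by (simp add: w_def)
      show "indep_rv M borel (w 1) borel (w 2)" using ww by (simp add: w_def)
      show "distributed M lborel (w 1) (normal_density 0 (sqrt N))" "distributed M lborel (w 2) (normal_density 0 (sqrt N))"
        by (intro w; simp)+
      show "integrable M (\<lambda>\<omega>. (x 1 \<omega>)\<^sup>2)" "integrable M (\<lambda>\<omega>. (x 2 \<omega>)\<^sup>2)"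
        by (rule normal_square_integrable[OF s0 S(5)], rule normal_square_integrable[OF s0 S(3)])
    qed
    then show ?thesis by (simp add: K_def u_def \<alpha>_def)
  qed
  with K obtain C where C: "K = ereal C" "0 \<le> C" by (cases K) auto
  \<comment> \<open>The information \<open>C\<close> of both pairs dominates every constraint, so
    each of the first two encoders alone pays for any \<open>A\<close> that contains it.\<close>
  define R where "R i = (if i = 3 then 0 else C)" for i :: nat

  have rate: "econditional_mutual_information M (vec_space A) (vec_space A) (vec_space (users - A))
      (subvector A x) (subvector A u) (subvector (users - A) u) \<le> ereal (\<Sum>i\<in>A. R i)" if A: "A \<subseteq> users" for A
  proof -
    let ?A' = "users - A"
    have sA: "subvector A x \<in> measurable M (vec_space A)" "subvector A u \<in> measurable M (vec_space A)"
      "subvector ?A' u \<in> measurable M (vec_space ?A')"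
      using A mx mu by (intro measurable_subvector; blast)+
    let ?I1 = "emutual_information M (vec_space A) (vec_space A \<Otimes>\<^sub>M vec_space ?A') (subvector A x) (\<lambda>\<omega>. (subvector A u \<omega>, subvector ?A' u \<omega>))"
    let ?I2 = "emutual_information M (vec_space A) (vec_space ?A') (subvector A x) (subvector ?A' u)"
    have I2: "0 \<le> ?I2" by (rule emutual_information_nonneg[OF prob_space_axioms sA(1,3)])
    have I1: "?I1 \<le> K"
    proof -
      define f where "f = (\<lambda>p :: real \<times> real. \<lambda>i\<in>A. if i = 1 then fst p else if i = 2 then snd p else fst p - snd p)"
      define g where "g = (\<lambda>q :: real \<times> real \<times> real. (\<lambda>i\<in>A. if i = 3 then fst q else if i = 1 then fst (snd q) else snd (snd q),
          \<lambda>i\<in>?A'. if i = 3 then fst q else if i = 1 then fst (snd q) else snd (snd q)))"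
      have f: "f \<in> measurable ?B (vec_space A)"
        unfolding f_def by (intro measurable_restrict) measurable
      have g: "g \<in> measurable (borel \<Otimes>\<^sub>M ?B) (vec_space A \<Otimes>\<^sub>M vec_space ?A')"
        unfolding g_def by (intro measurable_Pair measurable_restrict) measurable
      have mU3: "(\<lambda>\<omega>. (u 3 \<omega>, ?U \<omega>)) \<in> measurable M (borel \<Otimes>\<^sub>M ?B)"
        using mu by (intro measurable_Pair mU) auto
      have "subvector A x = (\<lambda>\<omega>. f (?X \<omega>))"
        using A x3 by (auto simp: f_def fun_eq_iff)
      moreover have "(\<lambda>\<omega>. (subvector A u \<omega>, subvector ?A' u \<omega>)) = (\<lambda>\<omega>. g (u 3 \<omega>, ?U \<omega>))"
        using A by (auto simp: g_def fun_eq_iff)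
      ultimately have "?I1 \<le> emutual_information M ?B (borel \<Otimes>\<^sub>M ?B) ?X (\<lambda>\<omega>. (u 3 \<omega>, ?U \<omega>))"
        using emutual_information_mono[OF prob_space_axioms mX mU3 f g] by simp
      also have "\<dots> \<le> K"
        unfolding K_def
      proof (rule emutual_information_indep_rv_le[OF prob_space_axioms mX mU])
        have "indep_rv M (?B \<Otimes>\<^sub>M ?B) (\<lambda>\<omega>. (\<lambda>b. ((xf 1 b, xf 2 b), (\<alpha> 1 * xf 1 b + c 1 * b 1, \<alpha> 2 * xf 2 b + c 2 * b 2))) (restrict \<omega> {0, 1, 2, 4}))
            borel (\<lambda>\<omega>. (\<lambda>b. c 3 * b 3) (restrict \<omega> {3}))"
          by (rule block) (auto intro!: measurable_Pair mwf mxf muf)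
        then show "indep_rv M (?B \<Otimes>\<^sub>M ?B) (\<lambda>\<omega>. (?X \<omega>, ?U \<omega>)) borel (u 3)"
          by (simp add: xr u_def w_def \<alpha>_def)
      qed
      finally show ?thesis .
    qed
    \<comment> \<open>In the first two cases the rate sum is zero, so the information itself has to
      vanish.\<close>
    consider "A = {}" | "A = {3}" | j where "j \<in> A" "j = 1 \<or> j = 2" using A by blast
    then show ?thesis
    proof cases
      case 1
      then have c0: "subvector A x = (\<lambda>_. \<lambda>_. undefined)" by (auto simp: fun_eq_iff)
      have sp: "(\<lambda>_. undefined) \<in> space (vec_space A)" using 1 by (simp add: space_PiM)
      have "?I1 = 0" "?I2 = 0"
        unfolding c0
        by (intro emutual_information_indep_rv[OF prob_space_axioms] indep_rv_const[OF _ sp] measurable_Pair sA(2,3))+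
      then show ?thesis using 1 by (simp add: econditional_mutual_information_def)
    next
      case 2
      have "indep_rv M (vec_space A \<Otimes>\<^sub>M vec_space ?A')
          (\<lambda>\<omega>. (\<lambda>b. (\<lambda>i\<in>A. xf i b, \<lambda>i\<in>?A'. \<alpha> i * xf i b + c i * b i)) (restrict \<omega> {0, 1, 2, 4}))
          (vec_space A) (\<lambda>\<omega>. (\<lambda>b. \<lambda>i\<in>A. c i * b i) (restrict \<omega> {3}))"
        using 2 by (intro block[OF _ _ _ measurable_Pair[OF mRx mRu] mRw]) auto
      moreover have "(\<lambda>\<omega>. (\<lambda>b. (\<lambda>i\<in>A. xf i b, \<lambda>i\<in>?A'. \<alpha> i * xf i b + c i * b i)) (restrict \<omega> {0, 1, 2, 4}))
          = (\<lambda>\<omega>. (subvector A x \<omega>, subvector ?A' u \<omega>))"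
        using 2 xr by (auto simp: fun_eq_iff u_def w_def)
      moreover have "(\<lambda>\<omega>. (\<lambda>b. \<lambda>i\<in>A. c i * b i) (restrict \<omega> {3})) = subvector A u"
        using 2 by (auto simp: fun_eq_iff u_def w_def \<alpha>_def)
      ultimately have ind: "indep_rv M (vec_space A \<Otimes>\<^sub>M vec_space ?A')
          (\<lambda>\<omega>. (subvector A x \<omega>, subvector ?A' u \<omega>)) (vec_space A) (subvector A u)"
        by (simp only:)
      have "?I1 \<le> ?I2"
        by (rule emutual_information_indep_rv_le[OF prob_space_axioms sA(1,3) ind])
      \<comment> \<open>Without finiteness the difference could be
        \<open>\<infinity> - \<infinity>\<close>, which counts as
        \<open>\<infinity>\<close>.\<close>
      moreover have "?I2 \<noteq> \<infinity>"
      proof -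
        have "emutual_information M (vec_space A) (vec_space ?A') (subvector A x)
            (\<lambda>\<omega>. snd (subvector A u \<omega>, subvector ?A' u \<omega>)) \<le> ?I1"
          by (rule emutual_information_mono[OF prob_space_axioms sA(1) measurable_Pair[OF sA(2,3)] _ measurable_snd,
                where f="\<lambda>b. b"]) simp
        then show ?thesis using I1 C(1) by auto
      qed
      ultimately have "?I1 - ?I2 \<le> 0"
        using I2 by (cases ?I1; cases ?I2) auto
      then show ?thesis using 2 by (simp add: econditional_mutual_information_def R_def zero_ereal_def)
    next
      case 3
      have "?I1 - ?I2 \<le> K - 0" by (rule ereal_minus_mono[OF I1 I2])
      also have "\<dots> = ereal (R j)" using 3 C by (auto simp: R_def)
      also have "\<dots> \<le> ereal (\<Sum>i\<in>A. R i)"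
      proof -
        have "R j \<le> (\<Sum>i\<in>A. R i)"
          using 3 C finite_subset[OF A] by (intro member_le_sum) (auto simp: R_def)
        then show ?thesis by simp
      qed
      finally show ?thesis by (simp add: econditional_mutual_information_def)
    qed
  qed
  have "(R 1, R 2, R 3, d) \<in> RD_in s"
    unfolding RD_in_def using src u rate by blast
  then show ?thesis by (auto simp: R_def)
qed

lemma RD_region_nonempty:
  assumes s: "1 / 2 < s" and d: "0 < d"
  shows "\<exists>C. (C, C, 0, d) \<in> RD_region s"
proof -
  \<comment> \<open>With \<open>a = 1 - e\<close> and \<open>e \<le> 1\<close> one has
    \<open>(1 - a)^2 \<le> e\<close> and \<open>1 - a^2 \<le> 2 * e\<close>, so the distortion is at
    most \<open>3 * e * (1 + 4 * s)\<close>.\<close>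
  define e where "e = min 1 (d / (3 * (1 + 4 * s)))"
  have e: "0 < e" "e \<le> 1" using s d by (auto simp: e_def)
  have "e * (3 * (1 + 4 * s)) \<le> d"
    using s by (simp add: e_def pos_le_divide_eq[symmetric])
  moreover have "(1 - (1 - e))\<^sup>2 + 2 * ((1 - (1 - e)\<^sup>2) * s) \<le> e + 4 * e * s"
  proof (rule add_mono)
    show "(1 - (1 - e))\<^sup>2 \<le> e" using e by (simp add: power2_eq_square mult_left_le)
    have "(1 - (1 - e)\<^sup>2) * s \<le> 2 * e * s"
      using s by (intro mult_right_mono) (auto simp: power2_eq_square algebra_simps)
    then show "2 * ((1 - (1 - e)\<^sup>2) * s) \<le> 4 * e * s" by linarith
  qed
  ultimately have "3 * ((1 - (1 - e))\<^sup>2 + 2 * ((1 - (1 - e)\<^sup>2) * s)) \<le> d"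
    by (simp add: algebra_simps)
  with e have "\<exists>C. (C, C, 0, d) \<in> RD_in s" by (intro RD_in_achievable[OF s, of "1 - e"]) auto
  moreover have "RD_in s \<subseteq> RD_region s"
    unfolding RD_region_def by (meson closure_subset hull_subset subset_trans)
  ultimately show ?thesis by blast
qed

section \<open>The minimal sum rate\<close>

text \<open>\<open>LEAST\<close> on the reals is meaningful only if a minimum exists, so attainment is needed as well
  as the bound.\<close>

lemma min_sum_rate_attained:
  assumes s: "1 \<le> s" and d: "0 < d"
  shows "\<exists>R1 R2. min_sum_rate s d = R1 + R2 \<and> (R1, R2, 0, d) \<in> RD_region s"
proof -
  \<comment> \<open>For slope 0 the bounds on the region hold for all
    \<open>s \<ge> 1\<close>.\<close>
  have nonneg: "0 \<le> R1" "0 \<le> R2" if "(R1, R2, 0, d) \<in> RD_region s" for R1 R2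
    using RD_region_bounds[OF _ s _ _ that, of 0] s by auto
  obtain C where C: "(C, C, 0, d) \<in> RD_region s" using RD_region_nonempty[of s d] s d by auto
  \<comment> \<open>Rate pairs worse than the known point \<open>(C, C)\<close> are cut off; with
    nonnegativity this leaves a compact set on which the sum attains its minimum.\<close>
  define T where "T = (\<lambda>p. (fst p, snd p, 0, d)) -` RD_region s \<inter> {p. fst p + snd p \<le> 2 * C}"
  have "closed T"
    unfolding T_def
    by (intro closed_Int closed_vimage closed_Collect_le continuous_intros) (simp add: RD_region_def)
  moreover have "T \<subseteq> cbox (0, 0) (2 * C, 2 * C)"
  proof
    fix p assume "p \<in> T"
    then have p: "(fst p, snd p, 0, d) \<in> RD_region s" "fst p + snd p \<le> 2 * C" by (auto simp: T_def)
    then show "p \<in> cbox (0, 0) (2 * C, 2 * C)"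
      using nonneg[OF p(1)] by (cases p) (auto simp: cbox_Pair_eq)
  qed
  ultimately have "compact T" using bounded_subset[OF bounded_cbox] compact_eq_bounded_closed by blast
  moreover have "(C, C) \<in> T" using C by (simp add: T_def)
  then have "T \<noteq> {}" by blast
  moreover have "continuous_on T (\<lambda>q. fst q + snd q)" by (intro continuous_intros)
  ultimately obtain p where p: "p \<in> T" and min: "\<And>q. q \<in> T \<Longrightarrow> fst p + snd p \<le> fst q + snd q"
    using continuous_attains_inf[of T "\<lambda>q. fst q + snd q"] by blast
  have "min_sum_rate s d = fst p + snd p"
    unfolding min_sum_rate_def
  proof (rule Least_equality)
    show "\<exists>R1 R2. fst p + snd p = R1 + R2 \<and> (R1, R2, 0, d) \<in> RD_region s"
      using p by (auto simp: T_def)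
    fix y assume "\<exists>R1 R2. y = R1 + R2 \<and> (R1, R2, 0, d) \<in> RD_region s"
    then obtain R1 R2 where y: "y = R1 + R2" "(R1, R2, 0, d) \<in> RD_region s" by blast
    show "fst p + snd p \<le> y"
    proof (cases "y \<le> 2 * C")
      case True
      then have "(R1, R2) \<in> T" using y by (simp add: T_def)
      then show ?thesis using min y(1) by fastforce
    next
      case False
      then show ?thesis using p by (simp add: T_def)
    qed
  qed
  then show ?thesis using p by (auto simp: T_def)
qed

theorem proposition2:
  fixes d :: real
  assumes "0 < d" and "d < 1"
  shows "filterlim (\<lambda>\<sigma>2. min_sum_rate \<sigma>2 d) at_top at_top"
  unfolding filterlim_at_top
proof
  fix Z :: real
  \<comment> \<open>The slope is chosen so that \<open>c * (1 - d)\<close> exceeds \<open>Z\<close>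
    by the additive constant 1 of the region bound; \<open>max Z 0\<close> keeps it
    nonnegative.\<close>
  define c where "c = (max Z 0 + 1) / (1 - d)"
  have c: "0 \<le> c" "c * (1 - d) = max Z 0 + 1" using assms by (auto simp: c_def)
  have "\<forall>\<^sub>F s in at_top. max 1 (max (c + 1) (2 powr (2 * c))) \<le> (s :: real)"
    by (rule eventually_ge_at_top)
  then show "\<forall>\<^sub>F s in at_top. Z \<le> min_sum_rate s d"
  proof eventually_elim
    case (elim s)
    then have s: "1 \<le> s" "c + 1 \<le> 4 * s" "2 powr (2 * c) \<le> 1 + s" using c by auto
    obtain R1 R2 where R: "min_sum_rate s d = R1 + R2" "(R1, R2, 0, d) \<in> RD_region s"
      using min_sum_rate_attained[OF s(1) assms(1)] by blast
    have "c * (1 - d) \<le> R1 + R2 + 1"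
      using RD_region_bounds(3)[OF c(1) s R(2)] by simp
    then show ?case using R(1) c(2) by simp
  qed
qed

end
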